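(* Let $t\in\mathbf C$, and let $s,s_0\in\overline{\mathbf R_\flat}$ be such that $s<\frac12$ and $0<s_0\le\frac12$. Let $\mathcal T_{0,t}$ and $S_0$ be the continuous linear operators on $\ell_0'(\mathbf N^{2d})$ and $\mathcal T_{0,t}^*$ the continuous linear operator on $\ell_0(\mathbf N^{2d})$ given by $$(\mathcal T_{0,t}c)(\alpha,\beta)=\sum_{\gamma\le\alpha,\beta}\left(\binom\alpha\gamma\binom\beta\gamma\right)^{1/2}t^{|\gamma|}c(\alpha-\gamma,\beta-\gamma),\qquad (S_0c)(\alpha,\beta)=i^{|\alpha+\beta|}c(\alpha,\beta),$$ $$(\mathcal T_{0,t}^*c)(\alpha,\beta)=\sum_{\gamma\in\mathbf N^d}\left(\binom{\alpha+\gamma}\gamma\binom{\beta+\gamma}\gamma\right)^{1/2}t^{|\gamma|}c(\alpha+\gamma,\beta+\gamma).$$ Then the following is true: (1) $\mathcal T_{0,t}$ restricts to homeomorphisms on $\ell_{\mathcal B,s}(\mathbf N^{2d})$, $\ell_{\mathcal B,s}^\star(\mathbf N^{2d})$, $\ell_{\mathcal B,0,s_0}(\mathbf N^{2d})$ and $\ell_{\mathcal B,0,s_0}^\star(\mathbf N^{2d})$, with inverse $\mathcal T_{0,-t}$, and $\mathcal T_{0,-t}=S_0^{-1}\circ\mathcal T_{0,t}\circ S_0$ on these spaces; (2) $\mathcal T_{0,t}^*$ on $\ell_0(\mathbf N^{2d})$ extends uniquely to homeomorphisms on $\ell_{\mathcal C,s}(\mathbf N^{2d})$, $\ell_{\mathcal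 C,s}^\star(\mathbf N^{2d})$, $\ell_{\mathcal C,0,s_0}(\mathbf N^{2d})$ and $\ell_{\mathcal C,0,s_0}^\star(\mathbf N^{2d})$, with inverse $\mathcal T_{0,-t}^*$, and $\mathcal T_{0,-t}^*=S_0^{-1}\circ\mathcal T_{0,t}^*\circ S_0$ on these spaces.
   Context: **Indices and weights.** $\mathbf N=\{0,1,2,\dots\}$. $\overline{\mathbf R_\flat}=[0,\infty)\cup\{\flat_\sigma:\sigma>0\}$, where the $\flat_\sigma$ are formal symbols, ordered so that $x_1<\flat_{\sigma_1}<\flat_{\sigma_2}<x_2$ whenever $x_1<\frac12\le x_2$ and $\sigma_1<\sigma_2$. For $r>0$ and $\alpha\in\mathbf N^d$: $\vartheta_{r,s}(\alpha)=e^{r|\alpha|^{1/(2s)}}$ if $s\in(0,\infty)$; $\vartheta_{r,s}(\alpha)=r^{|\alpha|}(\alpha!)^{1/(2\sigma)}$ if $s=\flat_\sigma$; $\vartheta_{r,0}(\alpha)=1$ if $|\alpha|\le r$ and $=\infty$ if $|\alpha|>r$. Conventions: $a/\infty=0$ for all $a\in(0,\infty]$, $\infty\cdot0=0$. For $\omega:\mathbf N^{2d}\to[0,\infty]$, $\ell_{[\omega]}$ is the set of $c:\mathbf N^{2d}\to\mathbf C$ with $\|c\,\omega\|_{\ell^p}<\infty$, with this (quasi-/semi-)norm, $p\in(0,\infty]$ fixed (the limit spaces below do not depend on $p$). **Spaces on $\mathbf N^{2d}=\mathbf N^d\times\mathbf N^d\ni(\alpha,\beta)$.** $\ell_0'$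 is the set of all sequences (topology of pointwise convergence); $\ell_0$ is the set of finitely supported sequences (the finest locally convex topology). With $\omega_{r_2,r_1}(\alpha,\beta)=\vartheta_{r_2,s}(\alpha)/\vartheta_{r_1,s}(\beta)$, $\omega^\star_{r_2,r_1}(\alpha,\beta)=\vartheta_{r_1,s}(\beta)/\vartheta_{r_2,s}(\alpha)$ and limits over positive parameters: $\ell_{\mathcal B,s}=\operatorname{proj\,lim}_{r_1}\operatorname{ind\,lim}_{r_2}\ell_{[\omega_{r_2,r_1}]}$, $\ell_{\mathcal B,0,s}=\operatorname{proj\,lim}_{r_2}\operatorname{ind\,lim}_{r_1}\ell_{[\omega_{r_2,r_1}]}$, $\ell_{\mathcal B,s}^\star=\operatorname{proj\,lim}_{r_2}\operatorname{ind\,lim}_{r_1}\ell_{[\omega^\star_{r_2,r_1}]}$, $\ell_{\mathcal B,0,s}^\star=\operatorname{proj\,lim}_{r_1}\operatorname{ind\,lim}_{r_2}\ell_{[\omega^\star_{r_2,r_1}]}$; $\ell_{\mathcal C,s}=\operatorname{ind\,lim}_{r_2}\operatorname{proj\,lim}_{r_1}\ell_{[\omega_{r_2,r_1}]}$, $\ell_{\mathcal C,0,s}=\operatorname{ind\,lim}_{r_1}\operatorname{proj\,lim}_{r_2}\ell_{[\omega_{r_2,r_1}]}$, $\ell_{\mathcal C,s}^\star=\operatorname{ind\,lim}_{r_1}\operatorname{proj\,lim}_{r_2}\ell_{[\omega^\star_{r_2,r_1}]}$, $\ell_{\mathcal C,0,s}^\star=\operatorname{ind\,lim}_{r_2}\operatorname{proj\,lim}_{r_1}\ell_{[\omega^\star_{r_2,r_1}]}$.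 As sets, projective/inductive limits are intersections/unions. Here $0^0=1$, and $\gamma\le\alpha,\beta$ means componentwise $\gamma\le\alpha$ and $\gamma\le\beta$. *)

theory Defs
  imports "HOL-Analysis.Analysis"
begin

section \<open>The index set of the spaces\<close>

text \<open>\<open>Num x\<close> is the real index \<open>x\<close> and \<open>Flat \<sigma>\<close> is the formal symbol \<open>\<flat>\<^sub>\<sigma>\<close>.
  The indices that occur are those in \<open>flat_reals\<close>; the order is defined on the whole
  datatype by the same rule.\<close>

datatype flat_real = Num real | Flat real

definition flat_reals :: "flat_real set" where
  "flat_reals = {Num x | x. 0 \<le> x} \<union> {Flat \<sigma> | \<sigma>. 0 < \<sigma>}"

instantiation flat_real :: linorder
begin

fun less_flat_real :: "flat_real \<Rightarrow> flat_real \<Rightarrow> bool" where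
  "less_flat_real (Num x) (Num y) = (x < y)"
| "less_flat_real (Flat \<sigma>) (Flat \<tau>) = (\<sigma> < \<tau>)"
| "less_flat_real (Num x) (Flat \<tau>) = (x < 1/2)"
| "less_flat_real (Flat \<sigma>) (Num y) = (1/2 \<le> y)"

definition less_eq_flat_real :: "flat_real \<Rightarrow> flat_real \<Rightarrow> bool" where
  "less_eq_flat_real a b \<longleftrightarrow> a < b \<or> a = b"

instance
proof
  fix x y z :: flat_real
  show "x < y \<longleftrightarrow> x \<le> y \<and> \<not> y \<le> x"
    by (cases x; cases y) (auto simp: less_eq_flat_real_def)
  show "x \<le> x"
    by (simp add: less_eq_flat_real_def)
  show "x \<le> z" if "x \<le> y" "y \<le> z"
    using that by (cases x; cases y; cases z) (auto simp: less_eq_flat_real_def)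
  show "x = y" if "x \<le> y" "y \<le> x"
    using that by (cases x; cases y) (auto simp: less_eq_flat_real_def)
  show "x \<le> y \<or> y \<le> x"
    by (cases x; cases y) (auto simp: less_eq_flat_real_def)
qed

end

section \<open>Multi-indices and weights\<close>

type_synonym 'd mindex = "nat ^ 'd"
type_synonym 'd seq2 = "'d mindex \<times> 'd mindex \<Rightarrow> complex"

definition mlen :: "'d::finite mindex \<Rightarrow> nat" where
  "mlen \<alpha> = (\<Sum>i\<in>UNIV. \<alpha> $ i)"

definition mfact :: "'d::finite mindex \<Rightarrow> nat" where
  "mfact \<alpha> = (\<Prod>i\<in>UNIV. fact (\<alpha> $ i))"

definition mbinom :: "'d::finite mindex \<Rightarrow> 'd mindex \<Rightarrow> nat" where
  "mbinom \<alpha> \<gamma> = (\<Prod>i\<in>UNIV. (\<alpha> $ i) choose (\<gamma> $ i))"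

fun vartheta :: "flat_real \<Rightarrow> real \<Rightarrow> 'd::finite mindex \<Rightarrow> ennreal" where
  "vartheta (Num s) r \<alpha> =
     (if s = 0 then (if real (mlen \<alpha>) \<le> r then 1 else \<infinity>)
      else ennreal (exp (r * real (mlen \<alpha>) powr (1 / (2 * s)))))"
| "vartheta (Flat \<sigma>) r \<alpha> = ennreal (r ^ mlen \<alpha> * real (mfact \<alpha>) powr (1 / (2 * \<sigma>)))"

text \<open>On \<open>ennreal\<close> one has \<open>a / \<infinity> = 0\<close> for all \<open>a\<close> (also \<open>a = \<infinity>\<close>) and \<open>\<infinity> * 0 = 0\<close>,
  which are the conventions needed for \<open>s = 0\<close>.\<close>

definition omega :: "flat_real \<Rightarrow> real \<Rightarrow> real \<Rightarrow> 'd::finite mindex \<times> 'd mindex \<Rightarrow> ennreal" where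
  "omega s r2 r1 = (\<lambda>(\<alpha>, \<beta>). vartheta s r2 \<alpha> / vartheta s r1 \<beta>)"

definition omega_star :: "flat_real \<Rightarrow> real \<Rightarrow> real \<Rightarrow> 'd::finite mindex \<times> 'd mindex \<Rightarrow> ennreal" where
  "omega_star s r2 r1 = (\<lambda>(\<alpha>, \<beta>). vartheta s r1 \<beta> / vartheta s r2 \<alpha>)"

section \<open>Weighted sequence spaces\<close>

definition epowr :: "ennreal \<Rightarrow> real \<Rightarrow> ennreal" where
  "epowr x a = (if x = \<infinity> then \<infinity> else ennreal (enn2real x powr a))"

definition lp_norm :: "ennreal \<Rightarrow> ('k \<Rightarrow> ennreal) \<Rightarrow> ennreal" where
  "lp_norm p f =
     (if p = \<infinity> then (SUP k. f k)
      else epowr (\<Sum>\<^sub>\<infinity>k. epowr (f k) (enn2real p)) (1 / enn2real p))"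

definition wnorm :: "ennreal \<Rightarrow> ('k \<Rightarrow> ennreal) \<Rightarrow> ('k \<Rightarrow> complex) \<Rightarrow> ennreal" where
  "wnorm p \<omega> c = lp_norm p (\<lambda>k. ennreal (cmod (c k)) * \<omega> k)"

text \<open>The space \<open>\<ell>\<^bsub>[\<omega>]\<^esub>\<close>, represented by its topology; the underlying set is the \<open>topspace\<close>.\<close>

definition ell_w :: "ennreal \<Rightarrow> ('k \<Rightarrow> ennreal) \<Rightarrow> ('k \<Rightarrow> complex) topology" where
  "ell_w p \<omega> = topology (\<lambda>U. U \<subseteq> {c. wnorm p \<omega> c < \<infinity>} \<and>
     (\<forall>c\<in>U. \<exists>\<epsilon>>0. \<forall>e. wnorm p \<omega> e < \<infinity> \<and> wnorm p \<omega> (\<lambda>k. e k - c k) < \<epsilon> \<longrightarrow> e \<in> U))"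

lemma openin_ell_w:
  "openin (ell_w p \<omega>) U \<longleftrightarrow> U \<subseteq> {c. wnorm p \<omega> c < \<infinity>} \<and>
     (\<forall>c\<in>U. \<exists>\<epsilon>>0. \<forall>e. wnorm p \<omega> e < \<infinity> \<and> wnorm p \<omega> (\<lambda>k. e k - c k) < \<epsilon> \<longrightarrow> e \<in> U)"
proof -
  let ?P = "\<lambda>U c \<epsilon>. \<forall>e. wnorm p \<omega> e < \<infinity> \<and> wnorm p \<omega> (\<lambda>k. e k - c k) < \<epsilon> \<longrightarrow> e \<in> U"
  let ?O = "\<lambda>U. U \<subseteq> {c. wnorm p \<omega> c < \<infinity>} \<and> (\<forall>c\<in>U. \<exists>\<epsilon>>0. ?P U c \<epsilon>)"
  have "istopology ?O"
    unfolding istopology_def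
  proof (intro conjI allI impI)
    fix S T assume S: "?O S" and T: "?O T"
    show "S \<inter> T \<subseteq> {c. wnorm p \<omega> c < \<infinity>}"
      using S by blast
    show "\<forall>c\<in>S \<inter> T. \<exists>\<epsilon>>0. ?P (S \<inter> T) c \<epsilon>"
    proof
      fix c assume "c \<in> S \<inter> T"
      then obtain e1 e2 where "e1 > 0" "?P S c e1" "e2 > 0" "?P T c e2"
        using S T by blast
      then have "min e1 e2 > 0" "?P (S \<inter> T) c (min e1 e2)"
        by auto
      then show "\<exists>\<epsilon>>0. ?P (S \<inter> T) c \<epsilon>"
        by blast
    qed
  next
    fix K assume K: "\<forall>S\<in>K. ?O S"
    show "\<Union> K \<subseteq> {c. wnorm p \<omega> c < \<infinity>}"
      using K by blast
    show "\<forall>c\<in>\<Union> K. \<exists>\<epsilon>>0. ?P (\<Union> K) c \<epsilon>"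
      using K by (meson UnionE UnionI)
  qed
  then show ?thesis
    by (simp add: ell_w_def)
qed

lemma topspace_ell_w: "topspace (ell_w p \<omega>) = {c. wnorm p \<omega> c < \<infinity>}"
proof
  show "topspace (ell_w p \<omega>) \<subseteq> {c. wnorm p \<omega> c < \<infinity>}"
    using openin_ell_w[of p \<omega> "topspace (ell_w p \<omega>)"] by simp
  have "openin (ell_w p \<omega>) {c. wnorm p \<omega> c < \<infinity>}"
    unfolding openin_ell_w by (auto intro: exI[of _ "1::ennreal"])
  then show "{c. wnorm p \<omega> c < \<infinity>} \<subseteq> topspace (ell_w p \<omega>)"
    by (rule openin_subset)
qed

section \<open>Locally convex topologies, projective and inductive limits\<close>

text \<open>Complex linear subspaces of a space of complex functions, and locally convex vector
  topologies on them (not required to be Hausdorff).\<close>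

definition lin_subspace :: "('k \<Rightarrow> complex) set \<Rightarrow> bool" where
  "lin_subspace X \<longleftrightarrow> (\<lambda>k. 0) \<in> X \<and> (\<forall>c\<in>X. \<forall>e\<in>X. (\<lambda>k. c k + e k) \<in> X) \<and>
     (\<forall>z. \<forall>c\<in>X. (\<lambda>k. z * c k) \<in> X)"

definition convex_set :: "('k \<Rightarrow> complex) set \<Rightarrow> bool" where
  "convex_set V \<longleftrightarrow> (\<forall>c\<in>V. \<forall>e\<in>V. \<forall>u::real. 0 \<le> u \<and> u \<le> 1 \<longrightarrow>
     (\<lambda>k. of_real (1 - u) * c k + of_real u * e k) \<in> V)"

definition locally_convex :: "('k \<Rightarrow> complex) topology \<Rightarrow> bool" where
  "locally_convex \<tau> \<longleftrightarrow> lin_subspace (topspace \<tau>) \<and>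
     continuous_map (prod_topology \<tau> \<tau>) \<tau> (\<lambda>(c, e). \<lambda>k. c k + e k) \<and>
     continuous_map (prod_topology euclidean \<tau>) \<tau> (\<lambda>(z, c). \<lambda>k. z * c k) \<and>
     (\<forall>U. openin \<tau> U \<and> (\<lambda>k. 0) \<in> U \<longrightarrow>
        (\<exists>V. openin \<tau> V \<and> (\<lambda>k. 0) \<in> V \<and> V \<subseteq> U \<and> convex_set V))"

text \<open>The finest locally convex topology on \<open>X\<close> among those with property \<open>Q\<close>, given as the
  supremum of these topologies. (The property \<open>Q\<close> is stable under suprema in both uses below.)\<close>

definition finest_lc ::
  "('k \<Rightarrow> complex) set \<Rightarrow> (('k \<Rightarrow> complex) topology \<Rightarrow> bool) \<Rightarrow> ('k \<Rightarrow> complex) topology" where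
  "finest_lc X Q = topology_generated_by
     {U. \<exists>\<tau>. locally_convex \<tau> \<and> topspace \<tau> = X \<and> Q \<tau> \<and> openin \<tau> U}"

text \<open>The limits of a family indexed by the positive reals, with respect to inclusions. The
  projective limit carries the coarsest topology making all inclusions into the \<open>E r\<close>
  continuous, the inductive limit the finest locally convex topology making all inclusions of
  the \<open>E r\<close> continuous.\<close>

definition proj_lim :: "(real \<Rightarrow> ('k \<Rightarrow> complex) topology) \<Rightarrow> ('k \<Rightarrow> complex) topology" where
  "proj_lim E = topology_generated_by
     {(\<Inter>r\<in>{0<..}. topspace (E r)) \<inter> U | r U. 0 < r \<and> openin (E r) U}"

definition ind_lim :: "(real \<Rightarrow> ('k \<Rightarrow> complex) topology) \<Rightarrow> ('k \<Rightarrow> complex) topology" where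
  "ind_lim E = finest_lc (\<Union>r\<in>{0<..}. topspace (E r)) (\<lambda>\<tau>. \<forall>r>0. continuous_map (E r) \<tau> id)"

lemma topspace_proj_lim: "topspace (proj_lim E) = (\<Inter>r\<in>{0<..}. topspace (E r))"
proof -
  have "(\<Inter>r\<in>{0<..}. topspace (E r)) \<inter> topspace (E 1) \<in>
      {(\<Inter>r\<in>{0<..}. topspace (E r)) \<inter> U | r U. 0 < r \<and> openin (E r) U}"
    using openin_topspace zero_less_one by blast
  moreover have "(\<Inter>r\<in>{0<..}. topspace (E r)) \<inter> topspace (E 1) = (\<Inter>r\<in>{0<..}. topspace (E r))"
    by auto
  ultimately show ?thesis
    unfolding proj_lim_def topology_generated_by_topspace by blast
qed

lemma topspace_finest_lc:
  assumes X: "lin_subspace X" and Q: "\<And>\<tau>. topspace \<tau> = X \<Longrightarrow> (\<And>U. openin \<tau> U \<longleftrightarrow> U = {} \<or> U = X) \<Longrightarrow> Q \<tau>"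
  shows "topspace (finest_lc X Q) = X"
proof -
  define \<tau> where "\<tau> = topology (\<lambda>U. U = {} \<or> U = X)"
  have "istopology (\<lambda>U. U = {} \<or> U = X)"
    unfolding istopology_def by blast
  then have op: "openin \<tau> U \<longleftrightarrow> U = {} \<or> U = X" for U
    by (simp add: \<tau>_def)
  then have top: "topspace \<tau> = X"
    by (auto simp: topspace_def)
  have cont: "continuous_map A \<tau> f" if "f \<in> topspace A \<rightarrow> X" for A :: "'c topology" and f
  proof -
    have *: "{x \<in> topspace A. f x \<in> X} = topspace A"
      using that by auto
    show ?thesis
      unfolding continuous_map using that by (auto simp: op top *)
  qed
  have "convex_set X"
    using X unfolding lin_subspace_def convex_set_def by simp
  moreover have "continuous_map (prod_topology \<tau> \<tau>) \<tau> (\<lambda>(c, e). \<lambda>k. c k + e k)"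
    using X by (intro cont) (auto simp: top lin_subspace_def)
  moreover have "continuous_map (prod_topology euclidean \<tau>) \<tau> (\<lambda>(z, c). \<lambda>k. z * c k)"
    using X by (intro cont) (auto simp: top lin_subspace_def)
  ultimately have "locally_convex \<tau>"
    using X unfolding locally_convex_def by (auto simp: top op)
  moreover have "Q \<tau>"
    using Q top op by blast
  ultimately show ?thesis
    unfolding finest_lc_def topology_generated_by_topspace
    using top openin_topspace[of \<tau>] openin_subset by fastforce
qed

lemma topspace_ind_lim:
  assumes "lin_subspace (\<Union>r\<in>{0<..}. topspace (E r))"
  shows "topspace (ind_lim E) = (\<Union>r\<in>{0<..}. topspace (E r))"
  unfolding ind_lim_def
proof (rule topspace_finest_lc[OF assms], intro allI impI)
  fix \<tau> and r :: real
  assume top: "topspace \<tau> = (\<Union>r\<in>{0<..}. topspace (E r))" and r: "0 < r"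
    and op: "\<And>U. openin \<tau> U \<longleftrightarrow> U = {} \<or> U = (\<Union>r\<in>{0<..}. topspace (E r))"
  have "{x \<in> topspace (E r). x \<in> (\<Union>r\<in>{0<..}. topspace (E r))} = topspace (E r)"
    using r by auto
  then show "continuous_map (E r) \<tau> id"
    unfolding continuous_map using r by (auto simp: op top)
qed

section \<open>The sequence spaces\<close>

definition ell0' :: "'d::finite seq2 topology" where
  "ell0' = product_topology (\<lambda>_. euclidean) UNIV"

definition ell0 :: "'d::finite seq2 topology" where
  "ell0 = finest_lc {c. finite {k. c k \<noteq> 0}} (\<lambda>_. True)"

definition ell_B :: "ennreal \<Rightarrow> flat_real \<Rightarrow> 'd::finite seq2 topology" where
  "ell_B p s = proj_lim (\<lambda>r1. ind_lim (\<lambda>r2. ell_w p (omega s r2 r1)))"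

definition ell_B0 :: "ennreal \<Rightarrow> flat_real \<Rightarrow> 'd::finite seq2 topology" where
  "ell_B0 p s = proj_lim (\<lambda>r2. ind_lim (\<lambda>r1. ell_w p (omega s r2 r1)))"

definition ell_B_star :: "ennreal \<Rightarrow> flat_real \<Rightarrow> 'd::finite seq2 topology" where
  "ell_B_star p s = proj_lim (\<lambda>r2. ind_lim (\<lambda>r1. ell_w p (omega_star s r2 r1)))"

definition ell_B0_star :: "ennreal \<Rightarrow> flat_real \<Rightarrow> 'd::finite seq2 topology" where
  "ell_B0_star p s = proj_lim (\<lambda>r1. ind_lim (\<lambda>r2. ell_w p (omega_star s r2 r1)))"

definition ell_C :: "ennreal \<Rightarrow> flat_real \<Rightarrow> 'd::finite seq2 topology" where
  "ell_C p s = ind_lim (\<lambda>r2. proj_lim (\<lambda>r1. ell_w p (omega s r2 r1)))"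

definition ell_C0 :: "ennreal \<Rightarrow> flat_real \<Rightarrow> 'd::finite seq2 topology" where
  "ell_C0 p s = ind_lim (\<lambda>r1. proj_lim (\<lambda>r2. ell_w p (omega s r2 r1)))"

definition ell_C_star :: "ennreal \<Rightarrow> flat_real \<Rightarrow> 'd::finite seq2 topology" where
  "ell_C_star p s = ind_lim (\<lambda>r1. proj_lim (\<lambda>r2. ell_w p (omega_star s r2 r1)))"

definition ell_C0_star :: "ennreal \<Rightarrow> flat_real \<Rightarrow> 'd::finite seq2 topology" where
  "ell_C0_star p s = ind_lim (\<lambda>r2. proj_lim (\<lambda>r1. ell_w p (omega_star s r2 r1)))"

section \<open>The operators\<close>

definition T0 :: "complex \<Rightarrow> 'd::finite seq2 \<Rightarrow> 'd seq2" where
  "T0 t c = (\<lambda>(\<alpha>, \<beta>). \<Sum>\<gamma> | \<gamma> \<le> \<alpha> \<and> \<gamma> \<le> \<beta>.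
     of_real (sqrt (real (mbinom \<alpha> \<gamma> * mbinom \<beta> \<gamma>))) * t ^ mlen \<gamma> * c (\<alpha> - \<gamma>, \<beta> - \<gamma>))"

definition S0 :: "'d::finite seq2 \<Rightarrow> 'd seq2" where
  "S0 c = (\<lambda>(\<alpha>, \<beta>). \<i> ^ mlen (\<alpha> + \<beta>) * c (\<alpha>, \<beta>))"

text \<open>Only used on finitely supported \<open>c\<close>, where the sum has finitely many nonzero terms.\<close>

definition T0_adj :: "complex \<Rightarrow> 'd::finite seq2 \<Rightarrow> 'd seq2" where
  "T0_adj t c = (\<lambda>(\<alpha>, \<beta>). \<Sum>\<^sub>\<infinity>\<gamma>.
     of_real (sqrt (real (mbinom (\<alpha> + \<gamma>) \<gamma> * mbinom (\<beta> + \<gamma>) \<gamma>))) * t ^ mlen \<gamma> *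
     c (\<alpha> + \<gamma>, \<beta> + \<gamma>))"

definition continuous_linear_op ::
  "('k \<Rightarrow> complex) topology \<Rightarrow> (('k \<Rightarrow> complex) \<Rightarrow> ('k \<Rightarrow> complex)) \<Rightarrow> bool" where
  "continuous_linear_op X f \<longleftrightarrow> continuous_map X X f \<and>
     (\<forall>c\<in>topspace X. \<forall>e\<in>topspace X. f (\<lambda>k. c k + e k) = (\<lambda>k. f c k + f e k)) \<and>
     (\<forall>z. \<forall>c\<in>topspace X. f (\<lambda>k. z * c k) = (\<lambda>k. z * f c k))"

text \<open>\<open>F\<close> is a continuous linear operator on \<open>X\<close> extending the operator \<open>f\<close> on \<open>Y \<subseteq> X\<close>, and
  on \<open>X\<close> it coincides with every continuous map extending \<open>f\<close>.\<close>

definition unique_extension ::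
  "('k \<Rightarrow> complex) topology \<Rightarrow> ('k \<Rightarrow> complex) topology \<Rightarrow>
    (('k \<Rightarrow> complex) \<Rightarrow> ('k \<Rightarrow> complex)) \<Rightarrow> (('k \<Rightarrow> complex) \<Rightarrow> ('k \<Rightarrow> complex)) \<Rightarrow> bool" where
  "unique_extension Y X f F \<longleftrightarrow>
     topspace Y \<subseteq> topspace X \<and> continuous_linear_op X F \<and> (\<forall>c\<in>topspace Y. F c = f c) \<and>
     (\<forall>G. continuous_map X X G \<and> (\<forall>c\<in>topspace Y. G c = f c) \<longrightarrow> (\<forall>c\<in>topspace X. G c = F c))"

end

theory Submission
  imports Defs
begin

text \<open>Both operators are given by a matrix supported on the pairs of indices that differ by a diagonal
  shift \<open>(\<gamma>, \<gamma>)\<close>, with entries bounded exponentially in the larger index; \<open>T0_adj\<close> has the transposed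
  matrix of \<open>T0\<close>. Along a diagonal shift, weight can be exchanged between the two indices, at the
  price of a change of the parameters, and this change also absorbs any exponential factor. The
  resulting exponential gain turns supremum bounds into \<open>\<ell>\<^sup>p\<close> bounds for every \<open>p\<close>, so the operators are
  bounded between the steps of the limits, in the order in which the quantifiers of the
  projective and the inductive limit ask for it. The same gain shows that truncations converge in
  the spaces of type \<open>C\<close>; as the coordinates are continuous there, a continuous map is determined
  by its values on finite sequences, which gives the uniqueness of the extension and the
  inversion formula. The latter comes from the binomial theorem, which gives \<open>T0 u (T0 t c) = T0 (t + u) c\<close>.\<close>

text \<open>The two ranges of the index come from the growth of the weights. The order of the limits
  decides whether the exponential size of the matrix entries has to be absorbed by a small parameter
  or may be absorbed by a large one. For real s > 0 a small parameter suffices once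
  |\<alpha>|^(1/(2s)) grows faster than |\<alpha>|, that is for s < 1/2; for s = 1/2 the growth is
  exactly linear, and the parameter must be allowed to grow. At \<open>Flat\<close> indices the
  parameter is itself the base of an exponential, so rescaling it works in both directions, and the
  factorials are comparable to products up to exponentials. Two obstacles shape the rest. For p < 1
  the steps are only quasi-normed, so continuity on an inductive limit is obtained from its
  universal property, by pulling back locally convex topologies, and not from a norm description of
  its neighbourhoods. For s = 0 the weights \<open>omega\<close> take the values 0, 1 and
  \<infinity>, so every estimate has to survive infinite weights.\<close>

lemma summable_on_ennreal': "(f :: 'a \<Rightarrow> ennreal) summable_on A"
  by (rule nonneg_summable_on_complete) simp

lemma sum_le_infsum_ennreal:
  fixes f :: "'a \<Rightarrow> ennreal"
  assumes "finite F" "F \<subseteq> A"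
  shows "sum f F \<le> infsum f A"
  using assms by (subst nonneg_infsum_complete) (auto intro!: SUP_upper)

lemma infsum_cmult_ennreal:
  fixes f :: "'a \<Rightarrow> ennreal"
  shows "(\<Sum>\<^sub>\<infinity>k\<in>A. c * f k) = c * infsum f A"
  by (simp add: nonneg_infsum_complete sum_distrib_left[symmetric] SUP_mult_left_ennreal)

section \<open>Powers and l^p quasi-norms with values in [0, \<infinity>]\<close>

lemma epowr_top [simp]: "epowr \<infinity> a = \<infinity>" "epowr top a = \<infinity>"
  by (simp_all add: epowr_def)

lemma epowr_ennreal: "0 \<le> x \<Longrightarrow> epowr (ennreal x) a = ennreal (x powr a)"
  by (simp add: epowr_def)

lemma epowr_less_top_iff: "epowr x a < top \<longleftrightarrow> x < top"
  by (simp add: epowr_def less_top)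

lemma epowr_mono:
  assumes "0 < a" "x \<le> y"
  shows "epowr x a \<le> epowr y a"
proof (cases "y = \<infinity>")
  case False
  then have "x < top" "y < top"
    using assms by (auto simp: less_top top_unique)
  then show ?thesis
    using assms by (auto simp: epowr_def enn2real_mono intro!: ennreal_leI powr_mono2)
qed simp

lemma epowr_max: "0 < a \<Longrightarrow> epowr (max x y) a = max (epowr x a) (epowr y a)"
  by (metis epowr_mono max.absorb1 max.absorb2 linear)

lemma epowr_mult:
  assumes "0 < a"
  shows "epowr (x * y) a = epowr x a * epowr y a"
proof -
  \<comment> \<open>The case z = 0 is the one to watch: \<open>top * 0 = 0\<close> and
    \<open>0 powr a = 0\<close>, so both sides vanish there.\<close>
  have *: "epowr (top * z) a = top * epowr z a" for z
    by (cases z) (auto simp: epowr_def ennreal_top_mult ennreal_zero_less_mult_iff)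
  consider "x = top" | "y = top" | r s where "0 \<le> r" "0 \<le> s" "x = ennreal r" "y = ennreal s"
    by (cases x; cases y) auto
  then show ?thesis
  proof cases
    case 1
    then show ?thesis
      using * by simp
  next
    case 2
    then show ?thesis
      using *[of x] by (simp add: mult.commute)
  next
    case 3
    then show ?thesis
      by (simp add: epowr_ennreal powr_mult flip: ennreal_mult)
  qed
qed

lemma epowr_epowr_inverse:
  assumes "0 < a"
  shows "epowr (epowr x a) (1 / a) = x" "epowr (epowr x (1 / a)) a = x"
  using assms by (cases x; simp add: epowr_ennreal powr_powr)+

lemma enn2real_pos: "0 < p \<Longrightarrow> p \<noteq> \<infinity> \<Longrightarrow> 0 < enn2real p"
  by (simp add: enn2real_positive_iff less_top)

lemma lp_norm_mono:
  assumes "0 < p" "\<And>k. f k \<le> g k"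
  shows "lp_norm p f \<le> lp_norm p g"
  using assms enn2real_pos[of p]
  by (auto simp: lp_norm_def intro!: SUP_mono epowr_mono infsum_mono summable_on_ennreal')

lemma le_lp_norm:
  assumes "0 < p"
  shows "f k \<le> lp_norm p f"
proof (cases "p = \<infinity>")
  case True
  then show ?thesis
    by (simp add: lp_norm_def SUP_upper)
next
  case False
  let ?q = "enn2real p"
  have q: "0 < ?q"
    using assms False by (rule enn2real_pos)
  have "sum (\<lambda>k. epowr (f k) ?q) {k} \<le> (\<Sum>\<^sub>\<infinity>k. epowr (f k) ?q)"
    by (rule sum_le_infsum_ennreal) auto
  then have "epowr (epowr (f k) ?q) (1 / ?q) \<le> epowr (\<Sum>\<^sub>\<infinity>k. epowr (f k) ?q) (1 / ?q)"
    using q by (intro epowr_mono) auto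
  then show ?thesis
    using False q by (simp add: lp_norm_def epowr_epowr_inverse)
qed

lemma lp_norm_cmult:
  assumes "0 < p"
  shows "lp_norm p (\<lambda>k. c * f k) = c * lp_norm p f"
  using enn2real_pos[OF assms]
  by (auto simp: lp_norm_def SUP_mult_left_ennreal epowr_mult infsum_cmult_ennreal epowr_epowr_inverse)

text \<open>Minkowski's inequality fails for p < 1; this quasi-triangle inequality covers all p at
  once. The maximum stands in place of a sum because it commutes with powers
  (\<open>epowr_max\<close>). For finite p the constant combines (x + y)^p \<le> 2^p max(x, y)^p,
  whose root is 2, with a factor 2 under the root from bounding a sum of two terms by twice their
  maximum.\<close>

lemma lp_norm_add_le_max:
  assumes "0 < p"
  shows "\<exists>C>0. \<forall>f g :: 'k \<Rightarrow> ennreal. lp_norm p (\<lambda>k. f k + g k) \<le> ennreal C * max (lp_norm p f) (lp_norm p g)"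
proof (cases "p = \<infinity>")
  case True
  have "lp_norm p (\<lambda>k. f k + g k) \<le> ennreal 2 * max (lp_norm p f) (lp_norm p g)" for f g :: "'k \<Rightarrow> ennreal"
  proof -
    have "f k + g k \<le> ennreal 2 * max (lp_norm p f) (lp_norm p g)" for k
      using add_mono[of "f k" "max (lp_norm p f) (lp_norm p g)" "g k" "max (lp_norm p f) (lp_norm p g)"]
        le_lp_norm[OF assms, of f k] le_lp_norm[OF assms, of g k]
      by (simp add: mult_2 max.coboundedI1 max.coboundedI2)
    then show ?thesis
      using True by (simp add: lp_norm_def SUP_le_iff)
  qed
  then show ?thesis
    by (intro exI[of _ 2]) auto
next
  case False
  let ?q = "enn2real p"
  have q: "0 < ?q"
    using assms False by (rule enn2real_pos)
  have "lp_norm p (\<lambda>k. f k + g k) \<le> ennreal (2 * 2 powr (1 / ?q)) * max (lp_norm p f) (lp_norm p g)"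
    for f g :: "'k \<Rightarrow> ennreal"
  proof -
    let ?F = "\<Sum>\<^sub>\<infinity>k. epowr (f k) ?q" and ?G = "\<Sum>\<^sub>\<infinity>k. epowr (g k) ?q"
    have pt: "epowr (f k + g k) ?q \<le> ennreal (2 powr ?q) * (epowr (f k) ?q + epowr (g k) ?q)" for k
    proof -
      have "f k + g k \<le> ennreal 2 * max (f k) (g k)"
        using add_mono[of "f k" "max (f k) (g k)" "g k" "max (f k) (g k)"] by (simp add: mult_2)
      then have "epowr (f k + g k) ?q \<le> epowr (ennreal 2 * max (f k) (g k)) ?q"
        by (rule epowr_mono[OF q])
      also have "\<dots> = ennreal (2 powr ?q) * max (epowr (f k) ?q) (epowr (g k) ?q)"
        using q by (simp add: epowr_mult epowr_max epowr_ennreal del: ennreal_numeral)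
      also have "\<dots> \<le> ennreal (2 powr ?q) * (epowr (f k) ?q + epowr (g k) ?q)"
        by (intro mult_left_mono) auto
      finally show ?thesis .
    qed
    have "(\<Sum>\<^sub>\<infinity>k. epowr (f k + g k) ?q) \<le> (\<Sum>\<^sub>\<infinity>k. ennreal (2 powr ?q) * (epowr (f k) ?q + epowr (g k) ?q))"
      by (intro infsum_mono pt summable_on_ennreal')
    also have "\<dots> = ennreal (2 powr ?q) * (?F + ?G)"
      by (simp add: infsum_cmult_ennreal infsum_add summable_on_ennreal')
    also have "\<dots> \<le> ennreal (2 powr ?q) * (ennreal 2 * max ?F ?G)"
      using add_mono[of ?F "max ?F ?G" ?G "max ?F ?G"] by (intro mult_left_mono) (auto simp: mult_2)
    finally have "epowr (\<Sum>\<^sub>\<infinity>k. epowr (f k + g k) ?q) (1 / ?q)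
        \<le> epowr (ennreal (2 powr ?q) * (ennreal 2 * max ?F ?G)) (1 / ?q)"
      using q by (intro epowr_mono) auto
    also have "\<dots> = ennreal 2 * (ennreal (2 powr (1 / ?q)) * max (epowr ?F (1 / ?q)) (epowr ?G (1 / ?q)))"
      using q by (simp add: epowr_mult epowr_max epowr_ennreal powr_powr del: ennreal_numeral)
    also have "\<dots> = ennreal (2 * 2 powr (1 / ?q)) * max (epowr ?F (1 / ?q)) (epowr ?G (1 / ?q))"
      by (simp add: ennreal_mult mult.assoc)
    finally show ?thesis
      using False by (simp add: lp_norm_def)
  qed
  then show ?thesis
    by (intro exI[of _ "2 * 2 powr (1 / ?q)"]) auto
qed

text \<open>The p-th power of (1/2)^n is q^n with q = (1/2)^p, so the geometric families have to be
  summable for every ratio in (0, 1).\<close>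

lemma lp_norm_geometric:
  assumes "0 < p"
    and h: "\<And>q. 0 < q \<Longrightarrow> q < 1 \<Longrightarrow> (\<Sum>\<^sub>\<infinity>k. ennreal (q ^ h k)) < \<infinity>"
  shows "lp_norm p (\<lambda>k. ennreal ((1/2) ^ h k)) < \<infinity>"
proof (cases "p = \<infinity>")
  case True
  have "lp_norm p (\<lambda>k. ennreal ((1/2) ^ h k)) \<le> 1"
    using True by (auto simp: lp_norm_def SUP_le_iff power_le_one)
  also have "\<dots> < \<infinity>"
    by simp
  finally show ?thesis .
next
  case False
  let ?q = "enn2real p"
  have q: "0 < ?q"
    using assms(1) False by (rule enn2real_pos)
  have "(1/2) powr ?q < (1/2) powr 0"
    using q by (intro powr_less_mono') auto
  then have "(\<Sum>\<^sub>\<infinity>k. ennreal (((1/2) powr ?q) ^ h k)) < \<infinity>"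
    by (intro h) auto
  moreover have "epowr (ennreal ((1/2) ^ h k)) ?q = ennreal (((1/2) powr ?q) ^ h k)" for k
    by (subst epowr_ennreal) (auto simp: powr_powr powr_realpow[symmetric] mult.commute)
  ultimately show ?thesis
    using False by (simp add: lp_norm_def epowr_less_top_iff)
qed

section \<open>Weighted sequence spaces and their limits\<close>

lemma ennreal_mult_less_if_small:
  assumes "0 < K" "0 < \<epsilon>"
  obtains \<delta> where "0 < \<delta>" "\<And>x. x < \<delta> \<Longrightarrow> ennreal K * x < \<epsilon>"
proof
  show "0 < \<epsilon> * ennreal (1 / K)"
    using assms by (simp add: ennreal_zero_less_mult_iff)
  fix x assume "x < \<epsilon> * ennreal (1 / K)"
  then have "x / ennreal (1 / K) < \<epsilon>"
    using assms by (subst divide_less_ennreal) auto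
  moreover have "x / ennreal (1 / K) = ennreal K * x"
    using assms by (simp add: divide_ennreal_def inverse_ennreal mult.commute)
  ultimately show "ennreal K * x < \<epsilon>"
    by simp
qed

lemma le_wnorm: "0 < p \<Longrightarrow> ennreal (cmod (c k)) * \<omega> k \<le> wnorm p \<omega> c"
  unfolding wnorm_def by (rule le_lp_norm)

lemma wnorm_mono:
  assumes "0 < p" "\<And>k. \<omega>' k \<le> \<omega> k"
  shows "wnorm p \<omega>' c \<le> wnorm p \<omega> c"
  unfolding wnorm_def using assms by (intro lp_norm_mono mult_left_mono) auto

lemma wnorm_cmult:
  assumes "0 < p"
  shows "wnorm p \<omega> (\<lambda>k. z * c k) = ennreal (cmod z) * wnorm p \<omega> c"
  unfolding wnorm_def lp_norm_cmult[OF assms, symmetric]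
  by (simp add: norm_mult ennreal_mult mult.assoc)

lemma wnorm_zero: "0 < p \<Longrightarrow> wnorm p \<omega> (\<lambda>k. 0) = 0"
  using wnorm_cmult[of p \<omega> 0 "\<lambda>k. 0"] by simp

lemma wnorm_add_le_max:
  assumes "0 < p"
  obtains C where "0 < C" "\<And>c e. wnorm p \<omega> (\<lambda>k. c k + e k) \<le> ennreal C * max (wnorm p \<omega> c) (wnorm p \<omega> e)"
proof -
  obtain C where C: "0 < C" "\<And>f g :: 'a \<Rightarrow> ennreal. lp_norm p (\<lambda>k. f k + g k) \<le> ennreal C * max (lp_norm p f) (lp_norm p g)"
    using lp_norm_add_le_max[OF assms] by metis
  show ?thesis
  proof
    fix c e :: "'a \<Rightarrow> complex"
    have "wnorm p \<omega> (\<lambda>k. c k + e k) \<le> lp_norm p (\<lambda>k. ennreal (cmod (c k)) * \<omega> k + ennreal (cmod (e k)) * \<omega> k)"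
      unfolding wnorm_def
      by (intro lp_norm_mono assms)
        (simp add: distrib_right[symmetric] mult_right_mono ennreal_leI norm_triangle_ineq flip: ennreal_plus)
    also have "\<dots> \<le> ennreal C * max (wnorm p \<omega> c) (wnorm p \<omega> e)"
      unfolding wnorm_def by (rule C)
    finally show "wnorm p \<omega> (\<lambda>k. c k + e k) \<le> ennreal C * max (wnorm p \<omega> c) (wnorm p \<omega> e)" .
  qed (rule C)
qed

lemma
  assumes "lin_subspace X" "c \<in> X"
  shows lin_subspace_add: "e \<in> X \<Longrightarrow> (\<lambda>k. c k + e k) \<in> X"
    and lin_subspace_scale: "(\<lambda>k. z * c k) \<in> X"
  using assms unfolding lin_subspace_def by blast+

lemma lin_subspace_diff:
  assumes "lin_subspace X" "c \<in> X" "e \<in> X"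
  shows "(\<lambda>k. c k - e k) \<in> X"
  using lin_subspace_add[OF assms(1,2) lin_subspace_scale[OF assms(1,3), of "- 1"]] by simp

lemma lin_subspace_INT: "(\<And>i. i \<in> I \<Longrightarrow> lin_subspace (X i)) \<Longrightarrow> lin_subspace (\<Inter>i\<in>I. X i)"
  by (simp add: lin_subspace_def)

lemma lin_subspace_directed_UN:
  assumes "I \<noteq> {}" "\<And>i. i \<in> I \<Longrightarrow> lin_subspace (X i)"
    and "\<And>i j. i \<in> I \<Longrightarrow> j \<in> I \<Longrightarrow> \<exists>l\<in>I. X i \<subseteq> X l \<and> X j \<subseteq> X l"
  shows "lin_subspace (\<Union>i\<in>I. X i)"
  unfolding lin_subspace_def
proof (intro conjI ballI allI)
  show "(\<lambda>k. 0) \<in> (\<Union>i\<in>I. X i)"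
    using assms(1,2) by (auto simp: lin_subspace_def)
  fix c assume c: "c \<in> (\<Union>i\<in>I. X i)"
  then show "(\<lambda>k. z * c k) \<in> (\<Union>i\<in>I. X i)" for z
    using assms(2) by (fastforce simp: lin_subspace_def)
  fix e assume "e \<in> (\<Union>i\<in>I. X i)"
  with c obtain l where "l \<in> I" "c \<in> X l" "e \<in> X l"
    using assms(3) by (metis UN_E subsetD)
  then show "(\<lambda>k. c k + e k) \<in> (\<Union>i\<in>I. X i)"
    using assms(2) by (auto simp: lin_subspace_def)
qed

lemma lin_subspace_ell_w:
  assumes "0 < p"
  shows "lin_subspace (topspace (ell_w p \<omega>))"
  unfolding lin_subspace_def topspace_ell_w
proof (intro conjI ballI allI)
  show "(\<lambda>k. 0) \<in> {c. wnorm p \<omega> c < \<infinity>}"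
    by (simp add: wnorm_zero assms)
  fix c assume c: "c \<in> {c. wnorm p \<omega> c < \<infinity>}"
  then show "(\<lambda>k. z * c k) \<in> {c. wnorm p \<omega> c < \<infinity>}" for z
    by (simp add: wnorm_cmult assms ennreal_mult_less_top)
  fix e assume e: "e \<in> {c. wnorm p \<omega> c < \<infinity>}"
  obtain C where C: "wnorm p \<omega> (\<lambda>k. c k + e k) \<le> ennreal C * max (wnorm p \<omega> c) (wnorm p \<omega> e)"
    using wnorm_add_le_max[OF assms] by metis
  also have "\<dots> < \<infinity>"
    using c e by (simp add: ennreal_mult_less_top)
  finally show "(\<lambda>k. c k + e k) \<in> {c. wnorm p \<omega> c < \<infinity>}"
    by simp
qed

text \<open>For \<open>p < 1\<close> a ball need not be open, but the quasi-triangle inequality makes its interior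
  contain the centre.\<close>

lemma ell_w_nbhd:
  assumes "0 < p" "c \<in> topspace (ell_w p \<omega>)" "0 < \<epsilon>"
  obtains N where "openin (ell_w p \<omega>) N" "c \<in> N" "\<And>e. e \<in> N \<Longrightarrow> wnorm p \<omega> (\<lambda>k. e k - c k) < \<epsilon>"
proof -
  let ?X = "topspace (ell_w p \<omega>)"
  obtain C where C: "0 < C" "\<And>c e. wnorm p \<omega> (\<lambda>k. c k + e k) \<le> ennreal C * max (wnorm p \<omega> c) (wnorm p \<omega> e)"
    using wnorm_add_le_max[OF assms(1)] by metis
  define N where "N = {x \<in> ?X. \<exists>\<delta>>0. \<forall>e\<in>?X. wnorm p \<omega> (\<lambda>k. e k - x k) < \<delta> \<longrightarrow> wnorm p \<omega> (\<lambda>k. e k - c k) < \<epsilon>}"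
  show thesis
  proof
    show "c \<in> N"
      using assms by (auto simp: N_def)
    show "wnorm p \<omega> (\<lambda>k. e k - c k) < \<epsilon>" if "e \<in> N" for e
    proof -
      obtain \<delta> where \<delta>: "0 < \<delta>" "\<And>e'. e' \<in> ?X \<Longrightarrow> wnorm p \<omega> (\<lambda>k. e' k - e k) < \<delta> \<Longrightarrow> wnorm p \<omega> (\<lambda>k. e' k - c k) < \<epsilon>"
        using \<open>e \<in> N\<close> unfolding N_def by blast
      have "e \<in> ?X"
        using that by (simp add: N_def)
      then show ?thesis
        using \<delta>(2)[of e] \<delta>(1) by (simp add: wnorm_zero[OF assms(1)])
    qed
    show "openin (ell_w p \<omega>) N"
      unfolding openin_ell_w
    proof (intro conjI ballI)
      show "N \<subseteq> {c. wnorm p \<omega> c < \<infinity>}"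
        by (auto simp: N_def topspace_ell_w)
      fix x assume "x \<in> N"
      then obtain \<delta> where \<delta>: "0 < \<delta>" "\<And>e. e \<in> ?X \<Longrightarrow> wnorm p \<omega> (\<lambda>k. e k - x k) < \<delta> \<Longrightarrow> wnorm p \<omega> (\<lambda>k. e k - c k) < \<epsilon>"
        unfolding N_def by blast
      obtain \<eta> where \<eta>: "0 < \<eta>" "\<And>x. x < \<eta> \<Longrightarrow> ennreal C * x < \<delta>"
        using ennreal_mult_less_if_small[OF C(1) \<delta>(1)] by metis
      have "y \<in> N" if y: "wnorm p \<omega> y < \<infinity>" "wnorm p \<omega> (\<lambda>k. y k - x k) < \<eta>" for y
      proof -
        have "wnorm p \<omega> (\<lambda>k. e k - c k) < \<epsilon>" if e: "e \<in> ?X" "wnorm p \<omega> (\<lambda>k. e k - y k) < \<eta>" for e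
        proof (rule \<delta>(2)[OF e(1)])
          have "wnorm p \<omega> (\<lambda>k. e k - x k) = wnorm p \<omega> (\<lambda>k. (e k - y k) + (y k - x k))"
            by simp
          also have "\<dots> \<le> ennreal C * max (wnorm p \<omega> (\<lambda>k. e k - y k)) (wnorm p \<omega> (\<lambda>k. y k - x k))"
            by (rule C)
          also have "\<dots> < \<delta>"
            using e y by (intro \<eta>) simp
          finally show "wnorm p \<omega> (\<lambda>k. e k - x k) < \<delta>" .
        qed
        then show ?thesis
          using y \<eta>(1) by (auto simp: N_def topspace_ell_w)
      qed
      then show "\<exists>\<epsilon>>0. \<forall>e. wnorm p \<omega> e < \<infinity> \<and> wnorm p \<omega> (\<lambda>k. e k - x k) < \<epsilon> \<longrightarrow> e \<in> N"
        using \<eta>(1) by blast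
    qed
  qed
qed

text \<open>Linearity relative to a set: the series in \<open>T0_adj\<close> can be added termwise
  only where it converges, and \<open>infsum\<close> returns 0 elsewhere.\<close>

definition linear_op_on :: "('k \<Rightarrow> complex) set \<Rightarrow> (('k \<Rightarrow> complex) \<Rightarrow> ('l \<Rightarrow> complex)) \<Rightarrow> bool" where
  "linear_op_on X f \<longleftrightarrow>
     (\<forall>c\<in>X. \<forall>e\<in>X. f (\<lambda>k. c k + e k) = (\<lambda>k. f c k + f e k)) \<and>
     (\<forall>z. \<forall>c\<in>X. f (\<lambda>k. z * c k) = (\<lambda>k. z * f c k))"

lemma linear_op_on_subset: "linear_op_on X f \<Longrightarrow> Y \<subseteq> X \<Longrightarrow> linear_op_on Y f"
  unfolding linear_op_on_def by blast

lemma
  assumes "linear_op_on X f" "c \<in> X"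
  shows linear_op_on_add: "e \<in> X \<Longrightarrow> f (\<lambda>k. c k + e k) = (\<lambda>k. f c k + f e k)"
    and linear_op_on_scale: "f (\<lambda>k. z * c k) = (\<lambda>k. z * f c k)"
  using assms unfolding linear_op_on_def by blast+

lemma linear_op_on_diff:
  assumes "linear_op_on X f" "lin_subspace X" "c \<in> X" "e \<in> X"
  shows "f (\<lambda>k. c k - e k) = (\<lambda>k. f c k - f e k)"
  using linear_op_on_add[OF assms(1,3) lin_subspace_scale[OF assms(2,4), of "- 1"]]
    linear_op_on_scale[OF assms(1,4), of "- 1"] by simp

lemma linear_op_on_zero:
  assumes "linear_op_on X f" "lin_subspace X"
  shows "f (\<lambda>k. 0) = (\<lambda>k. 0)"
  using linear_op_on_diff[OF assms, of "\<lambda>k. 0" "\<lambda>k. 0"] assms(2) by (simp add: lin_subspace_def)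

text \<open>Linearity reduces continuity to the bound for differences. The domain \<open>Z\<close>
  may be a smaller space with a finer topology than \<open>ell_w p \<omega>\<close>: for operators
  on a projective stage, the estimate holds for elements of the stage, with \<omega> chosen in
  dependence on \<omega>'.\<close>

lemma continuous_map_ell_w:
  assumes "0 < p" "lin_subspace (topspace Z)" and id: "continuous_map Z (ell_w p \<omega>) id"
    and T: "linear_op_on (topspace Z) T" and K: "0 < K"
    and bound: "\<And>c. c \<in> topspace Z \<Longrightarrow> wnorm p \<omega>' (T c) \<le> ennreal K * wnorm p \<omega> c"
  shows "continuous_map Z (ell_w p \<omega>') T"
  unfolding continuous_map
proof (intro conjI allI impI)
  have Z: "c \<in> topspace Z \<Longrightarrow> wnorm p \<omega> c < \<infinity>" for c
    using continuous_map_image_subset_topspace[OF id] by (auto simp: topspace_ell_w)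
  have T_Z: "wnorm p \<omega>' (T c) < \<infinity>" if "c \<in> topspace Z" for c
    using bound[OF that] Z[OF that] by (simp add: ennreal_mult_less_top le_less_trans)
  then show "T ` topspace Z \<subseteq> topspace (ell_w p \<omega>')"
    by (auto simp: topspace_ell_w)
  fix U assume U: "openin (ell_w p \<omega>') U"
  show "openin Z {c \<in> topspace Z. T c \<in> U}"
  proof (subst openin_subopen, intro ballI)
    fix c assume c: "c \<in> {c \<in> topspace Z. T c \<in> U}"
    then obtain \<epsilon> where \<epsilon>: "0 < \<epsilon>"
      "\<And>e. wnorm p \<omega>' e < \<infinity> \<Longrightarrow> wnorm p \<omega>' (\<lambda>k. e k - T c k) < \<epsilon> \<Longrightarrow> e \<in> U"
      using U unfolding openin_ell_w by blast
    obtain \<delta> where \<delta>: "0 < \<delta>" "\<And>x. x < \<delta> \<Longrightarrow> ennreal K * x < \<epsilon>"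
      using ennreal_mult_less_if_small[OF K \<epsilon>(1)] by metis
    have c_ell: "c \<in> topspace (ell_w p \<omega>)"
      using c Z by (simp add: topspace_ell_w)
    obtain N where N: "openin (ell_w p \<omega>) N" "c \<in> N" "\<And>e. e \<in> N \<Longrightarrow> wnorm p \<omega> (\<lambda>k. e k - c k) < \<delta>"
      using ell_w_nbhd[OF assms(1) c_ell \<delta>(1)] by metis
    have "openin Z {x \<in> topspace Z. id x \<in> N}"
      using id N(1) by (rule openin_continuous_map_preimage)
    moreover have "T e \<in> U" if e: "e \<in> topspace Z" "e \<in> N" for e
    proof (rule \<epsilon>(2)[OF T_Z[OF e(1)]])
      have "wnorm p \<omega>' (\<lambda>k. T e k - T c k) = wnorm p \<omega>' (T (\<lambda>k. e k - c k))"
        using c e by (subst linear_op_on_diff[OF T assms(2)]) auto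
      also have "\<dots> \<le> ennreal K * wnorm p \<omega> (\<lambda>k. e k - c k)"
        using c e by (intro bound lin_subspace_diff assms(2)) auto
      also have "\<dots> < \<epsilon>"
        by (intro \<delta> N e)
      finally show "wnorm p \<omega>' (\<lambda>k. T e k - T c k) < \<epsilon>" .
    qed
    ultimately show "\<exists>V. openin Z V \<and> c \<in> V \<and> V \<subseteq> {c \<in> topspace Z. T c \<in> U}"
      using c N(2) by (intro exI[of _ "{x \<in> topspace Z. id x \<in> N}"]) auto
  qed
qed

section \<open>Universal properties of projective and inductive limits\<close>

lemma continuous_map_proj_lim_id:
  assumes "0 < r"
  shows "continuous_map (proj_lim E) (E r) id"
  unfolding continuous_map
proof (intro conjI allI impI)
  show "id ` topspace (proj_lim E) \<subseteq> topspace (E r)"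
    using assms by (auto simp: topspace_proj_lim)
  fix U assume "openin (E r) U"
  then have "openin (proj_lim E) ((\<Inter>r\<in>{0<..}. topspace (E r)) \<inter> U)"
    unfolding proj_lim_def using assms by (intro topology_generated_by_Basis) auto
  moreover have "{x \<in> topspace (proj_lim E). id x \<in> U} = (\<Inter>r\<in>{0<..}. topspace (E r)) \<inter> U"
    by (auto simp: topspace_proj_lim)
  ultimately show "openin (proj_lim E) {x \<in> topspace (proj_lim E). id x \<in> U}"
    by simp
qed

lemma continuous_map_into_proj_lim:
  assumes "\<And>r. 0 < r \<Longrightarrow> continuous_map Z (E r) f"
  shows "continuous_map Z (proj_lim E) f"
  unfolding proj_lim_def
proof (rule continuous_on_generated_topo)
  let ?P = "\<Inter>r\<in>{0<..}. topspace (E r)"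
  have P: "f c \<in> ?P" if "c \<in> topspace Z" for c
  proof (rule INT_I)
    fix r :: real assume "r \<in> {0<..}"
    then show "f c \<in> topspace (E r)"
      using continuous_map_image_subset_topspace[OF assms] that by auto
  qed
  have "\<Union> {?P \<inter> U | r U. 0 < r \<and> openin (E r) U} = ?P"
    using topspace_proj_lim[of E] by (simp only: proj_lim_def topology_generated_by_topspace)
  then show "f ` topspace Z \<subseteq> \<Union> {?P \<inter> U | r U. 0 < r \<and> openin (E r) U}"
    using P by (simp only: image_subset_iff) blast
  fix V assume "V \<in> {?P \<inter> U | r U. 0 < r \<and> openin (E r) U}"
  then obtain r U where V: "V = ?P \<inter> U" "0 < r" "openin (E r) U"
    by blast
  have "f -` V \<inter> topspace Z = {c \<in> topspace Z. f c \<in> U}"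
    using P V by auto
  then show "openin Z (f -` V \<inter> topspace Z)"
    using openin_continuous_map_preimage[OF assms[OF V(2)] V(3)] by simp
qed

lemma continuous_map_proj_lim:
  assumes "\<And>r. 0 < r \<Longrightarrow> \<exists>r'>0. continuous_map (E r') (F r) f"
  shows "continuous_map (proj_lim E) (proj_lim F) f"
proof (rule continuous_map_into_proj_lim)
  fix r :: real assume "0 < r"
  then obtain r' where "0 < r'" "continuous_map (E r') (F r) f"
    using assms by blast
  then show "continuous_map (proj_lim E) (F r) f"
    using continuous_map_compose[OF continuous_map_proj_lim_id[of r' E], of "F r" f] by simp
qed

lemma continuous_map_into_finest_lc:
  assumes "\<And>\<tau>. locally_convex \<tau> \<Longrightarrow> topspace \<tau> = X \<Longrightarrow> Q \<tau> \<Longrightarrow> continuous_map Z \<tau> f"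
    and "topspace (finest_lc X Q) = X" "f \<in> topspace Z \<rightarrow> X"
  shows "continuous_map Z (finest_lc X Q) f"
  unfolding finest_lc_def
proof (rule continuous_on_generated_topo)
  have "\<Union> {U. \<exists>\<tau>. locally_convex \<tau> \<and> topspace \<tau> = X \<and> Q \<tau> \<and> openin \<tau> U} = X"
    using assms(2) by (simp only: finest_lc_def topology_generated_by_topspace)
  then show "f ` topspace Z \<subseteq> \<Union> {U. \<exists>\<tau>. locally_convex \<tau> \<and> topspace \<tau> = X \<and> Q \<tau> \<and> openin \<tau> U}"
    using assms(3) by (simp only: image_subset_iff Pi_iff)
  fix U assume "U \<in> {U. \<exists>\<tau>. locally_convex \<tau> \<and> topspace \<tau> = X \<and> Q \<tau> \<and> openin \<tau> U}"
  then obtain \<tau> where \<tau>: "locally_convex \<tau>" "topspace \<tau> = X" "Q \<tau>" "openin \<tau> U"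
    by blast
  then have "openin Z {x \<in> topspace Z. f x \<in> U}"
    by (intro openin_continuous_map_preimage[OF assms(1)])
  then show "openin Z (f -` U \<inter> topspace Z)"
    by (simp add: vimage_def Collect_conj_eq Int_commute)
qed

lemma continuous_map_finest_lc_id:
  assumes "locally_convex \<tau>" "topspace \<tau> = X" "Q \<tau>" "topspace (finest_lc X Q) = X"
  shows "continuous_map (finest_lc X Q) \<tau> id"
  unfolding continuous_map
proof (intro conjI allI impI)
  show "id ` topspace (finest_lc X Q) \<subseteq> topspace \<tau>"
    using assms by simp
  fix U assume U: "openin \<tau> U"
  then have "openin (finest_lc X Q) U"
    unfolding finest_lc_def using assms by (intro topology_generated_by_Basis) blast
  moreover have "{x \<in> topspace (finest_lc X Q). id x \<in> U} = U"
    using openin_subset[OF U] assms by auto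
  ultimately show "openin (finest_lc X Q) {x \<in> topspace (finest_lc X Q). id x \<in> U}"
    by simp
qed

text \<open>The pullback of a locally convex topology along a linear map is a candidate for the
  supremum in \<open>finest_lc\<close>; this drives the universal property of the inductive limit.
  Convex sets pull back to convex sets, so the neighbourhood condition is inherited.\<close>

lemma locally_convex_pullback:
  assumes \<tau>: "locally_convex \<tau>" and X: "lin_subspace X" and T: "linear_op_on X T"
    and TX: "T \<in> X \<rightarrow> topspace \<tau>"
  shows "locally_convex (pullback_topology X T \<tau>)" (is "locally_convex ?\<sigma>")
proof -
  have top: "topspace ?\<sigma> = X"
    using TX by (auto simp: topspace_pullback_topology)
  have cT: "continuous_map ?\<sigma> \<tau> T"
    using continuous_map_pullback[OF continuous_map_id, of X T \<tau>] by simp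
  have "continuous_map (prod_topology ?\<sigma> ?\<sigma>) (prod_topology \<tau> \<tau>) (\<lambda>x. (T (fst x), T (snd x)))"
    by (simp add: continuous_map_paired continuous_map_compose[OF continuous_map_fst cT, unfolded o_def]
        continuous_map_compose[OF continuous_map_snd cT, unfolded o_def])
  then have "continuous_map (prod_topology ?\<sigma> ?\<sigma>) \<tau> ((\<lambda>(c, e). \<lambda>k. c k + e k) \<circ> (\<lambda>x. (T (fst x), T (snd x))))"
    by (rule continuous_map_compose) (use \<tau> in \<open>simp add: locally_convex_def\<close>)
  then have "continuous_map (prod_topology ?\<sigma> ?\<sigma>) \<tau> (T \<circ> (\<lambda>(c, e). \<lambda>k. c k + e k))"
    by (rule continuous_map_eq) (use T in \<open>auto simp: top linear_op_on_def\<close>)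
  then have add: "continuous_map (prod_topology ?\<sigma> ?\<sigma>) ?\<sigma> (\<lambda>(c, e). \<lambda>k. c k + e k)"
    by (rule continuous_map_pullback') (use X in \<open>auto simp: top lin_subspace_def\<close>)
  have "continuous_map (prod_topology euclidean ?\<sigma>) (prod_topology euclidean \<tau>) (\<lambda>x. (fst x, T (snd x)))"
    by (simp add: continuous_map_paired continuous_map_fst
        continuous_map_compose[OF continuous_map_snd cT, unfolded o_def])
  then have "continuous_map (prod_topology euclidean ?\<sigma>) \<tau> ((\<lambda>(z, c). \<lambda>k. z * c k) \<circ> (\<lambda>x. (fst x, T (snd x))))"
    by (rule continuous_map_compose) (use \<tau> in \<open>simp add: locally_convex_def\<close>)
  then have "continuous_map (prod_topology euclidean ?\<sigma>) \<tau> (T \<circ> (\<lambda>(z, c). \<lambda>k. z * c k))"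
    by (rule continuous_map_eq) (use T in \<open>auto simp: top linear_op_on_def\<close>)
  then have scale: "continuous_map (prod_topology euclidean ?\<sigma>) ?\<sigma> (\<lambda>(z, c). \<lambda>k. z * c k)"
    by (rule continuous_map_pullback') (use X in \<open>auto simp: top lin_subspace_def\<close>)
  have "\<exists>V. openin ?\<sigma> V \<and> (\<lambda>k. 0) \<in> V \<and> V \<subseteq> U \<and> convex_set V" if U: "openin ?\<sigma> U" "(\<lambda>k. 0) \<in> U" for U
  proof -
    obtain U' where U': "openin \<tau> U'" "U = T -` U' \<inter> X"
      using U(1) unfolding openin_pullback_topology by blast
    then have "(\<lambda>k. 0) \<in> U'"
      using U(2) linear_op_on_zero[OF T X] by simp
    then obtain V' where V': "openin \<tau> V'" "(\<lambda>k. 0) \<in> V'" "V' \<subseteq> U'" "convex_set V'"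
      using \<tau> U' unfolding locally_convex_def by blast
    have "convex_set (T -` V' \<inter> X)"
      unfolding convex_set_def
    proof (intro ballI allI impI IntI vimageI2)
      fix c e and u :: real
      assume c: "c \<in> T -` V' \<inter> X" and e: "e \<in> T -` V' \<inter> X" and u: "0 \<le> u \<and> u \<le> 1"
      have ce: "(\<lambda>k. of_real (1 - u) * c k) \<in> X" "(\<lambda>k. of_real u * e k) \<in> X"
        using c e by (auto intro: lin_subspace_scale[OF X])
      then show "(\<lambda>k. of_real (1 - u) * c k + of_real u * e k) \<in> X"
        by (rule lin_subspace_add[OF X])
      have "T (\<lambda>k. of_real (1 - u) * c k + of_real u * e k) =
          (\<lambda>k. T (\<lambda>k. of_real (1 - u) * c k) k + T (\<lambda>k. of_real u * e k) k)"
        by (rule linear_op_on_add[OF T ce])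
      also have "\<dots> = (\<lambda>k. of_real (1 - u) * T c k + of_real u * T e k)"
        using c e by (simp add: linear_op_on_scale[OF T])
      also have "\<dots> \<in> V'"
        using V'(4) c e u unfolding convex_set_def by blast
      finally show "T (\<lambda>k. of_real (1 - u) * c k + of_real u * e k) \<in> V'" .
    qed
    moreover have "openin ?\<sigma> (T -` V' \<inter> X)"
      using V' unfolding openin_pullback_topology by blast
    moreover have "(\<lambda>k. 0) \<in> T -` V' \<inter> X"
      using V' X linear_op_on_zero[OF T X] by (simp add: lin_subspace_def)
    ultimately show ?thesis
      using V'(3) U'(2) by blast
  qed
  then show ?thesis
    unfolding locally_convex_def top using X add scale by blast
qed

text \<open>The same as the pullback along a linear operator, for the functional c \<mapsto> c k. It
  is a separate statement because \<open>locally_convex\<close> speaks of topologies on function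
  spaces, whereas the target here is the field; balls in the complex plane supply the convex
  neighbourhoods.\<close>

lemma locally_convex_coordinate:
  assumes X: "lin_subspace X"
  shows "locally_convex (pullback_topology X (\<lambda>c. c k) euclidean)" (is "locally_convex ?\<sigma>")
proof -
  have top: "topspace ?\<sigma> = X"
    by (auto simp: topspace_pullback_topology)
  have ck: "continuous_map ?\<sigma> euclidean (\<lambda>c. c k)"
    using continuous_map_pullback[OF continuous_map_id, of X "\<lambda>c. c k" euclidean] by simp
  have "continuous_map (prod_topology ?\<sigma> ?\<sigma>) euclidean (\<lambda>x. fst x k + snd x k)"
    by (intro continuous_map_add continuous_map_compose[OF continuous_map_fst ck, unfolded o_def]
        continuous_map_compose[OF continuous_map_snd ck, unfolded o_def])
  then have add: "continuous_map (prod_topology ?\<sigma> ?\<sigma>) ?\<sigma> (\<lambda>(c, e). \<lambda>k. c k + e k)"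
    by (intro continuous_map_pullback') (use X in \<open>auto simp: top lin_subspace_def case_prod_beta o_def\<close>)
  have "continuous_map (prod_topology euclidean ?\<sigma>) (prod_topology euclidean euclidean) (\<lambda>x. (fst x, snd x k))"
    by (intro continuous_map_paired[THEN iffD2] conjI continuous_map_fst
        continuous_map_compose[OF continuous_map_snd ck, unfolded o_def])
  moreover have "continuous_map (prod_topology euclidean euclidean) euclidean (\<lambda>(z :: complex, w). z * w)"
    by (auto simp: case_prod_beta intro!: continuous_intros)
  ultimately have "continuous_map (prod_topology euclidean ?\<sigma>) euclidean
      ((\<lambda>(z :: complex, w). z * w) \<circ> (\<lambda>x. (fst x, snd x k)))"
    by (rule continuous_map_compose)
  then have scale: "continuous_map (prod_topology euclidean ?\<sigma>) ?\<sigma> (\<lambda>(z, c). \<lambda>k. z * c k)"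
    by (intro continuous_map_pullback') (use X in \<open>auto simp: top lin_subspace_def case_prod_beta o_def\<close>)
  have "\<exists>V. openin ?\<sigma> V \<and> (\<lambda>k. 0) \<in> V \<and> V \<subseteq> U \<and> convex_set V" if U: "openin ?\<sigma> U" "(\<lambda>k. 0) \<in> U" for U
  proof -
    obtain U' where U': "open U'" "U = (\<lambda>c. c k) -` U' \<inter> X"
      using U(1) unfolding openin_pullback_topology by auto
    then obtain \<epsilon> where \<epsilon>: "0 < \<epsilon>" "ball 0 \<epsilon> \<subseteq> U'"
      using U(2) by (auto simp: open_contains_ball)
    have "convex_set ((\<lambda>c. c k) -` ball 0 \<epsilon> \<inter> X)"
      unfolding convex_set_def
    proof (intro ballI allI impI IntI vimageI2)
      fix c e and u :: real
      assume c: "c \<in> (\<lambda>c. c k) -` ball 0 \<epsilon> \<inter> X" and e: "e \<in> (\<lambda>c. c k) -` ball 0 \<epsilon> \<inter> X" and u: "0 \<le> u \<and> u \<le> 1"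
      have "(\<lambda>k. of_real (1 - u) * c k) \<in> X" "(\<lambda>k. of_real u * e k) \<in> X"
        using c e by (auto intro: lin_subspace_scale[OF X])
      then show "(\<lambda>k. of_real (1 - u) * c k + of_real u * e k) \<in> X"
        by (rule lin_subspace_add[OF X])
      have "(1 - u) *\<^sub>R c k + u *\<^sub>R e k \<in> ball 0 \<epsilon>"
        using c e u by (intro convexD_alt convex_ball) auto
      then show "of_real (1 - u) * c k + of_real u * e k \<in> ball 0 \<epsilon>"
        by (simp add: scaleR_conv_of_real)
    qed
    moreover have "openin ?\<sigma> ((\<lambda>c. c k) -` ball 0 \<epsilon> \<inter> X)"
      unfolding openin_pullback_topology by auto
    moreover have "(\<lambda>k. 0) \<in> (\<lambda>c. c k) -` ball 0 \<epsilon> \<inter> X"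
      using \<epsilon> X by (simp add: lin_subspace_def)
    ultimately show ?thesis
      using \<epsilon> U'(2) by blast
  qed
  then show ?thesis
    unfolding locally_convex_def top using X add scale by blast
qed

lemma continuous_map_into_ind_lim:
  assumes "lin_subspace (\<Union>r\<in>{0<..}. topspace (E r))" "0 < r"
  shows "continuous_map (E r) (ind_lim E) id"
  using assms topspace_ind_lim[OF assms(1)] unfolding ind_lim_def
  by (intro continuous_map_into_finest_lc) auto

lemma continuous_map_ind_lim:
  assumes X: "lin_subspace (\<Union>r\<in>{0<..}. topspace (E r))" and Y: "lin_subspace (\<Union>r\<in>{0<..}. topspace (F r))"
    and T: "linear_op_on (\<Union>r\<in>{0<..}. topspace (E r)) T"
    and cont: "\<And>r. 0 < r \<Longrightarrow> \<exists>r'>0. continuous_map (E r) (F r') T"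
  shows "continuous_map (ind_lim E) (ind_lim F) T"
proof -
  let ?X = "\<Union>r\<in>{0<..}. topspace (E r)" and ?Y = "\<Union>r\<in>{0<..}. topspace (F r)"
  have TX: "T c \<in> ?Y" if "c \<in> ?X" for c
  proof -
    obtain r where r: "0 < r" "c \<in> topspace (E r)"
      using \<open>c \<in> ?X\<close> by auto
    then obtain r' where "0 < r'" "continuous_map (E r) (F r') T"
      using cont by blast
    with r show ?thesis
      using continuous_map_image_subset_topspace by fastforce
  qed
  have "continuous_map (ind_lim E) \<tau> T"
    if \<tau>: "locally_convex \<tau>" "topspace \<tau> = ?Y" "\<forall>r>0. continuous_map (F r) \<tau> id" for \<tau>
  proof -
    \<comment> \<open>Continuity of \<open>T\<close> from each \<open>E r\<close> into \<tau> says
      that the inclusions of the \<open>E r\<close> into this pullback are continuous. The pullback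
      is thus one of the topologies whose supremum is \<open>ind_lim E\<close>, hence coarser than
      it.\<close>
    let ?\<sigma> = "pullback_topology ?X T \<tau>"
    have "continuous_map (E r) ?\<sigma> id" if "0 < r" for r
    proof -
      obtain r' where "0 < r'" "continuous_map (E r) (F r') T"
        using cont \<open>0 < r\<close> by blast
      then have "continuous_map (E r) \<tau> (id \<circ> T)"
        using \<tau>(3) by (intro continuous_map_compose[of _ "F r'"]) auto
      then show ?thesis
        using \<open>0 < r\<close> by (intro continuous_map_pullback') auto
    qed
    moreover have TX': "T \<in> ?X \<rightarrow> topspace \<tau>"
      unfolding \<tau>(2) using TX by (rule Pi_I)
    then have "locally_convex ?\<sigma>"
      by (rule locally_convex_pullback[OF \<tau>(1) X T])
    moreover have "topspace ?\<sigma> = ?X"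
      unfolding topspace_pullback_topology using TX' by (intro Int_absorb1 subsetI) (simp only: vimage_eq Pi_iff)
    ultimately have "continuous_map (ind_lim E) ?\<sigma> id"
      using topspace_ind_lim[OF X] unfolding ind_lim_def by (intro continuous_map_finest_lc_id) auto
    moreover have "continuous_map ?\<sigma> \<tau> T"
      using continuous_map_pullback[OF continuous_map_id, of ?X T \<tau>] by simp
    ultimately show ?thesis
      using continuous_map_compose[of _ ?\<sigma> id \<tau> T] by simp
  qed
  then show ?thesis
    using TX topspace_ind_lim[OF X] topspace_ind_lim[OF Y] unfolding ind_lim_def[of F]
    by (intro continuous_map_into_finest_lc) auto
qed

lemma continuous_map_ind_lim_coordinate:
  assumes X: "lin_subspace (\<Union>r\<in>{0<..}. topspace (E r))"
    and cont: "\<And>r. 0 < r \<Longrightarrow> continuous_map (E r) euclidean (\<lambda>c. c k)"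
  shows "continuous_map (ind_lim E) euclidean (\<lambda>c. c k)"
proof -
  let ?X = "\<Union>r\<in>{0<..}. topspace (E r)"
  let ?\<sigma> = "pullback_topology ?X (\<lambda>c. c k) euclidean"
  have "continuous_map (E r) ?\<sigma> id" if "0 < r" for r
    using cont[OF that] that by (intro continuous_map_pullback') (auto simp: o_def)
  moreover have "topspace ?\<sigma> = ?X"
    by (auto simp: topspace_pullback_topology)
  ultimately have "continuous_map (ind_lim E) ?\<sigma> id"
    using topspace_ind_lim[OF X] locally_convex_coordinate[OF X] unfolding ind_lim_def
    by (intro continuous_map_finest_lc_id) auto
  moreover have "continuous_map ?\<sigma> euclidean (\<lambda>c. c k)"
    using continuous_map_pullback[OF continuous_map_id, of ?X "\<lambda>c. c k" euclidean] by simp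
  ultimately show ?thesis
    using continuous_map_compose[of _ ?\<sigma> id euclidean "\<lambda>c. c k"] by (simp add: o_def)
qed

text \<open>Convergence is tested on the generating sets, by induction over finite intersections and
  unions. Each generator is cut down to the intersection of all the \<open>E r\<close>, which is why
  the \<open>f n\<close> are taken in that intersection.\<close>

lemma limitin_proj_lim:
  assumes "\<And>r. 0 < r \<Longrightarrow> limitin (E r) f l F" and "\<And>n. f n \<in> topspace (proj_lim E)"
  shows "limitin (proj_lim E) f l F"
  unfolding limitin_def
proof (intro conjI allI impI)
  show l: "l \<in> topspace (proj_lim E)"
    using assms(1) limitin_topspace by (fastforce simp: topspace_proj_lim)
  fix U assume "openin (proj_lim E) U \<and> l \<in> U"
  then have "generate_topology_on {(\<Inter>r\<in>{0<..}. topspace (E r)) \<inter> U | r U. 0 < r \<and> openin (E r) U} U" "l \<in> U"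
    unfolding proj_lim_def by (auto dest: openin_topology_generated_by)
  then show "\<forall>\<^sub>F n in F. f n \<in> U"
  proof (induction rule: generate_topology_on.induct)
    case (Int a b)
    then show ?case
      by (auto elim: eventually_elim2)
  next
    case (UN K)
    then obtain k where "k \<in> K" "\<forall>\<^sub>F n in F. f n \<in> k"
      by blast
    then show ?case
      by (auto elim: eventually_mono)
  next
    case (Basis s)
    then obtain r U where s: "s = (\<Inter>r\<in>{0<..}. topspace (E r)) \<inter> U" "0 < r" "openin (E r) U"
      by blast
    then have "\<forall>\<^sub>F n in F. f n \<in> U"
      using assms(1)[OF s(2)] Basis by (auto simp: limitin_def)
    then show ?case
      using assms(2) s(1) unfolding topspace_proj_lim by (auto elim: eventually_mono)
  qed simp
qed

lemma limitin_ell_w: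
  assumes "wnorm p \<omega> l < \<infinity>" "\<And>n. wnorm p \<omega> (f n) < \<infinity>"
    and "((\<lambda>n. wnorm p \<omega> (\<lambda>k. f n k - l k)) \<longlongrightarrow> 0) F"
  shows "limitin (ell_w p \<omega>) f l F"
  unfolding limitin_def
proof (intro conjI allI impI)
  show "l \<in> topspace (ell_w p \<omega>)"
    using assms(1) by (simp add: topspace_ell_w)
  fix U assume U: "openin (ell_w p \<omega>) U \<and> l \<in> U"
  then obtain \<epsilon> where \<epsilon>: "0 < \<epsilon>"
    "\<And>e. wnorm p \<omega> e < \<infinity> \<Longrightarrow> wnorm p \<omega> (\<lambda>k. e k - l k) < \<epsilon> \<Longrightarrow> e \<in> U"
    unfolding openin_ell_w by blast
  have "\<forall>\<^sub>F n in F. wnorm p \<omega> (\<lambda>k. f n k - l k) < \<epsilon>"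
    using assms(3) \<epsilon>(1) by (rule order_tendstoD)
  then show "\<forall>\<^sub>F n in F. f n \<in> U"
    by (rule eventually_mono) (intro \<epsilon> assms(2))
qed

section \<open>Multi-indices and the shift kernel\<close>

lemma mlen_add: "mlen (\<alpha> + \<beta>) = mlen \<alpha> + mlen \<beta>"
  by (simp add: mlen_def sum.distrib)

lemma mbinom_le: "mbinom \<alpha> \<gamma> \<le> 2 ^ mlen \<alpha>"
  unfolding mbinom_def mlen_def power_sum by (intro prod_mono conjI binomial_le_pow2) auto

lemma bij_betw_mindex_le:
  "bij_betw vec_lambda (PiE UNIV (\<lambda>i. {..\<alpha> $ i})) {\<gamma> :: 'd::finite mindex. \<gamma> \<le> \<alpha>}"
  by (rule bij_betw_byWitness[where f' = "\<lambda>\<gamma> i. \<gamma> $ i"]) (auto simp: less_eq_vec_def PiE_UNIV_domain)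

lemma finite_mindex_le: "finite {\<gamma> :: 'd::finite mindex. \<gamma> \<le> \<alpha>}"
  using bij_betw_finite[OF bij_betw_mindex_le, of \<alpha>] by (simp add: finite_PiE)

lemma sum_prod_mindex_le:
  fixes f :: "'d::finite \<Rightarrow> nat \<Rightarrow> 'a :: comm_semiring_1"
  shows "(\<Sum>\<gamma> | \<gamma> \<le> \<alpha>. \<Prod>i\<in>UNIV. f i (\<gamma> $ i)) = (\<Prod>i\<in>UNIV. \<Sum>g\<le>\<alpha> $ i. f i g)"
  using sum.reindex_bij_betw[OF bij_betw_mindex_le, of "\<lambda>\<gamma>. \<Prod>i\<in>UNIV. f i (\<gamma> $ i)" \<alpha>]
  by (simp add: prod_sum_PiE)

lemma mbinom_theorem:
  fixes t u :: "'a :: comm_semiring_1"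
  shows "(\<Sum>\<delta> | \<delta> \<le> \<mu>. of_nat (mbinom \<mu> \<delta>) * t ^ mlen \<delta> * u ^ mlen (\<mu> - \<delta>)) = (t + u) ^ mlen \<mu>"
proof -
  have "(t + u) ^ mlen \<mu> = (\<Prod>i\<in>UNIV. \<Sum>g\<le>\<mu> $ i. of_nat (\<mu> $ i choose g) * t ^ g * u ^ (\<mu> $ i - g))"
    unfolding mlen_def power_sum by (simp add: binomial_ring)
  also have "\<dots> = (\<Sum>\<delta> | \<delta> \<le> \<mu>. \<Prod>i\<in>UNIV. of_nat (\<mu> $ i choose \<delta> $ i) * t ^ (\<delta> $ i) * u ^ (\<mu> $ i - \<delta> $ i))"
    by (rule sum_prod_mindex_le[symmetric])
  also have "\<dots> = (\<Sum>\<delta> | \<delta> \<le> \<mu>. of_nat (mbinom \<mu> \<delta>) * t ^ mlen \<delta> * u ^ mlen (\<mu> - \<delta>))"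
    by (simp add: mbinom_def mlen_def prod.distrib power_sum of_nat_prod)
  finally show ?thesis
    by simp
qed

text \<open>In each component both sides equal (n + m)! / (n! d! (m - d)!), a choice in two stages
  made in either order. The right-hand side isolates the part depending on \<delta>, as required to
  factor a product of kernel entries.\<close>

lemma mbinom_mult:
  assumes "\<delta> \<le> \<mu>"
  shows "mbinom (x + \<mu>) (\<mu> - \<delta>) * mbinom (x + \<delta>) \<delta> = mbinom (x + \<mu>) \<mu> * mbinom \<mu> \<delta>"
proof -
  have "(n + m choose (m - d)) * (n + d choose d) = (n + m choose m) * (m choose d)" if "d \<le> m" for n m d :: nat
  proof -
    have "(n + m choose m) * (m choose (m - d)) = (n + m choose (m - d)) * (n + m - (m - d) choose (m - (m - d)))"
      using that by (intro choose_mult) auto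
    moreover have "n + m - (m - d) = n + d" "m - (m - d) = d"
      using that by auto
    ultimately show ?thesis
      using that by (simp add: binomial_symmetric[of d m])
  qed
  then show ?thesis
    using assms by (simp add: mbinom_def less_eq_vec_def flip: prod.distrib)
qed

section \<open>Diagonal shifts and the kernel common to both operators\<close>

definition idx_len :: "'d::finite mindex \<times> 'd mindex \<Rightarrow> nat" where
  "idx_len k = mlen (fst k) + mlen (snd k)"

text \<open>The partial order in which the matrix of \<open>T0\<close> is triangular: each row runs
  over the finitely many predecessors of an index, each row of the transpose over its infinitely
  many successors.\<close>

definition diag_below :: "'d::finite mindex \<times> 'd mindex \<Rightarrow> 'd mindex \<times> 'd mindex \<Rightarrow> bool" where
  "diag_below j k \<longleftrightarrow> (\<exists>\<gamma>. k = (fst j + \<gamma>, snd j + \<gamma>))"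

lemma diag_below_refl: "diag_below k k"
  unfolding diag_below_def by (rule exI[of _ 0]) simp

lemma diag_below_trans: "diag_below l j \<Longrightarrow> diag_below j k \<Longrightarrow> diag_below l k"
  unfolding diag_below_def by (metis add.assoc fst_conv snd_conv)

lemma diag_below_len: "diag_below j k \<Longrightarrow> idx_len j \<le> idx_len k"
  unfolding diag_below_def idx_len_def by (auto simp: mlen_add)

lemma diag_below_image:
  "{j. diag_below j (\<alpha>, \<beta>)} = (\<lambda>\<gamma>. (\<alpha> - \<gamma>, \<beta> - \<gamma>)) ` {\<gamma>. \<gamma> \<le> \<alpha> \<and> \<gamma> \<le> \<beta>}"
proof (intro set_eqI iffI)
  fix j assume "j \<in> {j. diag_below j (\<alpha>, \<beta>)}"
  then obtain \<gamma> where "\<alpha> = fst j + \<gamma>" "\<beta> = snd j + \<gamma>"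
    by (auto simp: diag_below_def)
  then show "j \<in> (\<lambda>\<gamma>. (\<alpha> - \<gamma>, \<beta> - \<gamma>)) ` {\<gamma>. \<gamma> \<le> \<alpha> \<and> \<gamma> \<le> \<beta>}"
    by (intro image_eqI[of _ _ \<gamma>]) (auto simp: less_eq_vec_def vec_eq_iff prod_eq_iff)
next
  fix j assume "j \<in> (\<lambda>\<gamma>. (\<alpha> - \<gamma>, \<beta> - \<gamma>)) ` {\<gamma>. \<gamma> \<le> \<alpha> \<and> \<gamma> \<le> \<beta>}"
  then obtain \<gamma> where "\<gamma> \<le> \<alpha>" "\<gamma> \<le> \<beta>" "j = (\<alpha> - \<gamma>, \<beta> - \<gamma>)"
    by auto
  then have "(\<alpha>, \<beta>) = (fst j + \<gamma>, snd j + \<gamma>)"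
    by (auto simp: vec_eq_iff less_eq_vec_def)
  then show "j \<in> {j. diag_below j (\<alpha>, \<beta>)}"
    unfolding diag_below_def by blast
qed

lemma finite_diag_below: "finite {j. diag_below j k}"
proof -
  have "finite {\<gamma>. \<gamma> \<le> fst k \<and> \<gamma> \<le> snd k}"
    by (rule finite_subset[OF _ finite_mindex_le]) auto
  then show ?thesis
    using diag_below_image[of "fst k" "snd k"] by simp
qed

text \<open>The shift is recovered as \<open>fst k - fst j\<close>. Truncated subtraction does no
  harm: the entry is nonzero only if \<open>k\<close> is a diagonal shift of \<open>j\<close>, and
  then the second components differ by the same multi-index.\<close>

definition shift_kernel :: "complex \<Rightarrow> 'd::finite mindex \<times> 'd mindex \<Rightarrow> 'd mindex \<times> 'd mindex \<Rightarrow> complex" where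
  "shift_kernel t k j =
     (if diag_below j k
      then of_real (sqrt (real (mbinom (fst k) (fst k - fst j) * mbinom (snd k) (fst k - fst j)))) *
           t ^ mlen (fst k - fst j)
      else 0)"

lemma shift_kernel_add:
  "shift_kernel t (x + \<gamma>, y + \<gamma>) (x, y) =
     of_real (sqrt (real (mbinom (x + \<gamma>) \<gamma> * mbinom (y + \<gamma>) \<gamma>))) * t ^ mlen \<gamma>"
  by (auto simp: shift_kernel_def diag_below_def)

lemma T0_eq_sum: "T0 t c k = (\<Sum>j | diag_below j k. shift_kernel t k j * c j)"
proof -
  obtain \<alpha> \<beta> where k: "k = (\<alpha>, \<beta>)"
    by (cases k)
  have inj: "inj_on (\<lambda>\<gamma>. (\<alpha> - \<gamma>, \<beta> - \<gamma>)) {\<gamma>. \<gamma> \<le> \<alpha> \<and> \<gamma> \<le> \<beta>}"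
    by (rule inj_onI) (auto simp: vec_eq_iff less_eq_vec_def, metis diff_diff_cancel)
  have "shift_kernel t k (\<alpha> - \<gamma>, \<beta> - \<gamma>) =
      of_real (sqrt (real (mbinom \<alpha> \<gamma> * mbinom \<beta> \<gamma>))) * t ^ mlen \<gamma>" if "\<gamma> \<le> \<alpha>" "\<gamma> \<le> \<beta>" for \<gamma>
  proof -
    have "\<alpha> - \<gamma> + \<gamma> = \<alpha>" "\<beta> - \<gamma> + \<gamma> = \<beta>"
      using that by (auto simp: vec_eq_iff less_eq_vec_def)
    then show ?thesis
      using shift_kernel_add[of t "\<alpha> - \<gamma>" \<gamma> "\<beta> - \<gamma>"] by (simp add: k)
  qed
  then show ?thesis
    unfolding k diag_below_image sum.reindex[OF inj] by (auto simp: T0_def k intro!: sum.cong)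
qed

text \<open>The semigroup law of the matrices, the algebraic core of both inversion formulas. The
  indices between l and k = l + (\<mu>, \<mu>) are l + (\<delta>, \<delta>) with \<delta> \<le>
  \<mu>. By \<open>mbinom_mult\<close> the radicand belonging to (k, l) splits off, and what remains
  is the binomial expansion of (t + u)^|\<mu>|.\<close>

lemma sum_shift_kernel_mult:
  "(\<Sum>j | diag_below j k. shift_kernel u k j * shift_kernel t j l) = shift_kernel (t + u) k l"
proof (cases "diag_below l k")
  case False
  then have "shift_kernel u k j * shift_kernel t j l = 0" for j
    using diag_below_trans[of l j k] by (auto simp: shift_kernel_def)
  moreover have "shift_kernel (t + u) k l = 0"
    using False by (simp add: shift_kernel_def)
  ultimately show ?thesis
    by (simp only: sum.neutral_const)
next
  case True
  obtain x y where l: "l = (x, y)"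
    by (cases l)
  with True obtain \<mu> where k: "k = (x + \<mu>, y + \<mu>)"
    by (auto simp: diag_below_def)
  let ?h = "\<lambda>\<delta>. (x + \<delta>, y + \<delta>)"
  have inj: "inj_on ?h {\<delta>. \<delta> \<le> \<mu>}"
    by (rule inj_onI) auto
  have below: "diag_below (?h \<delta>) k" if "\<delta> \<le> \<mu>" for \<delta>
    unfolding diag_below_def k using that
    by (intro exI[of _ "\<mu> - \<delta>"]) (auto simp: vec_eq_iff less_eq_vec_def)
  have "(\<Sum>j | diag_below j k. shift_kernel u k j * shift_kernel t j l) =
      (\<Sum>j\<in>?h ` {\<delta>. \<delta> \<le> \<mu>}. shift_kernel u k j * shift_kernel t j l)"
  proof (rule sum.mono_neutral_right[OF finite_diag_below])
    show "?h ` {\<delta>. \<delta> \<le> \<mu>} \<subseteq> {j. diag_below j k}"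
      using below by auto
    show "\<forall>j\<in>{j. diag_below j k} - ?h ` {\<delta>. \<delta> \<le> \<mu>}. shift_kernel u k j * shift_kernel t j l = 0"
    proof
      fix j assume j: "j \<in> {j. diag_below j k} - ?h ` {\<delta>. \<delta> \<le> \<mu>}"
      have "\<not> diag_below l j"
      proof
        assume "diag_below l j"
        then obtain \<delta> where \<delta>: "j = ?h \<delta>"
          by (auto simp: diag_below_def l)
        then have "\<delta> \<le> \<mu>"
          using j by (auto simp: diag_below_def k less_eq_vec_def vec_eq_iff)
        with \<delta> j show False
          by blast
      qed
      then show "shift_kernel u k j * shift_kernel t j l = 0"
        by (simp add: shift_kernel_def)
    qed
  qed
  also have "\<dots> = (\<Sum>\<delta> | \<delta> \<le> \<mu>. shift_kernel u k (?h \<delta>) * shift_kernel t (?h \<delta>) l)"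
    by (simp add: sum.reindex[OF inj])
  also have "\<dots> = (\<Sum>\<delta> | \<delta> \<le> \<mu>. of_real (sqrt (real (mbinom (x + \<mu>) \<mu> * mbinom (y + \<mu>) \<mu>))) *
      (of_nat (mbinom \<mu> \<delta>) * t ^ mlen \<delta> * u ^ mlen (\<mu> - \<delta>)))"
  proof (rule sum.cong[OF refl])
    fix \<delta> assume "\<delta> \<in> {\<delta>. \<delta> \<le> \<mu>}"
    then have \<delta>: "\<delta> \<le> \<mu>"
      by simp
    have 1: "shift_kernel u k (?h \<delta>) =
        of_real (sqrt (real (mbinom (x + \<mu>) (\<mu> - \<delta>) * mbinom (y + \<mu>) (\<mu> - \<delta>)))) * u ^ mlen (\<mu> - \<delta>)"
    proof -
      have "x + \<mu> = (x + \<delta>) + (\<mu> - \<delta>)" "y + \<mu> = (y + \<delta>) + (\<mu> - \<delta>)"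
        using \<delta> by (auto simp: vec_eq_iff less_eq_vec_def)
      then show ?thesis
        unfolding k by (metis shift_kernel_add)
    qed
    have "real (mbinom (x + \<mu>) (\<mu> - \<delta>) * mbinom (y + \<mu>) (\<mu> - \<delta>)) * real (mbinom (x + \<delta>) \<delta> * mbinom (y + \<delta>) \<delta>)
        = real ((mbinom (x + \<mu>) (\<mu> - \<delta>) * mbinom (x + \<delta>) \<delta>) * (mbinom (y + \<mu>) (\<mu> - \<delta>) * mbinom (y + \<delta>) \<delta>))"
      by (simp add: mult_ac)
    \<comment> \<open>Each of the two components contributes one factor
      \<open>mbinom \<mu> \<delta>\<close>; being squared, it can leave the root.\<close>
    also have "\<dots> = real (mbinom (x + \<mu>) \<mu> * mbinom (y + \<mu>) \<mu>) * (real (mbinom \<mu> \<delta>))\<^sup>2"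
      by (simp only: mbinom_mult[OF \<delta>]) (simp add: power2_eq_square mult_ac)
    finally have "sqrt (real (mbinom (x + \<mu>) (\<mu> - \<delta>) * mbinom (y + \<mu>) (\<mu> - \<delta>))) * sqrt (real (mbinom (x + \<delta>) \<delta> * mbinom (y + \<delta>) \<delta>))
        = sqrt (real (mbinom (x + \<mu>) \<mu> * mbinom (y + \<mu>) \<mu>)) * real (mbinom \<mu> \<delta>)"
      by (simp only: real_sqrt_mult[symmetric]) (simp only: real_sqrt_mult real_sqrt_abs abs_of_nat)
    then have 2: "complex_of_real (sqrt (real (mbinom (x + \<mu>) (\<mu> - \<delta>) * mbinom (y + \<mu>) (\<mu> - \<delta>)))) *
          of_real (sqrt (real (mbinom (x + \<delta>) \<delta> * mbinom (y + \<delta>) \<delta>)))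
        = of_real (sqrt (real (mbinom (x + \<mu>) \<mu> * mbinom (y + \<mu>) \<mu>))) * of_nat (mbinom \<mu> \<delta>)"
      by (metis of_real_mult of_real_of_nat_eq)
    show "shift_kernel u k (?h \<delta>) * shift_kernel t (?h \<delta>) l =
        of_real (sqrt (real (mbinom (x + \<mu>) \<mu> * mbinom (y + \<mu>) \<mu>))) *
        (of_nat (mbinom \<mu> \<delta>) * t ^ mlen \<delta> * u ^ mlen (\<mu> - \<delta>))"
      unfolding 1 l shift_kernel_add
      using arg_cong[OF 2, of "\<lambda>z. z * (t ^ mlen \<delta> * u ^ mlen (\<mu> - \<delta>))"] by (simp only: mult_ac)
  qed
  also have "\<dots> = shift_kernel (t + u) k l"
    by (simp only: sum_distrib_left[symmetric] mbinom_theorem k l shift_kernel_add)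
  finally show ?thesis .
qed

lemma shift_kernel_0: "shift_kernel 0 k j = (if j = k then 1 else 0)"
proof (cases "diag_below j k")
  case True
  obtain x y where j: "j = (x, y)"
    by (cases j)
  with True obtain \<gamma> where k: "k = (x + \<gamma>, y + \<gamma>)"
    by (auto simp: diag_below_def)
  have "mlen \<gamma> = 0 \<longleftrightarrow> \<gamma> = 0"
    by (simp add: mlen_def vec_eq_iff)
  moreover have "mbinom \<alpha> 0 = 1" for \<alpha> :: "'a mindex"
    by (simp add: mbinom_def)
  ultimately show ?thesis
    using shift_kernel_add[of 0 x \<gamma> y] by (cases "\<gamma> = 0") (auto simp: j k)
next
  case False
  then show ?thesis
    using diag_below_refl[of k] by (auto simp: shift_kernel_def)
qed

text \<open>Every row of \<open>T0\<close> is a finite sum, so the composition law is pure algebra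
  on arbitrary sequences. The inner sums are extended by zeros to a range independent of
  \<open>j\<close> before the interchange.\<close>

lemma T0_T0:
  fixes c :: "'d::finite seq2"
  shows "T0 u (T0 t c) = T0 (t + u) c"
proof
  fix k :: "'d mindex \<times> 'd mindex"
  let ?D = "{j. diag_below j k}"
  have "T0 u (T0 t c) k = (\<Sum>j\<in>?D. shift_kernel u k j * (\<Sum>l | diag_below l j. shift_kernel t j l * c l))"
    by (simp add: T0_eq_sum)
  also have "\<dots> = (\<Sum>j\<in>?D. shift_kernel u k j * (\<Sum>l\<in>?D. shift_kernel t j l * c l))"
  proof (rule sum.cong[OF refl])
    fix j assume "j \<in> ?D"
    then have "{l. diag_below l j} \<subseteq> ?D"
      using diag_below_trans by blast
    then have "(\<Sum>l | diag_below l j. shift_kernel t j l * c l) = (\<Sum>l\<in>?D. shift_kernel t j l * c l)"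
      by (intro sum.mono_neutral_left finite_diag_below) (auto simp: shift_kernel_def)
    then show "shift_kernel u k j * (\<Sum>l | diag_below l j. shift_kernel t j l * c l) =
        shift_kernel u k j * (\<Sum>l\<in>?D. shift_kernel t j l * c l)"
      by simp
  qed
  also have "\<dots> = (\<Sum>l\<in>?D. (\<Sum>j\<in>?D. shift_kernel u k j * shift_kernel t j l) * c l)"
    unfolding sum_distrib_left sum_distrib_right by (subst sum.swap) (simp only: mult.assoc)
  also have "\<dots> = T0 (t + u) c k"
    by (simp only: sum_shift_kernel_mult T0_eq_sum)
  finally show "T0 u (T0 t c) k = T0 (t + u) c k" .
qed

lemma T0_0:
  fixes c :: "'d::finite seq2"
  shows "T0 0 c = c"
proof
  fix k :: "'d mindex \<times> 'd mindex"
  have "T0 0 c k = (\<Sum>j | diag_below j k. if j = k then c j else 0)"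
    by (auto simp: T0_eq_sum shift_kernel_0 intro!: sum.cong)
  also have "\<dots> = c k"
    by (subst sum.delta[OF finite_diag_below]) (simp add: diag_below_refl)
  finally show "T0 0 c k = c k" .
qed

text \<open>A common form in which one boundedness estimate serves the matrix of \<open>T0\<close>
  and its transpose.\<close>

definition kernel_op :: "('k \<Rightarrow> 'k \<Rightarrow> complex) \<Rightarrow> ('k \<Rightarrow> complex) \<Rightarrow> 'k \<Rightarrow> complex" where
  "kernel_op M c = (\<lambda>k. \<Sum>\<^sub>\<infinity>j. M k j * c j)"

lemma kernel_op_finite:
  assumes "finite S" "\<And>j. j \<notin> S \<Longrightarrow> M k j * c j = 0"
  shows "kernel_op M c k = (\<Sum>j\<in>S. M k j * c j)"
proof -
  have "kernel_op M c k = (\<Sum>\<^sub>\<infinity>j\<in>S. M k j * c j)"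
    unfolding kernel_op_def using assms by (intro infsum_cong_neutral) auto
  then show ?thesis
    using assms(1) by simp
qed

lemma T0_eq_kernel_op: "T0 t = kernel_op (shift_kernel t)"
proof (intro ext)
  fix c :: "'a seq2" and k :: "'a mindex \<times> 'a mindex"
  show "T0 t c k = kernel_op (shift_kernel t) c k"
    unfolding T0_eq_sum by (rule kernel_op_finite[symmetric, OF finite_diag_below]) (simp add: shift_kernel_def)
qed

text \<open>The successors of \<open>j\<close> are reindexed by the shift. This is valid for every
  \<open>c\<close>: dropping zero terms and reindexing along an injection preserve
  \<open>infsum\<close> even for divergent series, where both sides are 0. Hence the formula for
  finite sequences can itself serve as the extension.\<close>

lemma T0_adj_eq_kernel_op: "T0_adj t = kernel_op (\<lambda>j k. shift_kernel t k j)"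
proof (intro ext)
  fix c :: "'a seq2" and j :: "'a mindex \<times> 'a mindex"
  let ?h = "\<lambda>\<gamma>. (fst j + \<gamma>, snd j + \<gamma>)"
  have inj: "inj ?h"
    by (rule injI) auto
  have "kernel_op (\<lambda>j k. shift_kernel t k j) c j = (\<Sum>\<^sub>\<infinity>k\<in>range ?h. shift_kernel t k j * c k)"
    unfolding kernel_op_def by (intro infsum_cong_neutral) (auto simp: shift_kernel_def diag_below_def)
  also have "\<dots> = (\<Sum>\<^sub>\<infinity>\<gamma>. shift_kernel t (?h \<gamma>) j * c (?h \<gamma>))"
    by (subst infsum_reindex[OF inj]) (simp add: o_def)
  also have "\<dots> = T0_adj t c j"
    using shift_kernel_add[of t "fst j" _ "snd j"] by (simp add: T0_adj_def case_prod_beta)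
  finally show "T0_adj t c j = kernel_op (\<lambda>j k. shift_kernel t k j) c j"
    by simp
qed

lemma T0_adj_finite:
  assumes "finite S" "\<And>k. k \<notin> S \<Longrightarrow> c k = 0"
  shows "T0_adj t c j = (\<Sum>k\<in>S. shift_kernel t k j * c k)"
  unfolding T0_adj_eq_kernel_op using assms by (intro kernel_op_finite) auto

lemma finite_support_T0_adj:
  assumes "finite {k. c k \<noteq> 0}"
  shows "finite {k. T0_adj t c k \<noteq> 0}"
proof (rule finite_subset)
  show "finite (\<Union>k\<in>{k. c k \<noteq> 0}. {j. diag_below j k})"
    using assms finite_diag_below by blast
  show "{k. T0_adj t c k \<noteq> 0} \<subseteq> (\<Union>k\<in>{k. c k \<noteq> 0}. {j. diag_below j k})"
  proof
    fix j assume "j \<in> {k. T0_adj t c k \<noteq> 0}"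
    then have "(\<Sum>k | c k \<noteq> 0. shift_kernel t k j * c k) \<noteq> 0"
      using T0_adj_finite[OF assms, of c t j] by simp
    then obtain k where "c k \<noteq> 0" "shift_kernel t k j * c k \<noteq> 0"
      by (metis (mono_tags, lifting) mem_Collect_eq sum.not_neutral_contains_not_neutral)
    then show "j \<in> (\<Union>k\<in>{k. c k \<noteq> 0}. {j. diag_below j k})"
      by (intro UN_I[of k]) (auto simp: shift_kernel_def split: if_splits)
  qed
qed

text \<open>Rows of the transpose are infinite, so the sums are interchanged for finite support
  only; the inverse relation passes to the limit spaces by density.\<close>

lemma T0_adj_T0_adj:
  fixes c :: "'d::finite seq2"
  assumes "finite {k. c k \<noteq> 0}"
  shows "T0_adj u (T0_adj t c) = T0_adj (t + u) c"
proof
  fix l :: "'d mindex \<times> 'd mindex"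
  let ?S = "{k. c k \<noteq> 0}"
  let ?D = "\<Union>k\<in>?S. {j. diag_below j k}"
  have D: "finite ?D"
    using assms finite_diag_below by blast
  have adj: "T0_adj r c j = (\<Sum>k\<in>?S. shift_kernel r k j * c k)" for r j
    by (rule T0_adj_finite[OF assms]) simp
  have "T0_adj u (T0_adj t c) l = (\<Sum>j\<in>?D. shift_kernel u j l * T0_adj t c j)"
  proof (rule T0_adj_finite[OF D])
    fix j assume "j \<notin> ?D"
    then show "T0_adj t c j = 0"
      unfolding adj by (intro sum.neutral) (auto simp: shift_kernel_def)
  qed
  also have "\<dots> = (\<Sum>k\<in>?S. (\<Sum>j\<in>?D. shift_kernel t k j * shift_kernel u j l) * c k)"
    unfolding adj sum_distrib_left sum_distrib_right by (subst sum.swap) (simp only: mult_ac)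
  also have "\<dots> = (\<Sum>k\<in>?S. (\<Sum>j | diag_below j k. shift_kernel t k j * shift_kernel u j l) * c k)"
  proof (rule sum.cong[OF refl])
    fix k assume "k \<in> ?S"
    then have "{j. diag_below j k} \<subseteq> ?D"
      by blast
    then have "(\<Sum>j\<in>?D. shift_kernel t k j * shift_kernel u j l) =
        (\<Sum>j | diag_below j k. shift_kernel t k j * shift_kernel u j l)"
      by (intro sum.mono_neutral_right[OF D]) (auto simp: shift_kernel_def)
    then show "(\<Sum>j\<in>?D. shift_kernel t k j * shift_kernel u j l) * c k =
        (\<Sum>j | diag_below j k. shift_kernel t k j * shift_kernel u j l) * c k"
      by simp
  qed
  also have "\<dots> = T0_adj (t + u) c l"
    by (simp only: sum_shift_kernel_mult adj add.commute)
  finally show "T0_adj u (T0_adj t c) l = T0_adj (t + u) c l" .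
qed

lemma T0_adj_0:
  fixes c :: "'d::finite seq2"
  assumes "finite {k. c k \<noteq> 0}"
  shows "T0_adj 0 c = c"
proof
  fix j :: "'d mindex \<times> 'd mindex"
  have "T0_adj 0 c j = (\<Sum>k | c k \<noteq> 0. if k = j then c k else 0)"
    unfolding T0_adj_finite[OF assms, of c, simplified] by (auto simp: shift_kernel_0 intro!: sum.cong)
  also have "\<dots> = c j"
    by (subst sum.delta[OF assms]) simp
  finally show "T0_adj 0 c j = c j" .
qed

section \<open>Geometric decay and bounds for kernel operators\<close>

lemma sum_power_mlen_le:
  fixes q :: real and \<alpha> :: "'d::finite mindex"
  assumes "0 < q" "q < 1"
  shows "(\<Sum>\<gamma> | \<gamma> \<le> \<alpha>. q ^ mlen \<gamma>) \<le> (1 / (1 - q)) ^ CARD('d)"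
proof -
  have "(\<Sum>\<gamma> | \<gamma> \<le> \<alpha>. q ^ mlen \<gamma>) = (\<Prod>i\<in>UNIV. \<Sum>g\<le>\<alpha> $ i. q ^ g)"
    unfolding mlen_def power_sum by (rule sum_prod_mindex_le)
  also have "\<dots> \<le> (\<Prod>i\<in>(UNIV :: 'd set). 1 / (1 - q))"
  proof (intro prod_mono conjI sum_nonneg)
    fix i
    have "(\<Sum>g\<le>\<alpha> $ i. q ^ g) \<le> (\<Sum>g. q ^ g)"
      using assms by (intro sum_le_suminf summable_geometric) auto
    then show "(\<Sum>g\<le>\<alpha> $ i. q ^ g) \<le> 1 / (1 - q)"
      using assms by (simp add: suminf_geometric)
  qed (use assms in auto)
  finally show ?thesis
    by simp
qed

lemma component_le_idx_len: "fst k $ i \<le> idx_len k" "snd k $ i \<le> idx_len k"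
  by (simp_all add: idx_len_def mlen_def member_le_sum trans_le_add1 trans_le_add2)

text \<open>Every finite set lies in a box, over which the sum factors into one geometric sum for
  each of the 2d components.\<close>

lemma infsum_geometric_idx_len:
  assumes "0 < q" "q < 1"
  shows "(\<Sum>\<^sub>\<infinity>k :: 'd::finite mindex \<times> 'd mindex. ennreal (q ^ idx_len k)) < \<infinity>"
proof -
  let ?B = "(1 / (1 - q)) ^ CARD('d)"
  have "(\<Sum>k\<in>F. ennreal (q ^ idx_len k)) \<le> ennreal (?B * ?B)"
    if F: "finite F" for F :: "('d mindex \<times> 'd mindex) set"
  proof -
    define N :: "'d mindex" where "N = (\<chi> i. \<Sum>k\<in>F. idx_len k)"
    have "idx_len k \<le> N $ i" if "k \<in> F" for k i
      using that F by (simp add: N_def member_le_sum)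
    then have "fst k $ i \<le> N $ i" "snd k $ i \<le> N $ i" if "k \<in> F" for k i
      using that component_le_idx_len le_trans by metis+
    then have "F \<subseteq> {\<alpha>. \<alpha> \<le> N} \<times> {\<beta>. \<beta> \<le> N}"
      by (auto simp: less_eq_vec_def)
    then have "(\<Sum>k\<in>F. q ^ idx_len k) \<le> (\<Sum>k\<in>{\<alpha>. \<alpha> \<le> N} \<times> {\<beta>. \<beta> \<le> N}. q ^ idx_len k)"
      using assms by (intro sum_mono2 finite_cartesian_product finite_mindex_le) auto
    also have "\<dots> = (\<Sum>\<alpha> | \<alpha> \<le> N. q ^ mlen \<alpha>) * (\<Sum>\<beta> | \<beta> \<le> N. q ^ mlen \<beta>)"
      by (simp add: idx_len_def power_add sum_product sum.cartesian_product case_prod_beta)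
    also have "\<dots> \<le> ?B * ?B"
      using assms by (intro mult_mono sum_power_mlen_le sum_nonneg) auto
    finally show ?thesis
      using assms by (simp add: sum_ennreal ennreal_leI)
  qed
  then have "(\<Sum>\<^sub>\<infinity>k :: 'd mindex \<times> 'd mindex. ennreal (q ^ idx_len k)) \<le> ennreal (?B * ?B)"
    by (subst nonneg_infsum_complete) (auto intro!: SUP_least)
  then show ?thesis
    by (simp add: le_less_trans)
qed

lemma finite_idx_len_less: "finite {k :: 'd::finite mindex \<times> 'd mindex. idx_len k < n}"
proof (rule finite_subset)
  show "finite ({\<alpha> :: 'd mindex. \<alpha> \<le> (\<chi> i. n)} \<times> {\<beta> :: 'd mindex. \<beta> \<le> (\<chi> i. n)})"
    by (intro finite_cartesian_product finite_mindex_le)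
  show "{k :: 'd mindex \<times> 'd mindex. idx_len k < n} \<subseteq> {\<alpha>. \<alpha> \<le> (\<chi> i. n)} \<times> {\<beta>. \<beta> \<le> (\<chi> i. n)}"
  proof
    fix k :: "'d mindex \<times> 'd mindex" assume "k \<in> {k. idx_len k < n}"
    then have "fst k $ i \<le> n" "snd k $ i \<le> n" for i
      using component_le_idx_len[where k = k and i = i] by auto
    then show "k \<in> {\<alpha>. \<alpha> \<le> (\<chi> i. n)} \<times> {\<beta>. \<beta> \<le> (\<chi> i. n)}"
      by (cases k) (auto simp: less_eq_vec_def)
  qed
qed

lemma abs_summable_if_ennreal:
  assumes "(\<Sum>\<^sub>\<infinity>j\<in>A. ennreal (norm (f j))) < \<infinity>"
  shows "(\<lambda>j. norm (f j)) summable_on A"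
proof (rule nonneg_bdd_above_summable_on)
  obtain r where r: "0 \<le> r" "(\<Sum>\<^sub>\<infinity>j\<in>A. ennreal (norm (f j))) = ennreal r"
    using assms by (cases "\<Sum>\<^sub>\<infinity>j\<in>A. ennreal (norm (f j))") auto
  have "(\<Sum>j\<in>F. norm (f j)) \<le> r" if "finite F" "F \<subseteq> A" for F
  proof -
    have "ennreal (\<Sum>j\<in>F. norm (f j)) \<le> ennreal r"
      using sum_le_infsum_ennreal[OF that, of "\<lambda>j. ennreal (norm (f j))"] r by simp
    then show ?thesis
      using r by simp
  qed
  then show "bdd_above (sum (\<lambda>j. norm (f j)) ` {F. F \<subseteq> A \<and> finite F})"
    by (intro bdd_aboveI[of _ r]) auto
qed simp

text \<open>Where the right-hand side is infinite the bound is trivial, and otherwise the series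
  converges absolutely.\<close>

lemma norm_infsum_le_ennreal:
  fixes f :: "'a \<Rightarrow> 'b :: banach"
  shows "ennreal (norm (\<Sum>\<^sub>\<infinity>j\<in>A. f j)) \<le> (\<Sum>\<^sub>\<infinity>j\<in>A. ennreal (norm (f j)))"
proof (cases "(\<Sum>\<^sub>\<infinity>j\<in>A. ennreal (norm (f j))) < \<infinity>")
  case True
  then have sm: "(\<lambda>j. norm (f j)) summable_on A"
    by (rule abs_summable_if_ennreal)
  then have "ennreal (norm (\<Sum>\<^sub>\<infinity>j\<in>A. f j)) \<le> ennreal (\<Sum>\<^sub>\<infinity>j\<in>A. norm (f j))"
    by (intro ennreal_leI norm_infsum_bound)
  also have "\<dots> = (SUP F\<in>{F. finite F \<and> F \<subseteq> A}. ennreal (\<Sum>j\<in>F. norm (f j)))"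
    using sm by (intro infsum_nonneg_is_SUPREMUM_ennreal) auto
  also have "\<dots> = (\<Sum>\<^sub>\<infinity>j\<in>A. ennreal (norm (f j)))"
    by (subst nonneg_infsum_complete) (auto intro!: SUP_cong)
  finally show ?thesis .
qed (simp add: less_top[symmetric])

lemma linear_op_on_kernel_op:
  assumes "\<And>c k. c \<in> X \<Longrightarrow> (\<lambda>j. M k j * c j) summable_on UNIV"
  shows "linear_op_on X (kernel_op M)"
  unfolding linear_op_on_def kernel_op_def
proof (intro conjI ballI allI ext)
  fix c e k assume "c \<in> X" "e \<in> X"
  then show "(\<Sum>\<^sub>\<infinity>j. M k j * (c j + e j)) = (\<Sum>\<^sub>\<infinity>j. M k j * c j) + (\<Sum>\<^sub>\<infinity>j. M k j * e j)"
    using assms by (simp add: distrib_left infsum_add)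
next
  fix z c k
  show "(\<Sum>\<^sub>\<infinity>j. M k j * (z * c j)) = z * (\<Sum>\<^sub>\<infinity>j. M k j * c j)"
    by (simp add: mult.left_commute[of _ z] infsum_cmult_right')
qed

lemma linear_op_on_T0: "linear_op_on X (T0 t)"
  unfolding linear_op_on_def
  by (auto simp: T0_eq_sum fun_eq_iff distrib_left sum.distrib sum_distrib_left mult.left_commute)

text \<open>Only the supremum bound \<open>le_wnorm\<close> for \<open>c\<close> enters; summability
  over \<open>j\<close> comes from the factor (1/2)^\<open>idx_len j\<close>, so the estimate has
  the same shape for all p. The bound is asked only where c j \<noteq> 0 with a view to s = 0, where
  it can fail at indices at which the sequences of a stage are forced to vanish.\<close>

lemma infsum_kernel_le:
  fixes c :: "'d::finite seq2"
  assumes "0 < p" "0 \<le> K"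
    and bound: "\<And>j. c j \<noteq> 0 \<Longrightarrow> ennreal (cmod (m j)) * w \<le> ennreal (K * (1/2) ^ idx_len j) * \<omega> j"
  shows "(\<Sum>\<^sub>\<infinity>j. ennreal (cmod (m j * c j))) * w
    \<le> ennreal K * (\<Sum>\<^sub>\<infinity>j :: 'd mindex \<times> 'd mindex. ennreal ((1/2) ^ idx_len j)) * wnorm p \<omega> c"
proof -
  have "(\<Sum>\<^sub>\<infinity>j. ennreal (cmod (m j * c j))) * w = (\<Sum>\<^sub>\<infinity>j. w * ennreal (cmod (m j * c j)))"
    by (simp add: infsum_cmult_ennreal mult.commute)
  also have "\<dots> \<le> (\<Sum>\<^sub>\<infinity>j :: 'd mindex \<times> 'd mindex. (ennreal K * wnorm p \<omega> c) * ennreal ((1/2) ^ idx_len j))"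
  proof (intro infsum_mono summable_on_ennreal')
    fix j :: "'d mindex \<times> 'd mindex"
    show "w * ennreal (cmod (m j * c j)) \<le> (ennreal K * wnorm p \<omega> c) * ennreal ((1/2) ^ idx_len j)"
    proof (cases "c j = 0")
      case False
      have "w * ennreal (cmod (m j * c j)) = (ennreal (cmod (m j)) * w) * ennreal (cmod (c j))"
        by (simp add: norm_mult ennreal_mult mult_ac)
      also have "\<dots> \<le> (ennreal (K * (1/2) ^ idx_len j) * \<omega> j) * ennreal (cmod (c j))"
        using bound[OF False] by (rule mult_right_mono) simp
      also have "\<dots> = ennreal (K * (1/2) ^ idx_len j) * (ennreal (cmod (c j)) * \<omega> j)"
        by (simp add: mult_ac)
      also have "\<dots> \<le> ennreal (K * (1/2) ^ idx_len j) * wnorm p \<omega> c"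
        by (intro mult_left_mono le_wnorm assms) simp
      also have "\<dots> = (ennreal K * wnorm p \<omega> c) * ennreal ((1/2) ^ idx_len j)"
        using assms by (simp add: ennreal_mult mult_ac)
      finally show ?thesis .
    qed simp
  qed
  also have "\<dots> = ennreal K * (\<Sum>\<^sub>\<infinity>j :: 'd mindex \<times> 'd mindex. ennreal ((1/2) ^ idx_len j)) * wnorm p \<omega> c"
    by (simp add: infsum_cmult_ennreal mult_ac)
  finally show ?thesis .
qed

text \<open>The way back from a pointwise bound to l^p: \<open>C\<close> is the l^p norm of the
  geometric family, made positive by adding 1, and depends on neither the weight nor the
  sequence.\<close>

lemma wnorm_le_if_decay:
  assumes "0 < p"
  obtains C where "0 < C" "\<And>\<omega> (c :: 'd::finite seq2) B.
    (\<And>k. ennreal (cmod (c k)) * \<omega> k \<le> B * ennreal ((1/2) ^ idx_len k)) \<Longrightarrow> wnorm p \<omega> c \<le> B * ennreal C"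
proof -
  let ?G = "lp_norm p (\<lambda>k :: 'd mindex \<times> 'd mindex. ennreal ((1/2) ^ idx_len k))"
  have "?G < \<infinity>"
    by (intro lp_norm_geometric assms infsum_geometric_idx_len)
  then have G: "?G \<le> ennreal (enn2real ?G + 1)"
    by (cases ?G) (auto intro: ennreal_leI)
  show ?thesis
  proof
    show "0 < enn2real ?G + 1"
      by (simp add: add_nonneg_pos)
    fix \<omega> and c :: "'d seq2" and B
    assume "\<And>k. ennreal (cmod (c k)) * \<omega> k \<le> B * ennreal ((1/2) ^ idx_len k)"
    then have "wnorm p \<omega> c \<le> B * ?G"
      unfolding wnorm_def lp_norm_cmult[OF assms, symmetric] by (rule lp_norm_mono[OF assms])
    also have "\<dots> \<le> B * ennreal (enn2real ?G + 1)"
      using G by (rule mult_left_mono) simp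
    finally show "wnorm p \<omega> c \<le> B * ennreal (enn2real ?G + 1)" .
  qed
qed

text \<open>A Schur-type test with decay in both indices: the factor in \<open>j\<close> sums each
  row against a supremum bound, the factor in \<open>k\<close> turns the resulting pointwise bound
  into an l^p bound. \<open>C\<close> is chosen before the weights, the kernel and the
  sequence.\<close>

lemma wnorm_kernel_op_le:
  assumes "0 < p"
  obtains C where "0 < C" "\<And>\<omega> \<omega>' (M :: 'd::finite mindex \<times> 'd mindex \<Rightarrow> 'd mindex \<times> 'd mindex \<Rightarrow> complex) (c :: 'd seq2) K. 0 \<le> K \<Longrightarrow>
    (\<And>j k. c j \<noteq> 0 \<Longrightarrow>
      ennreal (cmod (M k j)) * \<omega>' k \<le> ennreal (K * (1/2) ^ idx_len k * (1/2) ^ idx_len j) * \<omega> j) \<Longrightarrow>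
    wnorm p \<omega>' (kernel_op M c) \<le> ennreal (K * C) * wnorm p \<omega> c"
proof -
  obtain C where C: "0 < C" "\<And>\<omega> (c :: 'd seq2) B.
      (\<And>k. ennreal (cmod (c k)) * \<omega> k \<le> B * ennreal ((1/2) ^ idx_len k)) \<Longrightarrow> wnorm p \<omega> c \<le> B * ennreal C"
    by (rule wnorm_le_if_decay[OF assms]) blast
  let ?S = "\<Sum>\<^sub>\<infinity>j :: 'd mindex \<times> 'd mindex. ennreal ((1/2) ^ idx_len j)"
  have "?S < \<infinity>"
    by (rule infsum_geometric_idx_len) auto
  then have S: "?S \<le> ennreal (enn2real ?S + 1)"
    by (cases ?S) (auto intro: ennreal_leI)
  show ?thesis
  proof
    show "0 < (enn2real ?S + 1) * C"
      using C(1) by (simp add: add_nonneg_pos)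
    fix \<omega> \<omega>' and M :: "'d mindex \<times> 'd mindex \<Rightarrow> 'd mindex \<times> 'd mindex \<Rightarrow> complex"
      and c :: "'d seq2" and K :: real
    assume K: "0 \<le> K" and bound: "\<And>j k. c j \<noteq> 0 \<Longrightarrow>
      ennreal (cmod (M k j)) * \<omega>' k \<le> ennreal (K * (1/2) ^ idx_len k * (1/2) ^ idx_len j) * \<omega> j"
    have "ennreal (cmod (kernel_op M c k)) * \<omega>' k \<le> (ennreal K * ?S * wnorm p \<omega> c) * ennreal ((1/2) ^ idx_len k)" for k
    proof -
      have "ennreal (cmod (kernel_op M c k)) * \<omega>' k \<le> (\<Sum>\<^sub>\<infinity>j. ennreal (cmod (M k j * c j))) * \<omega>' k"
        unfolding kernel_op_def by (intro mult_right_mono norm_infsum_le_ennreal) simp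
      also have "\<dots> \<le> ennreal (K * (1/2) ^ idx_len k) * ?S * wnorm p \<omega> c"
        using K by (intro infsum_kernel_le assms bound) auto
      also have "\<dots> = (ennreal K * ?S * wnorm p \<omega> c) * ennreal ((1/2) ^ idx_len k)"
        using K by (simp add: ennreal_mult mult_ac)
      finally show ?thesis .
    qed
    then have "wnorm p \<omega>' (kernel_op M c) \<le> (ennreal K * ?S * wnorm p \<omega> c) * ennreal C"
      by (rule C(2))
    also have "\<dots> = (ennreal K * wnorm p \<omega> c * ennreal C) * ?S"
      by (simp add: mult_ac)
    also have "\<dots> \<le> (ennreal K * wnorm p \<omega> c * ennreal C) * ennreal (enn2real ?S + 1)"
      using S by (rule mult_left_mono) simp
    also have "\<dots> = ennreal (K * ((enn2real ?S + 1) * C)) * wnorm p \<omega> c"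
      using K C(1) by (simp add: ennreal_mult mult_ac)
    finally show "wnorm p \<omega>' (kernel_op M c) \<le> ennreal (K * ((enn2real ?S + 1) * C)) * wnorm p \<omega> c" .
  qed
qed

text \<open>Here \<open>w\<close> is the target weight of one fixed row; being nonzero, it can be
  removed from the finite bound for the weighted sum.\<close>

lemma kernel_summable:
  fixes c :: "'d::finite seq2"
  assumes "0 < p" "0 \<le> K" "w \<noteq> 0" "wnorm p \<omega> c < \<infinity>"
    and "\<And>j. c j \<noteq> 0 \<Longrightarrow> ennreal (cmod (m j)) * w \<le> ennreal (K * (1/2) ^ idx_len j) * \<omega> j"
  shows "(\<lambda>j. m j * c j) summable_on UNIV"
proof -
  let ?S = "\<Sum>\<^sub>\<infinity>j :: 'd mindex \<times> 'd mindex. ennreal ((1/2) ^ idx_len j)"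
  have "?S < \<infinity>"
    by (rule infsum_geometric_idx_len) auto
  then have "ennreal K * ?S * wnorm p \<omega> c < \<infinity>"
    using assms(4) by (simp add: ennreal_mult_less_top)
  with infsum_kernel_le[OF assms(1,2,5), of c]
  have "(\<Sum>\<^sub>\<infinity>j. ennreal (cmod (m j * c j))) * w < \<infinity>"
    by (rule le_less_trans)
  then have "(\<Sum>\<^sub>\<infinity>j. ennreal (cmod (m j * c j))) < \<infinity>"
    using assms(3) by (auto simp: ennreal_mult_less_top)
  then show ?thesis
    by (rule abs_summable_summable[OF abs_summable_if_ennreal])
qed

text \<open>8 = 2 * 4: the root of the two binomials is at most 2^\<open>idx_len k\<close>, and the
  factor 4 buys the decay (1/4)^\<open>idx_len k\<close>. The maximum with 1 allows |t|^|\<gamma>|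
  to be bounded by a power with the larger exponent \<open>idx_len k\<close>.\<close>

definition shift_bound :: "complex \<Rightarrow> real" where
  "shift_bound t = 8 * max 1 (cmod t)"

lemma shift_bound_ge_1: "1 \<le> shift_bound t"
  by (simp add: shift_bound_def)

lemma norm_shift_kernel_le: "cmod (shift_kernel t k j) \<le> shift_bound t ^ idx_len k * (1/4) ^ idx_len k"
proof (cases "diag_below j k")
  case True
  then obtain \<gamma> where k: "k = (fst j + \<gamma>, snd j + \<gamma>)"
    by (auto simp: diag_below_def)
  let ?m = "max 1 (cmod t)"
  let ?B = "mbinom (fst k) \<gamma> * mbinom (snd k) \<gamma>"
  have "?B \<le> 2 ^ idx_len k"
    unfolding idx_len_def power_add by (intro mult_mono mbinom_le) auto
  then have "real ?B \<le> 2 ^ idx_len k"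
    by (metis of_nat_le_iff of_nat_numeral of_nat_power)
  also have "\<dots> \<le> (2 ^ idx_len k)\<^sup>2"
    by (rule self_le_power) auto
  finally have "sqrt (real ?B) \<le> 2 ^ idx_len k"
    by (intro real_le_lsqrt) auto
  moreover have "cmod t ^ mlen \<gamma> \<le> ?m ^ idx_len k"
  proof -
    have "cmod t ^ mlen \<gamma> \<le> ?m ^ mlen \<gamma>"
      by (intro power_mono) auto
    also have "\<dots> \<le> ?m ^ idx_len k"
      by (subst k) (intro power_increasing, auto simp: idx_len_def mlen_add)
    finally show ?thesis .
  qed
  ultimately have "sqrt (real ?B) * cmod t ^ mlen \<gamma> \<le> 2 ^ idx_len k * ?m ^ idx_len k"
    by (intro mult_mono) auto
  also have "\<dots> = shift_bound t ^ idx_len k * (1/4) ^ idx_len k"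
  proof -
    have "2 * ?m = shift_bound t * (1/4)"
      by (simp add: shift_bound_def)
    then show ?thesis
      by (simp only: power_mult_distrib[symmetric])
  qed
  finally have "sqrt (real ?B) * cmod t ^ mlen \<gamma> \<le> shift_bound t ^ idx_len k * (1/4) ^ idx_len k" .
  moreover have "shift_kernel t k j = of_real (sqrt (real ?B)) * t ^ mlen \<gamma>"
    using shift_kernel_add[of t "fst j" \<gamma> "snd j"] unfolding k prod.collapse fst_conv snd_conv .
  ultimately show ?thesis
    by (simp add: norm_mult norm_power del: of_nat_mult)
next
  case False
  then show ?thesis
    using shift_bound_ge_1[of t] by (simp add: shift_kernel_def)
qed

text \<open>Turns an exchange inequality for the weights, with base \<open>shift_bound t\<close>,
  into the hypothesis of the kernel bound. As \<open>j\<close> lies below \<open>k\<close>, one of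
  the two factors (1/2)^\<open>idx_len k\<close> making up (1/4)^\<open>idx_len k\<close> may be
  traded for (1/2)^\<open>idx_len j\<close>. The bound treats both lengths alike and so serves the
  transpose too.\<close>

lemma shift_kernel_weight_le:
  assumes "0 \<le> K" and le: "diag_below j k \<Longrightarrow> ennreal (shift_bound t ^ idx_len k) * w \<le> ennreal K * v"
  shows "ennreal (cmod (shift_kernel t k j)) * w \<le> ennreal (K * (1/2) ^ idx_len k * (1/2) ^ idx_len j) * v"
proof (cases "diag_below j k")
  case True
  have "ennreal (cmod (shift_kernel t k j)) * w \<le> ennreal (shift_bound t ^ idx_len k * (1/4) ^ idx_len k) * w"
    by (intro mult_right_mono ennreal_leI norm_shift_kernel_le) simp
  also have "\<dots> = ennreal ((1/4) ^ idx_len k) * (ennreal (shift_bound t ^ idx_len k) * w)"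
    using shift_bound_ge_1[of t] by (simp add: ennreal_mult mult_ac)
  also have "\<dots> \<le> ennreal ((1/4) ^ idx_len k) * (ennreal K * v)"
    using le[OF True] by (rule mult_left_mono) simp
  also have "\<dots> = ennreal (K * (1/4) ^ idx_len k) * v"
    using assms by (simp add: ennreal_mult mult_ac)
  also have "\<dots> \<le> ennreal (K * (1/2) ^ idx_len k * (1/2) ^ idx_len j) * v"
  proof (intro mult_right_mono ennreal_leI)
    have "(1/4) ^ idx_len k = (1/2) ^ idx_len k * (1/2 :: real) ^ idx_len k"
      by (simp only: power_mult_distrib[symmetric]) simp
    also have "\<dots> \<le> (1/2) ^ idx_len k * (1/2) ^ idx_len j"
      using diag_below_len[OF True] by (intro mult_left_mono power_decreasing) auto
    finally have "K * (1/4) ^ idx_len k \<le> K * ((1/2) ^ idx_len k * (1/2) ^ idx_len j)"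
      using assms(1) by (rule mult_left_mono)
    then show "K * (1/4) ^ idx_len k \<le> K * (1/2) ^ idx_len k * (1/2) ^ idx_len j"
      by (simp add: mult.assoc)
  qed simp
  finally show ?thesis .
qed (simp add: shift_kernel_def)

lemma wnorm_finite_support:
  fixes c :: "'d::finite seq2"
  assumes "0 < p" "finite {k. c k \<noteq> 0}" "\<And>k. c k \<noteq> 0 \<Longrightarrow> \<omega> k < \<infinity>"
  shows "wnorm p \<omega> c < \<infinity>"
proof -
  obtain C where C: "0 < C" "\<And>\<omega> (c :: 'd seq2) B.
      (\<And>k. ennreal (cmod (c k)) * \<omega> k \<le> B * ennreal ((1/2) ^ idx_len k)) \<Longrightarrow> wnorm p \<omega> c \<le> B * ennreal C"
    by (rule wnorm_le_if_decay[OF assms(1)]) blast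
  \<comment> \<open>The factor 2^\<open>idx_len k\<close> compensates the decay demanded by
    \<open>wnorm_le_if_decay\<close>.\<close>
  define B where "B = (\<Sum>k | c k \<noteq> 0. ennreal (cmod (c k)) * \<omega> k * ennreal (2 ^ idx_len k))"
  have "wnorm p \<omega> c \<le> B * ennreal C"
  proof (rule C(2))
    fix k
    show "ennreal (cmod (c k)) * \<omega> k \<le> B * ennreal ((1/2) ^ idx_len k)"
    proof (cases "c k = 0")
      case False
      have "ennreal (cmod (c k)) * \<omega> k = ennreal (cmod (c k)) * \<omega> k * (ennreal (2 ^ idx_len k) * ennreal ((1/2) ^ idx_len k))"
        by (subst ennreal_mult[symmetric]) (simp_all only: power_mult_distrib[symmetric], simp_all)
      also have "\<dots> = (ennreal (cmod (c k)) * \<omega> k * ennreal (2 ^ idx_len k)) * ennreal ((1/2) ^ idx_len k)"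
        by (simp only: mult_ac)
      also have "\<dots> \<le> B * ennreal ((1/2) ^ idx_len k)"
        unfolding B_def using assms(2) False by (intro mult_right_mono member_le_sum) auto
      finally show ?thesis .
    qed simp
  qed
  also have "\<dots> < \<infinity>"
    using assms by (simp add: B_def ennreal_mult_less_top)
  finally show ?thesis .
qed

section \<open>The map \<open>S0\<close>\<close>

lemma S0_apply: "S0 c k = \<i> ^ idx_len k * c k"
  by (cases k) (simp add: S0_def idx_len_def mlen_add)

lemma wnorm_S0: "wnorm p \<omega> (S0 c) = wnorm p \<omega> c"
  by (simp add: wnorm_def S0_apply norm_mult norm_power)

lemma bij_S0: "bij S0"
  by (rule bij_betw_byWitness[where f' = "\<lambda>c k. (- \<i>) ^ idx_len k * c k"])
    (auto simp: S0_apply fun_eq_iff simp flip: mult.assoc power_mult_distrib)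

lemma linear_op_on_S0: "linear_op_on X S0"
  by (simp add: linear_op_on_def S0_apply fun_eq_iff distrib_left mult.left_commute)

text \<open>A diagonal shift by \<gamma> raises \<open>idx_len\<close> by 2|\<gamma>|, so the power
  of i changes by (-1)^|\<gamma>|, the very sign that replacing t by -t produces in the entry. The
  first form serves \<open>T0\<close>, the second its transpose.\<close>

lemma shift_kernel_uminus:
  "shift_kernel (- t) k j * \<i> ^ idx_len k = shift_kernel t k j * \<i> ^ idx_len j"
  "shift_kernel (- t) k j * \<i> ^ idx_len j = shift_kernel t k j * \<i> ^ idx_len k"
proof -
  have "shift_kernel (- t) k j * \<i> ^ idx_len k = shift_kernel t k j * \<i> ^ idx_len j \<and>
    shift_kernel (- t) k j * \<i> ^ idx_len j = shift_kernel t k j * \<i> ^ idx_len k"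
  proof (cases "diag_below j k")
    case True
    obtain x y where j: "j = (x, y)"
      by (cases j)
    with True obtain \<gamma> where k: "k = (x + \<gamma>, y + \<gamma>)"
      by (auto simp: diag_below_def)
    have "idx_len k = idx_len j + 2 * mlen \<gamma>"
      by (simp add: j k idx_len_def mlen_add)
    then have len: "\<i> ^ idx_len k = \<i> ^ idx_len j * (- 1) ^ mlen \<gamma>"
      by (simp add: power_add power_mult)
    have neg: "(- t) ^ mlen \<gamma> = t ^ mlen \<gamma> * (- 1) ^ mlen \<gamma>"
      by (simp flip: power_mult_distrib)
    have sq: "(- 1) ^ mlen \<gamma> * (- 1) ^ mlen \<gamma> = (1 :: complex)"
      by (simp flip: power_mult_distrib)
    have ker: "shift_kernel (- t) k j = shift_kernel t k j * (- 1) ^ mlen \<gamma>"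
      unfolding j k shift_kernel_add neg by simp
    show ?thesis
      unfolding len ker using arg_cong[OF sq, of "\<lambda>z. shift_kernel t k j * \<i> ^ idx_len j * z"]
      by (simp add: mult_ac)
  qed (simp add: shift_kernel_def)
  then show "shift_kernel (- t) k j * \<i> ^ idx_len k = shift_kernel t k j * \<i> ^ idx_len j"
    "shift_kernel (- t) k j * \<i> ^ idx_len j = shift_kernel t k j * \<i> ^ idx_len k"
    by blast+
qed

lemma T0_S0: "T0 t (S0 c) = S0 (T0 (- t) c)"
proof
  fix k
  have "T0 t (S0 c) k = (\<Sum>j | diag_below j k. (shift_kernel t k j * \<i> ^ idx_len j) * c j)"
    by (simp add: T0_eq_sum S0_apply mult.assoc)
  also have "\<dots> = S0 (T0 (- t) c) k"
    unfolding shift_kernel_uminus(1)[symmetric]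
    by (simp add: S0_apply T0_eq_sum sum_distrib_left mult_ac)
  finally show "T0 t (S0 c) k = S0 (T0 (- t) c) k" .
qed

text \<open>Valid for every sequence, convergent or not: \<open>infsum_cmult_right'\<close> pulls
  out a complex constant unconditionally.\<close>

lemma T0_adj_S0: "T0_adj t (S0 c) = S0 (T0_adj (- t) c)"
proof
  fix j
  have "T0_adj t (S0 c) j = (\<Sum>\<^sub>\<infinity>k. (shift_kernel t k j * \<i> ^ idx_len k) * c k)"
    by (simp add: T0_adj_eq_kernel_op kernel_op_def S0_apply mult.assoc)
  also have "\<dots> = (\<Sum>\<^sub>\<infinity>k. \<i> ^ idx_len j * (shift_kernel (- t) k j * c k))"
    unfolding shift_kernel_uminus(2)[symmetric] by (simp add: mult_ac)
  also have "\<dots> = S0 (T0_adj (- t) c) j"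
    by (simp add: infsum_cmult_right' S0_apply T0_adj_eq_kernel_op kernel_op_def)
  finally show "T0_adj t (S0 c) j = S0 (T0_adj (- t) c) j" .
qed

lemma image_S0_eq:
  assumes "\<And>c. S0 c \<in> X \<longleftrightarrow> c \<in> X"
  shows "S0 ` X = X"
proof
  show "S0 ` X \<subseteq> X"
    using assms by blast
  show "X \<subseteq> S0 ` X"
  proof
    fix c assume "c \<in> X"
    moreover have "c = S0 (inv S0 c)"
      by (simp add: surj_f_inv_f bij_is_surj[OF bij_S0])
    ultimately show "c \<in> S0 ` X"
      using assms by (metis image_eqI)
  qed
qed

section \<open>Projective limits of inductive limits\<close>

text \<open>\<open>a\<close> is the parameter of the projective limit, \<open>b\<close> that of the
  inductive limit. \<open>directed\<close> makes the union over \<open>b\<close> a vector space.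
  \<open>raising\<close> is what takes \<open>T0\<close> from step (a', b) to step (a, b'):
  continuity on the projective limit lets a' depend on a, continuity on the inductive stage lets b'
  depend on b.\<close>

locale proj_ind_weights =
  fixes p :: ennreal and W :: "real \<Rightarrow> real \<Rightarrow> 'd::finite mindex \<times> 'd mindex \<Rightarrow> ennreal"
  assumes p_pos: "0 < p"
    and directed: "\<lbrakk>0 < a; 0 < b1; 0 < b2\<rbrakk> \<Longrightarrow> \<exists>b>0. \<forall>k. W a b k \<le> W a b1 k \<and> W a b k \<le> W a b2 k"
    and raising: "\<lbrakk>1 \<le> A; 0 < a\<rbrakk> \<Longrightarrow> \<exists>a'>0. \<forall>b>0. \<exists>b'>0. \<exists>K>0. \<forall>j k. diag_below j k \<longrightarrow>
      ennreal (A ^ idx_len k) * W a b' k \<le> ennreal K * W a' b j"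
begin

abbreviation stage :: "real \<Rightarrow> 'd seq2 topology" where
  "stage a \<equiv> ind_lim (\<lambda>b. ell_w p (W a b))"

abbreviation limit_space :: "'d seq2 topology" where
  "limit_space \<equiv> proj_lim stage"

lemma lin_subspace_stage:
  assumes "0 < a"
  shows "lin_subspace (\<Union>b\<in>{0<..}. topspace (ell_w p (W a b)))"
proof (rule lin_subspace_directed_UN)
  fix b1 b2 :: real assume "b1 \<in> {0<..}" "b2 \<in> {0<..}"
  then obtain b where b: "0 < b" "\<forall>k. W a b k \<le> W a b1 k \<and> W a b k \<le> W a b2 k"
    using directed assms by (metis greaterThan_iff)
  then have "wnorm p (W a b) c \<le> wnorm p (W a b1) c" "wnorm p (W a b) c \<le> wnorm p (W a b2) c" for c
    by (auto intro: wnorm_mono p_pos)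
  then show "\<exists>b\<in>{0<..}. topspace (ell_w p (W a b1)) \<subseteq> topspace (ell_w p (W a b)) \<and>
      topspace (ell_w p (W a b2)) \<subseteq> topspace (ell_w p (W a b))"
    using b(1) by (intro bexI[of _ b]) (auto simp: topspace_ell_w intro: le_less_trans)
qed (auto intro: lin_subspace_ell_w p_pos)

lemma topspace_limit: "c \<in> topspace limit_space \<longleftrightarrow> (\<forall>a>0. \<exists>b>0. wnorm p (W a b) c < \<infinity>)"
proof -
  have "topspace (stage a) = (\<Union>b\<in>{0<..}. topspace (ell_w p (W a b)))" if "0 < a" for a
    using topspace_ind_lim[OF lin_subspace_stage[OF that]] .
  then show ?thesis
    by (auto simp: topspace_proj_lim topspace_ell_w)
qed

lemma continuous_map_T0: "continuous_map limit_space limit_space (T0 t)"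
proof (rule continuous_map_proj_lim)
  fix a :: real assume a: "0 < a"
  obtain C where C: "0 < C" "\<And>\<omega> \<omega>' (M :: 'd mindex \<times> 'd mindex \<Rightarrow> 'd mindex \<times> 'd mindex \<Rightarrow> complex) c K.
      0 \<le> K \<Longrightarrow> (\<And>j k. c j \<noteq> 0 \<Longrightarrow>
        ennreal (cmod (M k j)) * \<omega>' k \<le> ennreal (K * (1/2) ^ idx_len k * (1/2) ^ idx_len j) * \<omega> j) \<Longrightarrow>
      wnorm p \<omega>' (kernel_op M c) \<le> ennreal (K * C) * wnorm p \<omega> c"
    by (rule wnorm_kernel_op_le[OF p_pos]) blast
  obtain a' where a': "0 < a'" "\<And>b. 0 < b \<Longrightarrow> \<exists>b'>0. \<exists>K>0. \<forall>j k. diag_below j k \<longrightarrow>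
      ennreal (shift_bound t ^ idx_len k) * W a b' k \<le> ennreal K * W a' b j"
    using raising[OF shift_bound_ge_1 a] by blast
  have "continuous_map (stage a') (stage a) (T0 t)"
  proof (rule continuous_map_ind_lim[OF lin_subspace_stage lin_subspace_stage linear_op_on_T0])
    fix b :: real assume "0 < b"
    then obtain b' K where b': "0 < b'" "0 < K" and le: "\<And>j k. diag_below j k \<Longrightarrow>
        ennreal (shift_bound t ^ idx_len k) * W a b' k \<le> ennreal K * W a' b j"
      using a'(2) by blast
    have "continuous_map (ell_w p (W a' b)) (ell_w p (W a b')) (T0 t)"
    proof (rule continuous_map_ell_w[OF p_pos lin_subspace_ell_w[OF p_pos] continuous_map_id linear_op_on_T0])
      show "0 < K * C"
        using b' C by simp
      show "wnorm p (W a b') (T0 t c) \<le> ennreal (K * C) * wnorm p (W a' b) c" for c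
        unfolding T0_eq_kernel_op using b' by (intro C(2) shift_kernel_weight_le le) auto
    qed
    then show "\<exists>b'>0. continuous_map (ell_w p (W a' b)) (ell_w p (W a b')) (T0 t)"
      using b'(1) by blast
  qed (use a a' in auto)
  then show "\<exists>a'>0. continuous_map (stage a') (stage a) (T0 t)"
    using a'(1) by blast
qed

text \<open>The inverse relation and the conjugation by \<open>S0\<close> hold for all sequences, so
  continuity is the only analytic input. \<open>S0\<close> preserves every weighted norm, hence the
  space.\<close>

lemma T0_homeomorphic_maps:
  "homeomorphic_maps limit_space limit_space (T0 t) (T0 (- t)) \<and>
   S0 ` topspace limit_space = topspace limit_space \<and>
   (\<forall>c\<in>topspace limit_space. T0 (- t) c = (inv S0 \<circ> T0 t \<circ> S0) c)"
proof (intro conjI ballI)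
  show "homeomorphic_maps limit_space limit_space (T0 t) (T0 (- t))"
    by (simp add: homeomorphic_maps_def continuous_map_T0 T0_T0 T0_0)
  show "S0 ` topspace limit_space = topspace limit_space"
    by (rule image_S0_eq) (simp add: topspace_limit wnorm_S0)
  show "T0 (- t) c = (inv S0 \<circ> T0 t \<circ> S0) c" for c
    by (simp add: T0_S0 inv_f_f bij_is_inj[OF bij_S0])
qed

end

section \<open>Inductive limits of projective limits\<close>

lemma continuous_map_ell_w_coordinate:
  assumes "0 < p" "\<omega> k \<noteq> 0"
  shows "continuous_map (ell_w p \<omega>) euclidean (\<lambda>c. c k)"
  unfolding continuous_map
proof (intro conjI allI impI)
  fix U :: "complex set" assume "openin euclidean U"
  then have U: "open U"
    by simp
  show "openin (ell_w p \<omega>) {c \<in> topspace (ell_w p \<omega>). c k \<in> U}"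
    unfolding openin_ell_w
  proof (intro conjI ballI)
    show "{c \<in> topspace (ell_w p \<omega>). c k \<in> U} \<subseteq> {c. wnorm p \<omega> c < \<infinity>}"
      by (auto simp: topspace_ell_w)
    fix c assume "c \<in> {c \<in> topspace (ell_w p \<omega>). c k \<in> U}"
    then obtain \<epsilon> where \<epsilon>: "0 < \<epsilon>" "ball (c k) \<epsilon> \<subseteq> U"
      using U by (auto simp: open_contains_ball)
    \<comment> \<open>The radius \<epsilon> * \<omega> k forces |e k - c k| < \<epsilon>. If
      \<omega> k is infinite, so is the radius, and finiteness of the norm already gives e k = c
      k.\<close>
    have "e k \<in> U" if "wnorm p \<omega> (\<lambda>k. e k - c k) < ennreal \<epsilon> * \<omega> k" for e
    proof -
      have "ennreal (cmod (e k - c k)) * \<omega> k < ennreal \<epsilon> * \<omega> k"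
        using le_wnorm[OF assms(1), of "\<lambda>k. e k - c k" k \<omega>] that by (rule le_less_trans)
      then have "\<not> \<epsilon> \<le> cmod (e k - c k)"
        using mult_right_mono[OF ennreal_leI, of \<epsilon> "cmod (e k - c k)" "\<omega> k"] by (metis leD zero_le)
      then show ?thesis
        using \<epsilon> by (auto simp: dist_norm norm_minus_commute)
    qed
    then show "\<exists>\<epsilon>>0. \<forall>e. wnorm p \<omega> e < \<infinity> \<and> wnorm p \<omega> (\<lambda>k. e k - c k) < \<epsilon> \<longrightarrow> e \<in> {c \<in> topspace (ell_w p \<omega>). c k \<in> U}"
      using \<epsilon>(1) assms(2) by (intro exI[of _ "ennreal \<epsilon> * \<omega> k"])
        (auto simp: topspace_ell_w ennreal_zero_less_mult_iff zero_less_iff_neq_zero)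
  qed
qed simp

lemma lin_subspace_finite_support: "lin_subspace {c. finite {k. c k \<noteq> 0}}" (is "lin_subspace ?X")
  unfolding lin_subspace_def
proof (intro conjI ballI allI)
  fix c e assume "c \<in> ?X" "e \<in> ?X"
  then have "finite ({k. c k \<noteq> 0} \<union> {k. e k \<noteq> 0})"
    by simp
  then have "finite {k. c k + e k \<noteq> 0}"
    by (rule rev_finite_subset) auto
  then show "(\<lambda>k. c k + e k) \<in> ?X"
    by simp
next
  fix z c assume "c \<in> ?X"
  then show "(\<lambda>k. z * c k) \<in> ?X"
    by (auto elim!: rev_finite_subset)
qed simp

lemma topspace_ell0: "topspace ell0 = {c :: 'd::finite seq2. finite {k. c k \<noteq> 0}}"
  unfolding ell0_def by (rule topspace_finest_lc[OF lin_subspace_finite_support]) simp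

text \<open>Now \<open>a\<close> belongs to the inductive limit and \<open>b\<close> to the
  projective one. \<open>nonzero\<close> makes the coordinates continuous, \<open>finite_at\<close>
  puts the finite sequences into the space. In \<open>lowering\<close> the transposed matrix leads
  from stage a to stage a', and each target step b uses one source step b'. The alternative with an
  infinite weight is there for s = 0.\<close>

locale ind_proj_weights =
  fixes p :: ennreal and W :: "real \<Rightarrow> real \<Rightarrow> 'd::finite mindex \<times> 'd mindex \<Rightarrow> ennreal"
  assumes p_pos: "0 < p"
    and directed: "\<lbrakk>0 < a1; 0 < a2\<rbrakk> \<Longrightarrow> \<exists>a>0. \<forall>b>0. \<forall>k. W a b k \<le> W a1 b k \<and> W a b k \<le> W a2 b k"
    and nonzero: "0 < a \<Longrightarrow> \<exists>b>0. W a b k \<noteq> 0"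
    and finite_at: "\<exists>a>0. \<forall>b>0. W a b k < \<infinity>"
    and lowering: "\<lbrakk>1 \<le> A; 0 < a\<rbrakk> \<Longrightarrow> \<exists>a'>0. \<forall>b>0. \<exists>b'>0. \<exists>K>0. \<forall>j k. diag_below j k \<longrightarrow>
      ennreal (A ^ idx_len k) * W a' b j \<le> ennreal K * W a b' k \<or> (\<exists>b''>0. W a b'' k = \<infinity>)"
begin

abbreviation stage :: "real \<Rightarrow> 'd seq2 topology" where
  "stage a \<equiv> proj_lim (\<lambda>b. ell_w p (W a b))"

abbreviation limit_space :: "'d seq2 topology" where
  "limit_space \<equiv> ind_lim stage"

lemma topspace_stage: "c \<in> topspace (stage a) \<longleftrightarrow> (\<forall>b>0. wnorm p (W a b) c < \<infinity>)"
  by (auto simp: topspace_proj_lim topspace_ell_w)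

lemma lin_subspace_stage: "lin_subspace (topspace (stage a))"
  unfolding topspace_proj_lim by (intro lin_subspace_INT lin_subspace_ell_w p_pos)

lemma lin_subspace_limit: "lin_subspace (\<Union>a\<in>{0<..}. topspace (stage a))"
proof (rule lin_subspace_directed_UN)
  fix a1 a2 :: real assume "a1 \<in> {0<..}" "a2 \<in> {0<..}"
  then obtain a where a: "0 < a" "\<forall>b>0. \<forall>k. W a b k \<le> W a1 b k \<and> W a b k \<le> W a2 b k"
    using directed by (metis greaterThan_iff)
  then have "wnorm p (W a b) c \<le> wnorm p (W a1 b) c" "wnorm p (W a b) c \<le> wnorm p (W a2 b) c" if "0 < b" for b c
    using that by (auto intro: wnorm_mono p_pos)
  then have "topspace (stage a1) \<subseteq> topspace (stage a)" "topspace (stage a2) \<subseteq> topspace (stage a)"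
    unfolding subset_iff topspace_stage by (meson le_less_trans)+
  then show "\<exists>a\<in>{0<..}. topspace (stage a1) \<subseteq> topspace (stage a) \<and> topspace (stage a2) \<subseteq> topspace (stage a)"
    using a(1) by (intro bexI[of _ a]) auto
qed (auto intro: lin_subspace_stage)

lemma topspace_limit_eq: "topspace limit_space = (\<Union>a\<in>{0<..}. topspace (stage a))"
  by (rule topspace_ind_lim[OF lin_subspace_limit])

lemma topspace_limit: "c \<in> topspace limit_space \<longleftrightarrow> (\<exists>a>0. \<forall>b>0. wnorm p (W a b) c < \<infinity>)"
  unfolding topspace_limit_eq by (auto simp: topspace_stage)

text \<open>On the stage \<open>a\<close> the indices \<open>k\<close> with \<open>W a b'' k = \<infinity>\<close> do not matter, since \<open>c k = 0\<close> there.\<close>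

lemma lowering_on_support:
  assumes "1 \<le> A" "0 < a"
  obtains a' where "0 < a'" "\<And>b. 0 < b \<Longrightarrow> \<exists>b'>0. \<exists>K>0. \<forall>c j k. c \<in> topspace (stage a) \<longrightarrow> c k \<noteq> 0 \<longrightarrow>
    diag_below j k \<longrightarrow> ennreal (A ^ idx_len k) * W a' b j \<le> ennreal K * W a b' k"
proof -
  have infinite: "c k = 0" if c: "c \<in> topspace (stage a)" and "0 < b''" "W a b'' k = \<infinity>" for c k b''
  proof -
    have "ennreal (cmod (c k)) * W a b'' k < \<infinity>"
      using le_wnorm[OF p_pos, of c k "W a b''"] c that(2) unfolding topspace_stage by (meson le_less_trans)
    then show ?thesis
      using that(3) by (auto simp: ennreal_mult_less_top)
  qed
  obtain a' where a': "0 < a'" "\<And>b. 0 < b \<Longrightarrow> \<exists>b'>0. \<exists>K>0. \<forall>j k. diag_below j k \<longrightarrow>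
      ennreal (A ^ idx_len k) * W a' b j \<le> ennreal K * W a b' k \<or> (\<exists>b''>0. W a b'' k = \<infinity>)"
    using lowering[OF assms] by blast
  show ?thesis
  proof
    fix b :: real assume "0 < b"
    then obtain b' K where b': "0 < b'" "0 < K" and le: "\<And>j k. diag_below j k \<Longrightarrow>
      ennreal (A ^ idx_len k) * W a' b j \<le> ennreal K * W a b' k \<or> (\<exists>b''>0. W a b'' k = \<infinity>)"
      using a'(2) by blast
    show "\<exists>b'>0. \<exists>K>0. \<forall>c j k. c \<in> topspace (stage a) \<longrightarrow> c k \<noteq> 0 \<longrightarrow>
      diag_below j k \<longrightarrow> ennreal (A ^ idx_len k) * W a' b j \<le> ennreal K * W a b' k"
      using le infinite by (intro exI[of _ b'] exI[of _ K] conjI b' allI impI) blast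
  qed (rule a')
qed

lemma T0_adj_summable:
  assumes "c \<in> topspace limit_space"
  shows "(\<lambda>k. shift_kernel t k j * c k) summable_on UNIV"
proof -
  obtain a where a: "0 < a" "c \<in> topspace (stage a)"
    using assms unfolding topspace_limit_eq by auto
  obtain a' where a': "0 < a'" "\<And>b. 0 < b \<Longrightarrow> \<exists>b'>0. \<exists>K>0. \<forall>c j k. c \<in> topspace (stage a) \<longrightarrow> c k \<noteq> 0 \<longrightarrow>
      diag_below j k \<longrightarrow> ennreal (shift_bound t ^ idx_len k) * W a' b j \<le> ennreal K * W a b' k"
    by (rule lowering_on_support[OF shift_bound_ge_1 a(1)]) blast
  obtain b where b: "0 < b" "W a' b j \<noteq> 0"
    using nonzero[OF a'(1)] by blast
  obtain b' K where b': "0 < b'" "0 < K" and le: "\<And>k. c k \<noteq> 0 \<Longrightarrow> diag_below j k \<Longrightarrow>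
      ennreal (shift_bound t ^ idx_len k) * W a' b j \<le> ennreal K * W a b' k"
    using a'(2)[OF b(1)] a(2) by blast
  show ?thesis
  proof (rule kernel_summable[OF p_pos _ b(2)])
    show "0 \<le> K * (1/2) ^ idx_len j"
      using b' by simp
    show "wnorm p (W a b') c < \<infinity>"
      using a(2) b'(1) by (simp add: topspace_stage)
    fix k assume "c k \<noteq> 0"
    then show "ennreal (cmod (shift_kernel t k j)) * W a' b j
        \<le> ennreal (K * (1/2) ^ idx_len j * (1/2) ^ idx_len k) * W a b' k"
      using shift_kernel_weight_le[of K j k t "W a' b j" "W a b' k"] le b' by (simp add: mult_ac)
  qed
qed

lemma linear_op_on_T0_adj: "linear_op_on (topspace limit_space) (T0_adj t)"
  unfolding T0_adj_eq_kernel_op by (rule linear_op_on_kernel_op) (rule T0_adj_summable)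

lemma continuous_map_T0_adj: "continuous_map limit_space limit_space (T0_adj t)"
proof (rule continuous_map_ind_lim[OF lin_subspace_limit lin_subspace_limit])
  show "linear_op_on (\<Union>a\<in>{0<..}. topspace (stage a)) (T0_adj t)"
    using linear_op_on_T0_adj unfolding topspace_limit_eq .
  fix a :: real assume a: "0 < a"
  obtain C where C: "0 < C" "\<And>\<omega> \<omega>' (M :: 'd mindex \<times> 'd mindex \<Rightarrow> 'd mindex \<times> 'd mindex \<Rightarrow> complex) c K.
      0 \<le> K \<Longrightarrow> (\<And>j k. c j \<noteq> 0 \<Longrightarrow>
        ennreal (cmod (M k j)) * \<omega>' k \<le> ennreal (K * (1/2) ^ idx_len k * (1/2) ^ idx_len j) * \<omega> j) \<Longrightarrow>
      wnorm p \<omega>' (kernel_op M c) \<le> ennreal (K * C) * wnorm p \<omega> c"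
    by (rule wnorm_kernel_op_le[OF p_pos]) blast
  obtain a' where a': "0 < a'" "\<And>b. 0 < b \<Longrightarrow> \<exists>b'>0. \<exists>K>0. \<forall>c j k. c \<in> topspace (stage a) \<longrightarrow> c k \<noteq> 0 \<longrightarrow>
      diag_below j k \<longrightarrow> ennreal (shift_bound t ^ idx_len k) * W a' b j \<le> ennreal K * W a b' k"
    by (rule lowering_on_support[OF shift_bound_ge_1 a]) blast
  have lin: "linear_op_on (topspace (stage a)) (T0_adj t)"
    using linear_op_on_T0_adj by (rule linear_op_on_subset) (use a in \<open>auto simp: topspace_limit_eq\<close>)
  \<comment> \<open>The source stays the whole stage a: as b varies, the estimate refers to
    different steps b' of that stage.\<close>
  have "continuous_map (stage a) (stage a') (T0_adj t)"
  proof (rule continuous_map_into_proj_lim)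
    fix b :: real assume "0 < b"
    then obtain b' K where b': "0 < b'" "0 < K" and le: "\<And>c j k. c \<in> topspace (stage a) \<Longrightarrow> c k \<noteq> 0 \<Longrightarrow>
        diag_below j k \<Longrightarrow> ennreal (shift_bound t ^ idx_len k) * W a' b j \<le> ennreal K * W a b' k"
      using a'(2) by blast
    show "continuous_map (stage a) (ell_w p (W a' b)) (T0_adj t)"
    proof (rule continuous_map_ell_w[OF p_pos lin_subspace_stage continuous_map_proj_lim_id lin])
      show "0 < b'" "0 < K * C"
        using b' C by simp_all
      fix c assume c: "c \<in> topspace (stage a)"
      show "wnorm p (W a' b) (T0_adj t c) \<le> ennreal (K * C) * wnorm p (W a b') c"
        unfolding T0_adj_eq_kernel_op
      proof (rule C(2))
        fix k j assume "c k \<noteq> 0"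
        then show "ennreal (cmod (shift_kernel t k j)) * W a' b j
            \<le> ennreal (K * (1/2) ^ idx_len j * (1/2) ^ idx_len k) * W a b' k"
          using shift_kernel_weight_le[of K j k t "W a' b j" "W a b' k"] le[OF c] b' by (simp add: mult_ac)
      qed (use b' in simp)
    qed
  qed
  then show "\<exists>a'>0. continuous_map (stage a) (stage a') (T0_adj t)"
    using a'(1) by blast
qed

lemma continuous_map_coordinate: "continuous_map limit_space euclidean (\<lambda>c. c k)"
proof (rule continuous_map_ind_lim_coordinate[OF lin_subspace_limit])
  fix a :: real assume "0 < a"
  then obtain b where "0 < b" "W a b k \<noteq> 0"
    using nonzero by blast
  then show "continuous_map (stage a) euclidean (\<lambda>c. c k)"
    using continuous_map_compose[OF continuous_map_proj_lim_id[of b "\<lambda>b. ell_w p (W a b)"]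
        continuous_map_ell_w_coordinate[OF p_pos, of "W a b" k]] by (simp add: o_def)
qed

lemma ell0_subset_limit: "topspace ell0 \<subseteq> topspace limit_space"
proof
  fix c :: "'d seq2" assume "c \<in> topspace ell0"
  then have fin: "finite {k. c k \<noteq> 0}"
    by (simp add: topspace_ell0)
  \<comment> \<open>\<open>finite_at\<close> gives a stage for each single index;
    \<open>directed\<close> merges these stages along the finite support.\<close>
  have "\<exists>a>0. \<forall>b>0. \<forall>k\<in>S. W a b k < \<infinity>" if "finite S" for S
    using that
  proof induction
    case (insert k S)
    then obtain a1 where a1: "0 < a1" "\<forall>b>0. \<forall>k\<in>S. W a1 b k < \<infinity>"
      by blast
    obtain a2 where a2: "0 < a2" "\<forall>b>0. W a2 b k < \<infinity>"
      using finite_at by blast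
    obtain a where a: "0 < a" "\<forall>b>0. \<forall>k. W a b k \<le> W a1 b k \<and> W a b k \<le> W a2 b k"
      using directed[OF a1(1) a2(1)] by blast
    have "\<forall>b>0. \<forall>k\<in>insert k S. W a b k < \<infinity>"
      using a a1 a2 by (metis insert_iff le_less_trans)
    then show ?case
      using a(1) by blast
  qed (auto intro: exI[of _ 1])
  then obtain a where "0 < a" "\<forall>b>0. \<forall>k\<in>{k. c k \<noteq> 0}. W a b k < \<infinity>"
    using fin by blast
  then show "c \<in> topspace limit_space"
    unfolding topspace_limit by (intro exI[of _ a] conjI allI impI wnorm_finite_support[OF p_pos fin]) blast+
qed

definition truncate :: "nat \<Rightarrow> 'd seq2 \<Rightarrow> 'd seq2" where
  "truncate n c = (\<lambda>k. if idx_len k < n then c k else 0)"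

lemma truncate_in_ell0: "truncate n c \<in> topspace ell0"
  unfolding topspace_ell0 mem_Collect_eq
  by (rule finite_subset[OF _ finite_idx_len_less[of n]]) (auto simp: truncate_def)

text \<open>Convergence takes place in another stage a': comparing the weights of a' and a at the
  same index (j = k) gains 4^\<open>idx_len k\<close>, so the entries of c, weighted for a', decay
  like (1/4)^\<open>idx_len k\<close>. On the tail \<open>idx_len k\<close> \<ge> n, one factor
  (1/2)^\<open>idx_len k\<close> gives (1/2)^n and the other gives the l^p bound.\<close>

lemma limitin_truncate:
  assumes "c \<in> topspace limit_space"
  shows "limitin limit_space (\<lambda>n. truncate n c) c sequentially"
proof -
  obtain a where a: "0 < a" "c \<in> topspace (stage a)"
    using assms unfolding topspace_limit_eq by auto
  obtain a' where a': "0 < a'" "\<And>b. 0 < b \<Longrightarrow> \<exists>b'>0. \<exists>K>0. \<forall>c j k. c \<in> topspace (stage a) \<longrightarrow> c k \<noteq> 0 \<longrightarrow>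
      diag_below j k \<longrightarrow> ennreal (4 ^ idx_len k) * W a' b j \<le> ennreal K * W a b' k"
    by (rule lowering_on_support[OF _ a(1), of 4]) auto
  obtain C where C: "0 < C" "\<And>\<omega> (c :: 'd seq2) B.
      (\<And>k. ennreal (cmod (c k)) * \<omega> k \<le> B * ennreal ((1/2) ^ idx_len k)) \<Longrightarrow> wnorm p \<omega> c \<le> B * ennreal C"
    by (rule wnorm_le_if_decay[OF p_pos]) blast
  have conv: "wnorm p (W a' b) c < \<infinity> \<and> (\<lambda>n. wnorm p (W a' b) (\<lambda>k. truncate n c k - c k)) \<longlonglongrightarrow> 0" if "0 < b" for b
  proof -
    obtain b' K where b': "0 < b'" "0 < K" and le: "\<And>k. c k \<noteq> 0 \<Longrightarrow>
        ennreal (4 ^ idx_len k) * W a' b k \<le> ennreal K * W a b' k"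
      using a'(2)[OF \<open>0 < b\<close>] a(2) diag_below_refl by blast
    define B where "B = ennreal K * wnorm p (W a b') c"
    have B: "B < \<infinity>"
      using a(2) b'(1) by (simp add: B_def topspace_stage ennreal_mult_less_top)
    have decay: "ennreal (cmod (c k)) * W a' b k \<le> B * ennreal ((1/4) ^ idx_len k)" for k
    proof (cases "c k = 0")
      case False
      have "ennreal (cmod (c k)) * W a' b k =
          (ennreal ((1/4) ^ idx_len k) * ennreal (4 ^ idx_len k)) * (ennreal (cmod (c k)) * W a' b k)"
        by (subst ennreal_mult[symmetric]) (simp_all only: power_mult_distrib[symmetric], simp_all)
      also have "\<dots> = ennreal ((1/4) ^ idx_len k) * ennreal (cmod (c k)) * (ennreal (4 ^ idx_len k) * W a' b k)"
        by (simp only: mult_ac)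
      also have "\<dots> \<le> ennreal ((1/4) ^ idx_len k) * ennreal (cmod (c k)) * (ennreal K * W a b' k)"
        using le[OF False] by (rule mult_left_mono) simp
      also have "\<dots> = ennreal K * (ennreal (cmod (c k)) * W a b' k) * ennreal ((1/4) ^ idx_len k)"
        by (simp only: mult_ac)
      also have "\<dots> \<le> B * ennreal ((1/4) ^ idx_len k)"
        unfolding B_def by (intro mult_right_mono mult_left_mono le_wnorm p_pos) auto
      finally show ?thesis .
    qed simp
    have quarter: "(1/4 :: real) ^ m = (1/2) ^ m * (1/2) ^ m" for m
      by (simp only: power_mult_distrib[symmetric]) simp
    have tail: "wnorm p (W a' b) (\<lambda>k. truncate n c k - c k) \<le> B * ennreal C * ennreal ((1/2) ^ n)" for n
    proof -
      have "wnorm p (W a' b) (\<lambda>k. truncate n c k - c k) \<le> (B * ennreal ((1/2) ^ n)) * ennreal C"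
      proof (rule C(2))
        fix k
        show "ennreal (cmod (truncate n c k - c k)) * W a' b k \<le> B * ennreal ((1/2) ^ n) * ennreal ((1/2) ^ idx_len k)"
        proof (cases "idx_len k < n")
          case False
          have "B * ennreal ((1/4) ^ idx_len k) \<le> B * ennreal ((1/2) ^ n * (1/2) ^ idx_len k)"
            unfolding quarter using False by (intro mult_left_mono ennreal_leI mult_right_mono power_decreasing) auto
          then show ?thesis
            using decay[of k] False by (simp add: truncate_def ennreal_mult mult.assoc order_trans)
        qed (simp add: truncate_def)
      qed
      then show ?thesis
        by (simp only: mult_ac)
    qed
    have "(\<lambda>n. B * ennreal C * ennreal ((1/2) ^ n)) \<longlonglongrightarrow> B * ennreal C * ennreal 0"
      using B by (intro ennreal_tendsto_cmult tendsto_ennrealI LIMSEQ_realpow_zero) (auto simp: ennreal_mult_less_top)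
    then have lim: "(\<lambda>n. B * ennreal C * ennreal ((1/2) ^ n)) \<longlonglongrightarrow> 0"
      by simp
    have "(\<lambda>n. wnorm p (W a' b) (\<lambda>k. truncate n c k - c k)) \<longlonglongrightarrow> 0"
      by (rule tendsto_sandwich[OF always_eventually always_eventually tendsto_const lim]) (simp_all add: tail)
    moreover have "wnorm p (W a' b) c < \<infinity>"
    proof -
      \<comment> \<open>\<open>truncate 0 c\<close> is the zero sequence, so the tail bound for n =
        0 bounds c itself.\<close>
      have "wnorm p (W a' b) (\<lambda>k. truncate 0 c k - c k) = wnorm p (W a' b) c"
        by (simp add: truncate_def wnorm_def)
      then have "wnorm p (W a' b) c \<le> B * ennreal C * ennreal ((1/2) ^ 0)"
        using tail[of 0] by simp
      also have "\<dots> < \<infinity>"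
        using B by (simp add: ennreal_mult_less_top)
      finally show ?thesis .
    qed
    ultimately show ?thesis
      by blast
  qed
  have trunc: "wnorm p (W a' b) (truncate n c) < \<infinity>" if "0 < b" for b n
  proof -
    have "wnorm p (W a' b) (truncate n c) \<le> wnorm p (W a' b) c"
      unfolding wnorm_def by (intro lp_norm_mono p_pos) (simp add: truncate_def)
    then show ?thesis
      using conv[OF \<open>0 < b\<close>] by (auto intro: le_less_trans)
  qed
  have "limitin (stage a') (\<lambda>n. truncate n c) c sequentially"
    using conv trunc by (intro limitin_proj_lim limitin_ell_w) (auto simp: topspace_stage)
  then show ?thesis
    using continuous_map_limit[OF continuous_map_into_ind_lim[OF lin_subspace_limit a'(1)]]
    by (fastforce simp: o_def)
qed

text \<open>Truncations lie in \<open>ell0\<close> and converge, and limits are compared coordinate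
  by coordinate in the complex plane. This yields uniqueness among all continuous extensions, linear
  or not.\<close>

lemma continuous_map_eq_if_eq_on_ell0:
  assumes F: "continuous_map limit_space limit_space F" and G: "continuous_map limit_space limit_space G"
    and eq: "\<And>c. c \<in> topspace ell0 \<Longrightarrow> F c = G c" and c: "c \<in> topspace limit_space"
  shows "F c = G c"
proof
  fix k
  have lim: "(\<lambda>n. H (truncate n c) k) \<longlonglongrightarrow> H c k" if "continuous_map limit_space limit_space H" for H
    using continuous_map_limit[OF continuous_map_compose[OF that continuous_map_coordinate[of k]] limitin_truncate[OF c]]
    by (simp add: o_def)
  show "F c k = G c k"
    using lim[OF F] lim[OF G] eq[OF truncate_in_ell0] by (simp add: LIMSEQ_unique)
qed

lemma T0_adj_unique_extension: "unique_extension ell0 limit_space (T0_adj t) (T0_adj t)"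
  unfolding unique_extension_def continuous_linear_op_def
  using ell0_subset_limit continuous_map_T0_adj linear_op_on_T0_adj[unfolded linear_op_on_def]
    continuous_map_eq_if_eq_on_ell0 by blast

text \<open>The double series is never rearranged on the limit space: both sides are continuous and
  agree on finite sequences.\<close>

lemma T0_adj_uminus:
  assumes "c \<in> topspace limit_space"
  shows "T0_adj (- t) (T0_adj t c) = c"
proof -
  have "(T0_adj (- t) \<circ> T0_adj t) c = id c"
  proof (rule continuous_map_eq_if_eq_on_ell0[OF _ continuous_map_id _ assms])
    show "continuous_map limit_space limit_space (T0_adj (- t) \<circ> T0_adj t)"
      using continuous_map_T0_adj continuous_map_T0_adj by (rule continuous_map_compose)
    show "(T0_adj (- t) \<circ> T0_adj t) c = id c" if "c \<in> topspace ell0" for c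
      using that by (simp add: topspace_ell0 T0_adj_T0_adj T0_adj_0)
  qed
  then show ?thesis
    by simp
qed

lemma T0_adj_homeomorphic_maps:
  "\<exists>F G. unique_extension ell0 limit_space (T0_adj t) F \<and>
     unique_extension ell0 limit_space (T0_adj (- t)) G \<and>
     homeomorphic_maps limit_space limit_space F G \<and>
     S0 ` topspace limit_space = topspace limit_space \<and>
     (\<forall>c\<in>topspace limit_space. G c = (inv S0 \<circ> F \<circ> S0) c)"
proof (intro exI conjI ballI)
  show "homeomorphic_maps limit_space limit_space (T0_adj t) (T0_adj (- t))"
    unfolding homeomorphic_maps_def using T0_adj_uminus[of _ t] T0_adj_uminus[of _ "- t"]
    by (simp add: continuous_map_T0_adj)
  show "S0 ` topspace limit_space = topspace limit_space"
    by (rule image_S0_eq) (simp add: topspace_limit wnorm_S0)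
  show "T0_adj (- t) c = (inv S0 \<circ> T0_adj t \<circ> S0) c" for c
    by (simp add: T0_adj_S0 inv_f_f bij_is_inj[OF bij_S0])
qed (rule T0_adj_unique_extension)+

end

section \<open>The weights\<close>

lemma flat_real_less_half_cases:
  assumes "s \<in> flat_reals" "s < Num (1/2)"
  obtains "s = Num 0" | x where "s = Num x" "0 < x" "x < 1/2" | \<sigma> where "s = Flat \<sigma>" "0 < \<sigma>"
  using assms by (cases s) (force simp: flat_reals_def)+

lemma flat_real_le_half_cases:
  assumes "s \<in> flat_reals" "Num 0 < s" "s \<le> Num (1/2)"
  obtains x where "s = Num x" "0 < x" "x \<le> 1/2" | \<sigma> where "s = Flat \<sigma>" "0 < \<sigma>"
  using assms by (cases s) (auto simp: flat_reals_def less_eq_flat_real_def)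

text \<open>The finite form of \<open>vartheta\<close>, so that the estimates can be done in the
  reals; the two agree for every index other than \<open>Num 0\<close>.\<close>

fun real_weight :: "flat_real \<Rightarrow> real \<Rightarrow> 'd::finite mindex \<Rightarrow> real" where
  "real_weight (Num s) r \<alpha> = exp (r * real (mlen \<alpha>) powr (1 / (2 * s)))"
| "real_weight (Flat \<sigma>) r \<alpha> = r ^ mlen \<alpha> * real (mfact \<alpha>) powr (1 / (2 * \<sigma>))"

lemma vartheta_eq_real_weight: "s \<noteq> Num 0 \<Longrightarrow> vartheta s r \<alpha> = ennreal (real_weight s r \<alpha>)"
  by (cases s) auto

lemma mfact_pos: "0 < mfact \<alpha>"
  by (simp add: mfact_def prod_pos)

lemma real_weight_pos: "0 < r \<Longrightarrow> 0 < real_weight s r \<alpha>"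
  using mfact_pos[of \<alpha>] by (cases s) auto

lemma real_weight_mono:
  assumes "0 < r" "r \<le> r'"
  shows "real_weight s r \<alpha> \<le> real_weight s r' \<alpha>"
  using assms by (cases s) (auto intro!: mult_right_mono power_mono)

lemma vartheta_pos: "0 < r \<Longrightarrow> 0 < vartheta s r \<alpha>"
  using real_weight_pos[of r s \<alpha>] by (cases "s = Num 0") (auto simp: vartheta_eq_real_weight)

lemma vartheta_less_top: "s \<noteq> Num 0 \<Longrightarrow> vartheta s r \<alpha> < top"
  by (simp add: vartheta_eq_real_weight)

text \<open>For \<open>s = 0\<close> the weight decreases in \<open>r\<close>, for all other indices it increases.\<close>

lemma vartheta_directed_below:
  assumes "0 < r1" "0 < r2"
  obtains r where "0 < r" "\<And>\<alpha>. vartheta s r \<alpha> \<le> vartheta s r1 \<alpha>" "\<And>\<alpha>. vartheta s r \<alpha> \<le> vartheta s r2 \<alpha>"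
proof (cases "s = Num 0")
  case True
  show ?thesis
    by (rule that[of "max r1 r2"]) (use assms True in auto)
next
  case False
  show ?thesis
    by (rule that[of "min r1 r2"])
      (use assms in \<open>auto simp: vartheta_eq_real_weight[OF False] intro!: ennreal_leI real_weight_mono\<close>)
qed

lemma vartheta_directed_above:
  assumes "s \<noteq> Num 0" "0 < r1" "0 < r2"
  obtains r where "0 < r" "\<And>\<alpha>. vartheta s r1 \<alpha> \<le> vartheta s r \<alpha>" "\<And>\<alpha>. vartheta s r2 \<alpha> \<le> vartheta s r \<alpha>"
  by (rule that[of "max r1 r2"])
    (use assms in \<open>auto simp: vartheta_eq_real_weight intro!: ennreal_leI real_weight_mono\<close>)

lemma vartheta_finite_at:
  obtains r where "0 < r" "vartheta s r \<alpha> < top"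
proof (cases "s = Num 0")
  case True
  show ?thesis
    by (rule that[of "real (mlen \<alpha>) + 1"]) (auto simp: True)
next
  case False
  show ?thesis
    by (rule that[of 1]) (auto simp: vartheta_less_top[OF False])
qed

section \<open>Exchange inequalities for the weights\<close>

lemma linear_le_powr:
  assumes "1 < \<kappa>" "0 < \<delta>" "0 \<le> c"
  obtains C where "\<And>n :: nat. c * real n \<le> C + \<delta> * real n powr \<kappa>"
proof
  fix n :: nat
  \<comment> \<open>The threshold beyond which \<delta> n^(\<kappa> - 1) \<ge> c; up to it the
    linear term is at most the constant \<open>c * ?N\<close>.\<close>
  let ?N = "(c / \<delta>) powr (1 / (\<kappa> - 1))"
  show "c * real n \<le> c * ?N + \<delta> * real n powr \<kappa>"
  proof (cases "real n \<le> ?N")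
    case True
    then have "c * real n \<le> c * ?N"
      using assms(3) by (rule mult_left_mono)
    then show ?thesis
      using assms(2) by (simp add: add_increasing2)
  next
    case False
    then have n: "0 < real n"
      by (metis not_le order_le_less_trans powr_ge_zero)
    have "?N powr (\<kappa> - 1) \<le> real n powr (\<kappa> - 1)"
      using False assms(1) by (intro powr_mono2) auto
    then have "c / \<delta> \<le> real n powr (\<kappa> - 1)"
      using assms by (simp add: powr_powr)
    then have "c \<le> \<delta> * real n powr (\<kappa> - 1)"
      using assms(2) by (simp add: field_simps)
    then have "c * real n \<le> \<delta> * real n powr (\<kappa> - 1) * real n"
      using n by (intro mult_right_mono) auto
    also have "\<dots> = \<delta> * real n powr \<kappa>"
      using n by (simp add: powr_diff)
    finally show ?thesis
      using assms(3) by (simp add: add_increasing)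
  qed
qed

lemma powr_add_le:
  fixes x y :: real
  assumes "0 \<le> x" "0 \<le> y" "0 \<le> \<kappa>"
  shows "(x + y) powr \<kappa> \<le> 2 powr \<kappa> * (x powr \<kappa> + y powr \<kappa>)"
proof -
  have "(x + y) powr \<kappa> \<le> (2 * max x y) powr \<kappa>"
    using assms by (intro powr_mono2) auto
  also have "\<dots> = 2 powr \<kappa> * max x y powr \<kappa>"
    by (rule powr_mult)
  also have "\<dots> \<le> 2 powr \<kappa> * (x powr \<kappa> + y powr \<kappa>)"
    by (intro mult_left_mono) (auto simp: max_def)
  finally show ?thesis .
qed

lemma nat_le_powr: "1 \<le> \<kappa> \<Longrightarrow> real n \<le> real n powr \<kappa>"
  using powr_mono[of 1 \<kappa> "real n"] by (cases "n = 0") auto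

lemma mfact_add: "mfact (\<alpha> + \<gamma>) = mbinom (\<alpha> + \<gamma>) \<gamma> * (mfact \<alpha> * mfact \<gamma>)"
proof -
  have "fact (m + n) = (m + n choose n) * (fact m * fact n :: nat)" for m n :: nat
    using binomial_fact_lemma[of n "m + n"] by (simp add: mult_ac)
  then show ?thesis
    by (simp add: mfact_def mbinom_def flip: prod.distrib)
qed

text \<open>Together with \<open>mfact_mult_le\<close>: factorials are multiplicative up to an
  exponential factor, since the binomial lies between 1 and 2^|\<alpha> + \<gamma>|. At
  \<open>Flat\<close> indices such factors are absorbed by r^|\<alpha>|.\<close>

lemma mfact_add_le: "mfact (\<alpha> + \<gamma>) \<le> 2 ^ mlen (\<alpha> + \<gamma>) * (mfact \<alpha> * mfact \<gamma>)"
  unfolding mfact_add by (intro mult_right_mono mbinom_le) simp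

lemma mfact_mult_le: "mfact \<alpha> * mfact \<gamma> \<le> mfact (\<alpha> + \<gamma>)"
proof -
  have "1 \<le> mbinom (\<alpha> + \<gamma>) \<gamma>"
    unfolding mbinom_def by (intro prod_ge_1) (simp add: Suc_le_eq)
  then show ?thesis
    unfolding mfact_add by simp
qed

text \<open>\<gamma>! is split off (\<alpha> + \<gamma>)! at an exponential cost and then merged
  with \<beta>! at no cost.\<close>

lemma mfact_powr_exchange:
  assumes "0 \<le> \<kappa>"
  shows "real (mfact (\<alpha> + \<gamma>)) powr \<kappa> * real (mfact \<beta>) powr \<kappa>
    \<le> (2 powr \<kappa>) ^ mlen (\<alpha> + \<gamma>) * (real (mfact \<alpha>) powr \<kappa> * real (mfact (\<beta> + \<gamma>)) powr \<kappa>)"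
proof -
  have "mfact (\<alpha> + \<gamma>) * mfact \<beta> \<le> 2 ^ mlen (\<alpha> + \<gamma>) * (mfact \<alpha> * mfact \<gamma>) * mfact \<beta>"
    by (intro mult_right_mono mfact_add_le) simp
  also have "\<dots> = 2 ^ mlen (\<alpha> + \<gamma>) * (mfact \<alpha> * (mfact \<beta> * mfact \<gamma>))"
    by (simp only: mult_ac)
  also have "\<dots> \<le> 2 ^ mlen (\<alpha> + \<gamma>) * (mfact \<alpha> * mfact (\<beta> + \<gamma>))"
    by (intro mult_left_mono mfact_mult_le) simp_all
  finally have "real (mfact (\<alpha> + \<gamma>) * mfact \<beta>) \<le> real (2 ^ mlen (\<alpha> + \<gamma>) * (mfact \<alpha> * mfact (\<beta> + \<gamma>)))"
    by (simp only: of_nat_le_iff)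
  then have "(real (mfact (\<alpha> + \<gamma>)) * real (mfact \<beta>)) powr \<kappa>
      \<le> (2 ^ mlen (\<alpha> + \<gamma>) * (real (mfact \<alpha>) * real (mfact (\<beta> + \<gamma>)))) powr \<kappa>"
    using assms by (intro powr_mono2) auto
  moreover have "(2 ^ n) powr \<kappa> = (2 powr \<kappa>) ^ n" for n
    by (auto simp: powr_powr powr_realpow[symmetric] mult.commute)
  ultimately show ?thesis
    by (simp add: powr_mult)
qed

text \<open>The new base r' absorbs r, A and the cost 2^(1/(2\<sigma>)) of exchanging factorials. It
  then carries the exponent |\<alpha> + \<gamma>|; the surplus r'^|\<gamma>| joins q^|\<beta>| under
  the common base max r' q, and q' absorbs that base together with A^|\<beta> + \<gamma>|.\<close>

lemma flat_real_weight_exchange: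
  fixes \<alpha> \<beta> \<gamma> :: "'d::finite mindex"
  assumes \<sigma>: "0 < \<sigma>" and A: "1 \<le> A" and pos: "0 < r" "0 < q" "0 < q'"
    and r: "A * r * 2 powr (1 / (2 * \<sigma>)) \<le> r'" and q: "A * max r' q \<le> q'"
  shows "A ^ (mlen (\<alpha> + \<gamma>) + mlen (\<beta> + \<gamma>)) * (real_weight (Flat \<sigma>) r (\<alpha> + \<gamma>) * real_weight (Flat \<sigma>) q \<beta>)
    \<le> real_weight (Flat \<sigma>) r' \<alpha> * real_weight (Flat \<sigma>) q' (\<beta> + \<gamma>)"
proof -
  define \<kappa> where "\<kappa> = 1 / (2 * \<sigma>)"
  have \<kappa>: "0 \<le> \<kappa>"
    using \<sigma> by (simp add: \<kappa>_def)
  let ?m = "mlen (\<alpha> + \<gamma>)" and ?n = "mlen (\<beta> + \<gamma>)"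
  let ?F = "real (mfact \<alpha>) powr \<kappa> * real (mfact (\<beta> + \<gamma>)) powr \<kappa>"
  have r': "0 < r'"
    using pos A by (intro less_le_trans[OF _ r]) auto
  have "A ^ (?m + ?n) * (real_weight (Flat \<sigma>) r (\<alpha> + \<gamma>) * real_weight (Flat \<sigma>) q \<beta>)
      = (A ^ ?m * r ^ ?m * A ^ ?n * q ^ mlen \<beta>) * (real (mfact (\<alpha> + \<gamma>)) powr \<kappa> * real (mfact \<beta>) powr \<kappa>)"
    by (simp add: \<kappa>_def power_add mult_ac)
  also have "\<dots> \<le> (A ^ ?m * r ^ ?m * A ^ ?n * q ^ mlen \<beta>) * ((2 powr \<kappa>) ^ ?m * ?F)"
    using pos A by (intro mult_left_mono mfact_powr_exchange[OF \<kappa>]) auto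
  also have "\<dots> = ((A * r * 2 powr \<kappa>) ^ ?m * A ^ ?n * q ^ mlen \<beta>) * ?F"
    by (simp add: power_mult_distrib mult_ac)
  also have "\<dots> \<le> (r' ^ mlen \<alpha> * q' ^ ?n) * ?F"
  proof (rule mult_right_mono)
    have "(A * r * 2 powr \<kappa>) ^ ?m * A ^ ?n * q ^ mlen \<beta> \<le> r' ^ ?m * A ^ ?n * max r' q ^ mlen \<beta>"
      using pos A r r' by (intro mult_mono power_mono) (auto simp: \<kappa>_def)
    also have "\<dots> = r' ^ mlen \<alpha> * (A ^ ?n * (max r' q ^ mlen \<beta> * r' ^ mlen \<gamma>))"
      by (simp add: mlen_add power_add mult_ac)
    also have "\<dots> \<le> r' ^ mlen \<alpha> * (A ^ ?n * (max r' q ^ mlen \<beta> * max r' q ^ mlen \<gamma>))"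
      using r' A by (intro mult_left_mono power_mono) auto
    also have "\<dots> = r' ^ mlen \<alpha> * (A * max r' q) ^ ?n"
      by (simp add: mlen_add power_add power_mult_distrib)
    also have "\<dots> \<le> r' ^ mlen \<alpha> * q' ^ ?n"
      using r' A q by (intro mult_left_mono power_mono) auto
    finally show "(A * r * 2 powr \<kappa>) ^ ?m * A ^ ?n * q ^ mlen \<beta> \<le> r' ^ mlen \<alpha> * q' ^ ?n" .
  qed simp
  also have "\<dots> = real_weight (Flat \<sigma>) r' \<alpha> * real_weight (Flat \<sigma>) q' (\<beta> + \<gamma>)"
    by (simp add: \<kappa>_def mult_ac)
  finally show ?thesis .
qed

text \<open>After taking logarithms everything is additive. The linear terms from A are charged to v
  and w times n^\<kappa>, \<kappa> = 1/(2x), up to the constants C and D. The power at \<alpha> +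
  \<gamma> is split at the price 2^\<kappa>: the part at \<alpha> goes into r', and the part at
  \<gamma>, bounded by the power at \<beta> + \<gamma>, goes into q'.\<close>

lemma num_real_weight_exchange:
  fixes \<alpha> \<beta> \<gamma> :: "'d::finite mindex"
  assumes x: "0 < x" and A: "1 \<le> A" and pos: "0 \<le> r" "0 \<le> q" "0 \<le> v" "0 \<le> w"
    and v: "\<And>n :: nat. ln A * real n \<le> C + v * real n powr (1 / (2 * x))"
    and w: "\<And>n :: nat. ln A * real n \<le> D + w * real n powr (1 / (2 * x))"
    and r: "(r + v) * 2 powr (1 / (2 * x)) \<le> r'" and q: "(r + v) * 2 powr (1 / (2 * x)) + q + w \<le> q'"
  shows "A ^ (mlen (\<alpha> + \<gamma>) + mlen (\<beta> + \<gamma>)) * (real_weight (Num x) r (\<alpha> + \<gamma>) * real_weight (Num x) q \<beta>)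
    \<le> exp (C + D) * (real_weight (Num x) r' \<alpha> * real_weight (Num x) q' (\<beta> + \<gamma>))"
proof -
  define \<kappa> where "\<kappa> = 1 / (2 * x)"
  have \<kappa>: "0 \<le> \<kappa>"
    using x by (simp add: \<kappa>_def)
  define P where "P = (\<lambda>\<gamma> :: 'd mindex. real (mlen \<gamma>) powr \<kappa>)"
  have P_nonneg: "0 \<le> P \<mu>" for \<mu>
    by (simp add: P_def)
  have P_mono: "P \<beta> \<le> P (\<beta> + \<gamma>)" "P \<gamma> \<le> P (\<beta> + \<gamma>)"
    using \<kappa> by (auto simp: P_def mlen_add intro!: powr_mono2)
  have P_add: "P (\<alpha> + \<gamma>) \<le> 2 powr \<kappa> * (P \<alpha> + P \<gamma>)"
    using powr_add_le[OF _ _ \<kappa>, of "real (mlen \<alpha>)" "real (mlen \<gamma>)"] by (simp add: P_def mlen_add)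
  have "(r + v) * P (\<alpha> + \<gamma>) \<le> (r + v) * (2 powr \<kappa> * (P \<alpha> + P \<gamma>))"
    using pos by (intro mult_left_mono P_add) auto
  also have "\<dots> = ((r + v) * 2 powr \<kappa>) * P \<alpha> + ((r + v) * 2 powr \<kappa>) * P \<gamma>"
    by (simp add: algebra_simps)
  also have "\<dots> \<le> r' * P \<alpha> + ((r + v) * 2 powr \<kappa>) * P (\<beta> + \<gamma>)"
    using r pos by (intro add_mono mult_right_mono mult_left_mono P_mono P_nonneg) (auto simp: \<kappa>_def)
  finally have 1: "(r + v) * P (\<alpha> + \<gamma>) \<le> r' * P \<alpha> + ((r + v) * 2 powr \<kappa>) * P (\<beta> + \<gamma>)" .
  have 2: "q * P \<beta> \<le> q * P (\<beta> + \<gamma>)"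
    using pos by (intro mult_left_mono P_mono) auto
  have 3: "((r + v) * 2 powr \<kappa> + q + w) * P (\<beta> + \<gamma>) \<le> q' * P (\<beta> + \<gamma>)"
    using q by (intro mult_right_mono P_nonneg) (auto simp: \<kappa>_def)
  have "ln A * real (mlen (\<alpha> + \<gamma>)) + ln A * real (mlen (\<beta> + \<gamma>)) + r * P (\<alpha> + \<gamma>) + q * P \<beta>
      \<le> C + D + r' * P \<alpha> + q' * P (\<beta> + \<gamma>)"
    using v[of "mlen (\<alpha> + \<gamma>)"] w[of "mlen (\<beta> + \<gamma>)"] 1 2 3
    unfolding P_def[symmetric] \<kappa>_def[symmetric] by (simp add: P_def algebra_simps)
  then have "exp (ln A * real (mlen (\<alpha> + \<gamma>)) + ln A * real (mlen (\<beta> + \<gamma>)) + r * P (\<alpha> + \<gamma>) + q * P \<beta>)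
      \<le> exp (C + D + r' * P \<alpha> + q' * P (\<beta> + \<gamma>))"
    by (simp only: exp_le_cancel_iff)
  moreover have "exp (ln A * real n) = A ^ n" for n
    using A by (subst mult.commute, subst exp_of_nat_mult) simp
  ultimately show ?thesis
    by (simp add: exp_add power_add P_def \<kappa>_def mult_ac)
qed

lemma vartheta_exchangeI:
  fixes \<alpha> \<beta> \<gamma> :: "'d::finite mindex"
  assumes "s \<noteq> Num 0" "1 \<le> A" "0 < r" "0 < q" "0 < r'" "0 < q'" "0 < K"
    and "\<And>\<alpha> \<beta> \<gamma> :: 'd mindex. A ^ (mlen (\<alpha> + \<gamma>) + mlen (\<beta> + \<gamma>)) * (real_weight s r (\<alpha> + \<gamma>) * real_weight s q \<beta>)
      \<le> K * (real_weight s r' \<alpha> * real_weight s q' (\<beta> + \<gamma>))"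
  shows "ennreal (A ^ (mlen (\<alpha> + \<gamma>) + mlen (\<beta> + \<gamma>))) * (vartheta s r (\<alpha> + \<gamma>) * vartheta s q \<beta>)
    \<le> ennreal K * (vartheta s r' \<alpha> * vartheta s q' (\<beta> + \<gamma>))"
proof -
  have pos: "0 \<le> real_weight s r (\<alpha> + \<gamma>)" "0 \<le> real_weight s q \<beta>" "0 \<le> real_weight s r' \<alpha>"
    "0 \<le> real_weight s q' (\<beta> + \<gamma>)"
    using assms(3-6) by (simp_all add: less_imp_le real_weight_pos)
  show ?thesis
    using ennreal_leI[OF assms(8)[of \<alpha> \<gamma> \<beta>]] assms(2,7) pos
    by (simp add: vartheta_eq_real_weight[OF assms(1)] ennreal_mult)
qed

text \<open>The dual of an inequality for \<open>T0\<close> is the inequality with the two indices interchanged,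
  so two exchange inequalities serve all eight spaces. The first one chooses the new parameters
  small, which needs \<open>s < 1/2\<close> since the factor \<open>A ^ mlen (\<beta> + \<gamma>)\<close> has to be absorbed by an arbitrarily
  small change of weight; the second one chooses them large.\<close>

lemma vartheta_exchange_lower:
  assumes s: "s \<in> flat_reals" "s < Num (1/2)" and A: "1 \<le> A" and q': "0 < q'"
  obtains q where "0 < q" "\<And>\<alpha> \<gamma> :: 'd::finite mindex. vartheta s q' (\<alpha> + \<gamma>) < top \<Longrightarrow> vartheta s q \<alpha> < top"
    "\<And>r'. 0 < r' \<Longrightarrow> \<exists>r>0. \<exists>K>0. \<forall>\<alpha> \<beta> \<gamma> :: 'd mindex.
      ennreal (A ^ (mlen (\<alpha> + \<gamma>) + mlen (\<beta> + \<gamma>))) * (vartheta s r (\<alpha> + \<gamma>) * vartheta s q \<beta>)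
      \<le> ennreal K * (vartheta s r' \<alpha> * vartheta s q' (\<beta> + \<gamma>))"
  using s
proof (cases rule: flat_real_less_half_cases)
  case 1
  show thesis
  proof (rule that[OF q'])
    fix \<alpha> \<gamma> :: "'d mindex" assume "vartheta s q' (\<alpha> + \<gamma>) < top"
    then show "vartheta s q' \<alpha> < top"
      by (auto simp: 1 mlen_add split: if_splits)
  next
    fix r' :: real assume r': "0 < r'"
    \<comment> \<open>For s = 0 the weights are 1 or \<infinity>. Where the right-hand side is
      finite, |\<alpha>| \<le> r' and |\<beta> + \<gamma>| \<le> q', so |\<alpha> + \<gamma>| \<le>
      r' + q': the weights on the left are 1 and the power of A is at most K.\<close>
    define K where "K = A ^ (nat \<lceil>r' + q'\<rceil> + nat \<lceil>q'\<rceil>)"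
    have K: "0 < K"
      using A by (simp add: K_def)
    have "ennreal (A ^ (mlen (\<alpha> + \<gamma>) + mlen (\<beta> + \<gamma>))) * (vartheta s (r' + q') (\<alpha> + \<gamma>) * vartheta s q' \<beta>)
      \<le> ennreal K * (vartheta s r' \<alpha> * vartheta s q' (\<beta> + \<gamma>))" for \<alpha> \<beta> \<gamma> :: "'d mindex"
    proof (cases "real (mlen \<alpha>) \<le> r' \<and> real (mlen (\<beta> + \<gamma>)) \<le> q'")
      case True
      then have le: "real (mlen (\<alpha> + \<gamma>)) \<le> r' + q'" "real (mlen \<beta>) \<le> q'"
        by (auto simp: mlen_add)
      then have "mlen (\<alpha> + \<gamma>) \<le> nat \<lceil>r' + q'\<rceil>" "mlen (\<beta> + \<gamma>) \<le> nat \<lceil>q'\<rceil>"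
        using True by linarith+
      then have "A ^ (mlen (\<alpha> + \<gamma>) + mlen (\<beta> + \<gamma>)) \<le> K"
        unfolding K_def using A by (intro power_increasing add_mono)
      then show ?thesis
        using True le by (simp add: 1 ennreal_leI)
    next
      case False
      then have "vartheta s r' \<alpha> * vartheta s q' (\<beta> + \<gamma>) = top"
        by (auto simp: 1 ennreal_top_mult ennreal_mult_top)
      then show ?thesis
        using K by (simp add: ennreal_mult_top)
    qed
    then show "\<exists>r>0. \<exists>K>0. \<forall>\<alpha> \<beta> \<gamma> :: 'd mindex.
        ennreal (A ^ (mlen (\<alpha> + \<gamma>) + mlen (\<beta> + \<gamma>))) * (vartheta s r (\<alpha> + \<gamma>) * vartheta s q' \<beta>)
        \<le> ennreal K * (vartheta s r' \<alpha> * vartheta s q' (\<beta> + \<gamma>))"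
      using r' q' K by (intro exI[of _ "r' + q'"] exI[of _ K]) auto
  qed
next
  case (2 x)
  have \<kappa>: "1 < 1 / (2 * x)"
    using 2 by simp
  have lnA: "0 \<le> ln A"
    using A by simp
  have s0: "s \<noteq> Num 0"
    using 2 by simp
  show thesis
  proof (rule that[of "q' / 4"])
    show "0 < q' / 4"
      using q' by simp
    show "vartheta s (q' / 4) \<alpha> < top" for \<alpha> :: "'d mindex"
      by (rule vartheta_less_top[OF s0])
    fix r' :: real assume r': "0 < r'"
    \<comment> \<open>The exponential at \<alpha> + \<gamma> is charged to a second copy of r, hence
      the 2 in the denominator. The minimum makes 2r * 2^(1/(2x)) fit both into r' and into a
      quarter of q'; two further quarters go to the weight at \<beta> and to the exponential at
      \<beta> + \<gamma>.\<close>
    define r where "r = min r' (q' / 4) / (2 * 2 powr (1 / (2 * x)))"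
    have r: "0 < r" "2 * r * 2 powr (1 / (2 * x)) = min r' (q' / 4)"
      using r' q' by (auto simp: r_def)
    obtain C where C: "\<And>n :: nat. ln A * real n \<le> C + r * real n powr (1 / (2 * x))"
      by (rule linear_le_powr[OF \<kappa> r(1) lnA]) blast
    obtain D where D: "\<And>n :: nat. ln A * real n \<le> D + q' / 4 * real n powr (1 / (2 * x))"
      by (rule linear_le_powr[OF \<kappa> _ lnA, of "q' / 4"]) (use q' in auto)
    have "A ^ (mlen (\<alpha> + \<gamma>) + mlen (\<beta> + \<gamma>)) * (real_weight s r (\<alpha> + \<gamma>) * real_weight s (q' / 4) \<beta>)
      \<le> exp (C + D) * (real_weight s r' \<alpha> * real_weight s q' (\<beta> + \<gamma>))" for \<alpha> \<beta> \<gamma> :: "'d mindex"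
      unfolding 2(1) using 2 A q' r
      by (intro num_real_weight_exchange[OF 2(2) A _ _ _ _ C D]) auto
    then show "\<exists>r>0. \<exists>K>0. \<forall>\<alpha> \<beta> \<gamma> :: 'd mindex.
        ennreal (A ^ (mlen (\<alpha> + \<gamma>) + mlen (\<beta> + \<gamma>))) * (vartheta s r (\<alpha> + \<gamma>) * vartheta s (q' / 4) \<beta>)
        \<le> ennreal K * (vartheta s r' \<alpha> * vartheta s q' (\<beta> + \<gamma>))"
      using A q' r' r(1) by (intro exI[of _ r] exI[of _ "exp (C + D)"] conjI allI vartheta_exchangeI[OF s0]) auto
  qed
next
  case (3 \<sigma>)
  have s0: "s \<noteq> Num 0"
    using 3 by simp
  show thesis
  proof (rule that[of "q' / A"])
    show "0 < q' / A"
      using q' A by simp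
    show "vartheta s (q' / A) \<alpha> < top" for \<alpha> :: "'d mindex"
      by (rule vartheta_less_top[OF s0])
    fix r' :: real assume r': "0 < r'"
    \<comment> \<open>The bound m \<le> q' / A keeps max m (q' / A) equal to q' / A, so that A times
      it is exactly q'.\<close>
    define m where "m = min r' (q' / A)"
    define r where "r = m / (A * 2 powr (1 / (2 * \<sigma>)))"
    have m: "0 < m" "m \<le> r'" "max m (q' / A) = q' / A"
      using r' q' A by (auto simp: m_def)
    have r: "0 < r" "A * r * 2 powr (1 / (2 * \<sigma>)) = m"
      using m A by (auto simp: r_def)
    have "A ^ (mlen (\<alpha> + \<gamma>) + mlen (\<beta> + \<gamma>)) * (real_weight s r (\<alpha> + \<gamma>) * real_weight s (q' / A) \<beta>)
      \<le> 1 * (real_weight s r' \<alpha> * real_weight s q' (\<beta> + \<gamma>))" for \<alpha> \<beta> \<gamma> :: "'d mindex"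
    proof -
      have "A ^ (mlen (\<alpha> + \<gamma>) + mlen (\<beta> + \<gamma>)) * (real_weight s r (\<alpha> + \<gamma>) * real_weight s (q' / A) \<beta>)
        \<le> real_weight s m \<alpha> * real_weight s q' (\<beta> + \<gamma>)"
        unfolding 3(1) using A q' r m by (intro flat_real_weight_exchange[OF 3(2) A]) auto
      also have "\<dots> \<le> real_weight s r' \<alpha> * real_weight s q' (\<beta> + \<gamma>)"
        by (intro mult_right_mono real_weight_mono[OF m(1,2)] less_imp_le[OF real_weight_pos[OF q']])
      finally show ?thesis
        by simp
    qed
    then show "\<exists>r>0. \<exists>K>0. \<forall>\<alpha> \<beta> \<gamma> :: 'd mindex.
        ennreal (A ^ (mlen (\<alpha> + \<gamma>) + mlen (\<beta> + \<gamma>))) * (vartheta s r (\<alpha> + \<gamma>) * vartheta s (q' / A) \<beta>)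
        \<le> ennreal K * (vartheta s r' \<alpha> * vartheta s q' (\<beta> + \<gamma>))"
      using A q' r' r(1) by (intro exI[of _ r] exI[of _ 1] conjI allI vartheta_exchangeI[OF s0]) auto
  qed
qed

lemma vartheta_exchange_raise:
  assumes s: "s \<in> flat_reals" "Num 0 < s" "s \<le> Num (1/2)" and A: "1 \<le> A" and r: "0 < r"
  obtains r' where "0 < r'"
    "\<And>q. 0 < q \<Longrightarrow> \<exists>q'>0. \<exists>K>0. \<forall>\<alpha> \<beta> \<gamma> :: 'd::finite mindex.
      ennreal (A ^ (mlen (\<alpha> + \<gamma>) + mlen (\<beta> + \<gamma>))) * (vartheta s r (\<alpha> + \<gamma>) * vartheta s q \<beta>)
      \<le> ennreal K * (vartheta s r' \<alpha> * vartheta s q' (\<beta> + \<gamma>))"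
  using s
proof (cases rule: flat_real_le_half_cases)
  case (1 x)
  have s0: "s \<noteq> Num 0"
    using 1 by simp
  have \<kappa>: "1 \<le> 1 / (2 * x)"
    using 1 by simp
  have lnA: "0 \<le> ln A"
    using A by simp
  \<comment> \<open>As n \<le> n^\<kappa> for \<kappa> = 1/(2x) \<ge> 1, the coefficient ln A
    absorbs the exponential with constant 0. This includes \<kappa> = 1, that is s = 1/2, because
    the parameters may grow.\<close>
  define r' where "r' = (r + ln A) * 2 powr (1 / (2 * x))"
  have r': "0 < r'"
    using r lnA by (simp add: r'_def add_pos_nonneg)
  have lin: "ln A * real n \<le> 0 + ln A * real n powr (1 / (2 * x))" for n :: nat
    using mult_left_mono[OF nat_le_powr[OF \<kappa>] lnA] by simp
  show thesis
  proof (rule that[OF r'])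
    fix q :: real assume q: "0 < q"
    have q': "0 < r' + q + ln A"
      using r' q lnA by simp
    have "A ^ (mlen (\<alpha> + \<gamma>) + mlen (\<beta> + \<gamma>)) * (real_weight s r (\<alpha> + \<gamma>) * real_weight s q \<beta>)
      \<le> exp (0 + 0) * (real_weight s r' \<alpha> * real_weight s (r' + q + ln A) (\<beta> + \<gamma>))" for \<alpha> \<beta> \<gamma> :: "'d mindex"
      unfolding 1(1) using A q r lnA
      by (intro num_real_weight_exchange[OF 1(2) A _ _ _ _ lin lin]) (auto simp: r'_def)
    then show "\<exists>q'>0. \<exists>K>0. \<forall>\<alpha> \<beta> \<gamma> :: 'd mindex.
        ennreal (A ^ (mlen (\<alpha> + \<gamma>) + mlen (\<beta> + \<gamma>))) * (vartheta s r (\<alpha> + \<gamma>) * vartheta s q \<beta>)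
        \<le> ennreal K * (vartheta s r' \<alpha> * vartheta s q' (\<beta> + \<gamma>))"
      using A q q' r r' by (intro exI[of _ "r' + q + ln A"] exI[of _ 1] conjI allI vartheta_exchangeI[OF s0]) auto
  qed
next
  case (2 \<sigma>)
  have s0: "s \<noteq> Num 0"
    using 2 by simp
  define r' where "r' = A * r * 2 powr (1 / (2 * \<sigma>))"
  have r': "0 < r'"
    using r A by (simp add: r'_def)
  show thesis
  proof (rule that[OF r'])
    fix q :: real assume q: "0 < q"
    have q': "0 < A * max r' q"
      using A q by (simp add: less_max_iff_disj)
    have "A ^ (mlen (\<alpha> + \<gamma>) + mlen (\<beta> + \<gamma>)) * (real_weight s r (\<alpha> + \<gamma>) * real_weight s q \<beta>)
      \<le> 1 * (real_weight s r' \<alpha> * real_weight s (A * max r' q) (\<beta> + \<gamma>))" for \<alpha> \<beta> \<gamma> :: "'d mindex"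
      unfolding 2(1) mult_1 using A q r q'
      by (intro flat_real_weight_exchange[OF 2(2) A]) (auto simp: r'_def)
    then show "\<exists>q'>0. \<exists>K>0. \<forall>\<alpha> \<beta> \<gamma> :: 'd mindex.
        ennreal (A ^ (mlen (\<alpha> + \<gamma>) + mlen (\<beta> + \<gamma>))) * (vartheta s r (\<alpha> + \<gamma>) * vartheta s q \<beta>)
        \<le> ennreal K * (vartheta s r' \<alpha> * vartheta s q' (\<beta> + \<gamma>))"
      using A q q' r r' by (intro exI[of _ "A * max r' q"] exI[of _ 1] conjI allI vartheta_exchangeI[OF s0]) auto
  qed
qed

section \<open>The sequence spaces as limits\<close>

text \<open>Cross multiplication with infinite denominators: for b = \<infinity> the left side is 0;
  for finite b the last assumption excludes d = \<infinity>, where the right side would be 0. The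
  finiteness clause in \<open>vartheta_exchange_lower\<close> supplies that assumption.\<close>

lemma ennreal_divide_le_divide:
  fixes x y b d :: ennreal
  assumes "x * d \<le> y * b" "0 < b" "0 < d" "b < top \<Longrightarrow> d < top"
  shows "x / b \<le> y / d"
proof (cases "b = top")
  case False
  then have "b < top" "d < top"
    using assms(4) by (auto simp: less_top)
  have "x = x * d / d"
    using assms(3) \<open>d < top\<close> by (simp add: ennreal_mult_divide_eq)
  also have "\<dots> \<le> y * b / d"
    by (intro divide_right_mono_ennreal assms(1))
  also have "\<dots> = b * (y / d)"
    by (simp add: ennreal_times_divide mult.commute)
  finally show ?thesis
    by (intro divide_le_posI_ennreal assms(2))
qed simp

lemma ennreal_divide_mono:
  fixes x y b d :: ennreal
  assumes "x \<le> y" "d \<le> b"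
  shows "x / b \<le> y / d"
proof -
  have "inverse b \<le> inverse d"
  proof (cases "d = 0 \<or> b = top")
    case False
    then obtain q r where qr: "b = ennreal q" "0 \<le> q" "d = ennreal r" "0 < r"
      using assms(2) by (cases b; cases d) (auto simp: top_unique)
    moreover have "r \<le> q"
      using assms(2) qr by simp
    ultimately show ?thesis
      by (simp add: inverse_ennreal ennreal_leI le_imp_inverse_le)
  qed auto
  with assms(1) show ?thesis
    unfolding divide_ennreal_def by (intro mult_mono) auto
qed

lemma ennreal_divide_less_top:
  fixes x b :: ennreal
  assumes "x < top" "0 < b"
  shows "x / b < top"
proof -
  have "x / b \<noteq> top"
    using assms by (auto simp: ennreal_divide_eq_top_iff)
  then show ?thesis
    by (simp add: less_top)
qed

lemma diag_below_swap: "diag_below (prod.swap j) (prod.swap k) \<longleftrightarrow> diag_below j k"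
  by (auto simp: diag_below_def prod.swap_def prod_eq_iff)

lemma idx_len_swap: "idx_len (prod.swap k) = idx_len k"
  by (simp add: idx_len_def)

text \<open>The starred weights are the plain ones with the components interchanged, and diagonal
  shifts and \<open>idx_len\<close> are invariant under this; so each starred space reduces to an
  unstarred one.\<close>

lemma proj_ind_weights_swap:
  assumes "proj_ind_weights p W"
  shows "proj_ind_weights p (\<lambda>a b k. W a b (prod.swap k))"
proof -
  interpret proj_ind_weights p W
    by (rule assms)
  show ?thesis
  proof
    show "0 < p"
      by (rule p_pos)
    show "\<exists>b>0. \<forall>k. W a b (prod.swap k) \<le> W a b1 (prod.swap k) \<and> W a b (prod.swap k) \<le> W a b2 (prod.swap k)"
      if "0 < a" "0 < b1" "0 < b2" for a b1 b2
      using directed[OF that] by blast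
    show "\<exists>a'>0. \<forall>b>0. \<exists>b'>0. \<exists>K>0. \<forall>j k. diag_below j k \<longrightarrow>
        ennreal (A ^ idx_len k) * W a b' (prod.swap k) \<le> ennreal K * W a' b (prod.swap j)"
      if "1 \<le> A" "0 < a" for A a
      using raising[OF that] by (metis diag_below_swap idx_len_swap)
  qed
qed

lemma ind_proj_weights_swap:
  assumes "ind_proj_weights p W"
  shows "ind_proj_weights p (\<lambda>a b k. W a b (prod.swap k))"
proof -
  interpret ind_proj_weights p W
    by (rule assms)
  show ?thesis
  proof
    show "0 < p"
      by (rule p_pos)
    show "\<exists>a>0. \<forall>b>0. \<forall>k. W a b (prod.swap k) \<le> W a1 b (prod.swap k) \<and> W a b (prod.swap k) \<le> W a2 b (prod.swap k)"
      if "0 < a1" "0 < a2" for a1 a2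
      using directed[OF that] by blast
    show "\<exists>b>0. W a b (prod.swap k) \<noteq> 0" if "0 < a" for a k
      using nonzero[OF that] .
    show "\<exists>a>0. \<forall>b>0. W a b (prod.swap k) < \<infinity>" for k
      using finite_at .
    show "\<exists>a'>0. \<forall>b>0. \<exists>b'>0. \<exists>K>0. \<forall>j k. diag_below j k \<longrightarrow>
        ennreal (A ^ idx_len k) * W a' b (prod.swap j) \<le> ennreal K * W a b' (prod.swap k) \<or>
        (\<exists>b''>0. W a b'' (prod.swap k) = \<infinity>)"
      if "1 \<le> A" "0 < a" for A a
      using lowering[OF that] by (metis diag_below_swap idx_len_swap)
  qed
qed

lemma omega_apply: "omega s r2 r1 k = vartheta s r2 (fst k) / vartheta s r1 (snd k)"
  by (simp add: omega_def case_prod_beta)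

lemma omega_star_eq_swap: "omega_star s r2 r1 = (\<lambda>k. omega s r1 r2 (prod.swap k))"
  by (simp add: omega_star_def omega_def fun_eq_iff)

lemma diag_below_iff: "diag_below j k \<longleftrightarrow> (\<exists>\<alpha> \<beta> \<gamma>. j = (\<alpha>, \<beta>) \<and> k = (\<alpha> + \<gamma>, \<beta> + \<gamma>))"
  by (cases j) (simp add: diag_below_def)

text \<open>The projective parameter a sits in the denominator, at \<beta> + \<gamma>. Since a' must
  be found before b is known, the exchange has to treat that index first, which is the order of
  choices in \<open>vartheta_exchange_lower\<close>.\<close>

lemma proj_ind_weights_B:
  assumes "0 < p" "s \<in> flat_reals" "s < Num (1/2)"
  shows "proj_ind_weights p (\<lambda>a b. omega s b a :: 'd::finite mindex \<times> 'd mindex \<Rightarrow> ennreal)"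
proof
  fix a b1 b2 :: real assume "0 < a" "0 < b1" "0 < b2"
  obtain b where "0 < b" "\<And>\<alpha> :: 'd mindex. vartheta s b \<alpha> \<le> vartheta s b1 \<alpha>"
    "\<And>\<alpha> :: 'd mindex. vartheta s b \<alpha> \<le> vartheta s b2 \<alpha>"
    using vartheta_directed_below[OF \<open>0 < b1\<close> \<open>0 < b2\<close>] by metis
  then show "\<exists>b>0. \<forall>k :: 'd mindex \<times> 'd mindex. omega s b a k \<le> omega s b1 a k \<and> omega s b a k \<le> omega s b2 a k"
    by (intro exI[of _ b]) (simp add: omega_apply divide_right_mono_ennreal)
next
  fix A a :: real assume A: "1 \<le> A" and a: "0 < a"
  obtain a' where a': "0 < a'" "\<And>\<alpha> \<gamma> :: 'd mindex. vartheta s a (\<alpha> + \<gamma>) < top \<Longrightarrow> vartheta s a' \<alpha> < top"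
    and ex: "\<And>b. 0 < b \<Longrightarrow> \<exists>b'>0. \<exists>K>0. \<forall>\<alpha> \<beta> \<gamma> :: 'd mindex.
      ennreal (A ^ (mlen (\<alpha> + \<gamma>) + mlen (\<beta> + \<gamma>))) * (vartheta s b' (\<alpha> + \<gamma>) * vartheta s a' \<beta>)
      \<le> ennreal K * (vartheta s b \<alpha> * vartheta s a (\<beta> + \<gamma>))"
    by (rule vartheta_exchange_lower[OF assms(2,3) A a]) blast
  have "\<exists>b'>0. \<exists>K>0. \<forall>j k :: 'd mindex \<times> 'd mindex. diag_below j k \<longrightarrow>
      ennreal (A ^ idx_len k) * omega s b' a k \<le> ennreal K * omega s b a' j" if b: "0 < b" for b
  proof -
    obtain b' K where b': "0 < b'" "0 < K" and le: "\<And>\<alpha> \<beta> \<gamma> :: 'd mindex.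
        ennreal (A ^ (mlen (\<alpha> + \<gamma>) + mlen (\<beta> + \<gamma>))) * (vartheta s b' (\<alpha> + \<gamma>) * vartheta s a' \<beta>)
        \<le> ennreal K * (vartheta s b \<alpha> * vartheta s a (\<beta> + \<gamma>))"
      using ex[OF b] by blast
    have "ennreal (A ^ idx_len k) * omega s b' a k \<le> ennreal K * omega s b a' j"
      if "diag_below j k" for j k :: "'d mindex \<times> 'd mindex"
    proof -
      obtain \<alpha> \<beta> \<gamma> where jk: "j = (\<alpha>, \<beta>)" "k = (\<alpha> + \<gamma>, \<beta> + \<gamma>)"
        using \<open>diag_below j k\<close> unfolding diag_below_iff by blast
      show ?thesis
        unfolding omega_apply ennreal_times_divide
        using le[of \<alpha> \<gamma> \<beta>] a'(2)[of \<beta> \<gamma>] a' a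
        by (intro ennreal_divide_le_divide vartheta_pos) (simp_all add: jk idx_len_def mult.assoc)
    qed
    then show ?thesis
      using b' by blast
  qed
  then show "\<exists>a'>0. \<forall>b>0. \<exists>b'>0. \<exists>K>0. \<forall>j k :: 'd mindex \<times> 'd mindex. diag_below j k \<longrightarrow>
      ennreal (A ^ idx_len k) * omega s b' a k \<le> ennreal K * omega s b a' j"
    using a'(1) by blast
qed (rule assms)

text \<open>Here the given parameter belongs to the numerator, at \<alpha> + \<gamma>, and
  \<open>vartheta_exchange_raise\<close> has the choices in the right order. The inductive parameter
  sits in the denominator, so enlarging it lowers the weight.\<close>

lemma proj_ind_weights_B0:
  assumes "0 < p" "s \<in> flat_reals" "Num 0 < s" "s \<le> Num (1/2)"
  shows "proj_ind_weights p (\<lambda>a b. omega s a b :: 'd::finite mindex \<times> 'd mindex \<Rightarrow> ennreal)"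
proof
  have s0: "s \<noteq> Num 0"
    using assms(3) by auto
  fix a b1 b2 :: real assume "0 < a" "0 < b1" "0 < b2"
  obtain b where "0 < b" "\<And>\<alpha> :: 'd mindex. vartheta s b1 \<alpha> \<le> vartheta s b \<alpha>"
    "\<And>\<alpha> :: 'd mindex. vartheta s b2 \<alpha> \<le> vartheta s b \<alpha>"
    using vartheta_directed_above[OF s0 \<open>0 < b1\<close> \<open>0 < b2\<close>] by metis
  then show "\<exists>b>0. \<forall>k :: 'd mindex \<times> 'd mindex. omega s a b k \<le> omega s a b1 k \<and> omega s a b k \<le> omega s a b2 k"
    by (intro exI[of _ b]) (simp add: omega_apply ennreal_divide_mono)
next
  have s0: "s \<noteq> Num 0"
    using assms(3) by auto
  fix A a :: real assume A: "1 \<le> A" and a: "0 < a"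
  obtain a' where a': "0 < a'"
    and ex: "\<And>b. 0 < b \<Longrightarrow> \<exists>b'>0. \<exists>K>0. \<forall>\<alpha> \<beta> \<gamma> :: 'd mindex.
      ennreal (A ^ (mlen (\<alpha> + \<gamma>) + mlen (\<beta> + \<gamma>))) * (vartheta s a (\<alpha> + \<gamma>) * vartheta s b \<beta>)
      \<le> ennreal K * (vartheta s a' \<alpha> * vartheta s b' (\<beta> + \<gamma>))"
    by (rule vartheta_exchange_raise[OF assms(2-4) A a]) blast
  have "\<exists>b'>0. \<exists>K>0. \<forall>j k :: 'd mindex \<times> 'd mindex. diag_below j k \<longrightarrow>
      ennreal (A ^ idx_len k) * omega s a b' k \<le> ennreal K * omega s a' b j" if b: "0 < b" for b
  proof -
    obtain b' K where b': "0 < b'" "0 < K" and le: "\<And>\<alpha> \<beta> \<gamma> :: 'd mindex.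
        ennreal (A ^ (mlen (\<alpha> + \<gamma>) + mlen (\<beta> + \<gamma>))) * (vartheta s a (\<alpha> + \<gamma>) * vartheta s b \<beta>)
        \<le> ennreal K * (vartheta s a' \<alpha> * vartheta s b' (\<beta> + \<gamma>))"
      using ex[OF b] by blast
    have "ennreal (A ^ idx_len k) * omega s a b' k \<le> ennreal K * omega s a' b j"
      if "diag_below j k" for j k :: "'d mindex \<times> 'd mindex"
    proof -
      obtain \<alpha> \<beta> \<gamma> where jk: "j = (\<alpha>, \<beta>)" "k = (\<alpha> + \<gamma>, \<beta> + \<gamma>)"
        using \<open>diag_below j k\<close> unfolding diag_below_iff by blast
      show ?thesis
        unfolding omega_apply ennreal_times_divide
        using le[of \<alpha> \<gamma> \<beta>] b b'
        by (intro ennreal_divide_le_divide vartheta_pos vartheta_less_top[OF s0]) (simp_all add: jk idx_len_def mult.assoc)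
    qed
    then show ?thesis
      using b' by blast
  qed
  then show "\<exists>a'>0. \<forall>b>0. \<exists>b'>0. \<exists>K>0. \<forall>j k :: 'd mindex \<times> 'd mindex. diag_below j k \<longrightarrow>
      ennreal (A ^ idx_len k) * omega s a b' k \<le> ennreal K * omega s a' b j"
    using a'(1) by blast
qed (rule assms)

lemma ind_proj_weights_C:
  assumes "0 < p" "s \<in> flat_reals" "s < Num (1/2)"
  shows "ind_proj_weights p (\<lambda>a b. omega s a b :: 'd::finite mindex \<times> 'd mindex \<Rightarrow> ennreal)"
proof
  fix a1 a2 :: real assume "0 < a1" "0 < a2"
  obtain a where "0 < a" "\<And>\<alpha> :: 'd mindex. vartheta s a \<alpha> \<le> vartheta s a1 \<alpha>"
    "\<And>\<alpha> :: 'd mindex. vartheta s a \<alpha> \<le> vartheta s a2 \<alpha>"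
    using vartheta_directed_below[OF \<open>0 < a1\<close> \<open>0 < a2\<close>] by metis
  then show "\<exists>a>0. \<forall>b>0. \<forall>k :: 'd mindex \<times> 'd mindex. omega s a b k \<le> omega s a1 b k \<and> omega s a b k \<le> omega s a2 b k"
    by (intro exI[of _ a]) (simp add: omega_apply divide_right_mono_ennreal)
next
  fix a :: real and k :: "'d mindex \<times> 'd mindex" assume a: "0 < a"
  obtain b where "0 < b" "vartheta s b (snd k) < top"
    using vartheta_finite_at by metis
  then show "\<exists>b>0. omega s a b k \<noteq> 0"
    using vartheta_pos[OF a, of s "fst k"] by (intro exI[of _ b]) (auto simp: omega_apply)
next
  fix k :: "'d mindex \<times> 'd mindex"
  obtain a where a: "0 < a" "vartheta s a (fst k) < top"
    using vartheta_finite_at by metis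
  have "omega s a b k < \<infinity>" if "0 < b" for b
    unfolding omega_apply infinity_ennreal_def by (intro ennreal_divide_less_top a vartheta_pos that)
  then show "\<exists>a>0. \<forall>b>0. omega s a b k < \<infinity>"
    using a(1) by blast
next
  fix A a :: real assume A: "1 \<le> A" and a: "0 < a"
  obtain a' where a': "0 < a'"
    and ex: "\<And>b. 0 < b \<Longrightarrow> \<exists>b'>0. \<exists>K>0. \<forall>\<alpha> \<beta> \<gamma> :: 'd mindex.
      ennreal (A ^ (mlen (\<alpha> + \<gamma>) + mlen (\<beta> + \<gamma>))) * (vartheta s b' (\<alpha> + \<gamma>) * vartheta s a' \<beta>)
      \<le> ennreal K * (vartheta s b \<alpha> * vartheta s a (\<beta> + \<gamma>))"
    by (rule vartheta_exchange_lower[OF assms(2,3) A a]) blast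
  have "\<exists>b'>0. \<exists>K>0. \<forall>j k :: 'd mindex \<times> 'd mindex. diag_below j k \<longrightarrow>
      ennreal (A ^ idx_len k) * omega s a' b j \<le> ennreal K * omega s a b' k \<or> (\<exists>b''>0. omega s a b'' k = \<infinity>)"
    if b: "0 < b" for b
  proof -
    obtain b' K where b': "0 < b'" "0 < K" and le: "\<And>\<alpha> \<beta> \<gamma> :: 'd mindex.
        ennreal (A ^ (mlen (\<alpha> + \<gamma>) + mlen (\<beta> + \<gamma>))) * (vartheta s b' (\<alpha> + \<gamma>) * vartheta s a' \<beta>)
        \<le> ennreal K * (vartheta s b \<alpha> * vartheta s a (\<beta> + \<gamma>))"
      using ex[OF b] by blast
    have "ennreal (A ^ idx_len k) * omega s a' b j \<le> ennreal K * omega s a b' k \<or> (\<exists>b''>0. omega s a b'' k = \<infinity>)"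
      if "diag_below j k" for j k :: "'d mindex \<times> 'd mindex"
    proof -
      obtain \<alpha> \<beta> \<gamma> where jk: "j = (\<alpha>, \<beta>)" "k = (\<alpha> + \<gamma>, \<beta> + \<gamma>)"
        using \<open>diag_below j k\<close> unfolding diag_below_iff by blast
      \<comment> \<open>The kernel is transposed and the sequence is weighted at the larger index
        \<open>k\<close>, so the exchange inequality is used with \<alpha> and \<beta>
        interchanged.\<close>
      have le': "(ennreal (A ^ idx_len k) * vartheta s a' \<alpha>) * vartheta s b' (\<beta> + \<gamma>)
          \<le> (ennreal K * vartheta s a (\<alpha> + \<gamma>)) * vartheta s b \<beta>"
        using le[of \<beta> \<gamma> \<alpha>] by (simp add: jk idx_len_def add.commute mult_ac)
      show ?thesis
      proof (cases "vartheta s a (\<alpha> + \<gamma>) = top")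
        case True
        \<comment> \<open>The numerator is infinite; a parameter making the denominator finite gives
          an infinite weight.\<close>
        obtain b'' where "0 < b''" "vartheta s b'' (\<beta> + \<gamma>) < top"
          using vartheta_finite_at by metis
        with True have "omega s a b'' k = \<infinity>"
          by (auto simp: omega_apply jk ennreal_top_divide)
        then show ?thesis
          using \<open>0 < b''\<close> by blast
      next
        case False
        \<comment> \<open>Finiteness of the denominator is read off from the exchange inequality:
          its right-hand side is finite, and the other factor on the left is nonzero.\<close>
        have "vartheta s b' (\<beta> + \<gamma>) < top" if "vartheta s b \<beta> < top"
        proof -
          have "(ennreal K * vartheta s a (\<alpha> + \<gamma>)) * vartheta s b \<beta> < top"
            using that False by (simp add: ennreal_mult_less_top less_top)
          then have "(ennreal (A ^ idx_len k) * vartheta s a' \<alpha>) * vartheta s b' (\<beta> + \<gamma>) < top"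
            using le' by (rule le_less_trans[rotated])
          moreover have "ennreal (A ^ idx_len k) * vartheta s a' \<alpha> \<noteq> 0"
            using A vartheta_pos[OF a', of s \<alpha>] by (auto simp: not_le)
          ultimately show ?thesis
            by (auto simp: ennreal_mult_less_top)
        qed
        then have "ennreal (A ^ idx_len k) * omega s a' b j \<le> ennreal K * omega s a b' k"
          unfolding omega_apply ennreal_times_divide jk fst_conv snd_conv
          using le'[unfolded jk] b b' by (intro ennreal_divide_le_divide vartheta_pos) auto
        then show ?thesis
          by blast
      qed
    qed
    then show ?thesis
      using b' by blast
  qed
  then show "\<exists>a'>0. \<forall>b>0. \<exists>b'>0. \<exists>K>0. \<forall>j k :: 'd mindex \<times> 'd mindex. diag_below j k \<longrightarrow>
      ennreal (A ^ idx_len k) * omega s a' b j \<le> ennreal K * omega s a b' k \<or> (\<exists>b''>0. omega s a b'' k = \<infinity>)"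
    using a'(1) by blast
qed (rule assms)

text \<open>Away from s = 0 all weights lie strictly between 0 and \<infinity>, which settles
  \<open>nonzero\<close> and \<open>finite_at\<close>; \<open>lowering\<close> is the raising
  exchange with the two indices interchanged.\<close>

lemma ind_proj_weights_C0:
  assumes "0 < p" "s \<in> flat_reals" "Num 0 < s" "s \<le> Num (1/2)"
  shows "ind_proj_weights p (\<lambda>a b. omega s b a :: 'd::finite mindex \<times> 'd mindex \<Rightarrow> ennreal)"
proof -
  have s0: "s \<noteq> Num 0"
    using assms(3) by auto
  have between: "0 < omega s r2 r1 k" "omega s r2 r1 k < \<infinity>" if "0 < r1" "0 < r2"
    for r1 r2 and k :: "'d mindex \<times> 'd mindex"
    unfolding omega_apply infinity_ennreal_def
    by (simp_all add: ennreal_zero_less_divide ennreal_divide_less_top vartheta_pos vartheta_less_top s0 that)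
  show ?thesis
  proof
    fix a1 a2 :: real assume "0 < a1" "0 < a2"
    obtain a where "0 < a" "\<And>\<alpha> :: 'd mindex. vartheta s a1 \<alpha> \<le> vartheta s a \<alpha>"
      "\<And>\<alpha> :: 'd mindex. vartheta s a2 \<alpha> \<le> vartheta s a \<alpha>"
      using vartheta_directed_above[OF s0 \<open>0 < a1\<close> \<open>0 < a2\<close>] by metis
    then show "\<exists>a>0. \<forall>b>0. \<forall>k :: 'd mindex \<times> 'd mindex. omega s b a k \<le> omega s b a1 k \<and> omega s b a k \<le> omega s b a2 k"
      by (intro exI[of _ a]) (simp add: omega_apply ennreal_divide_mono)
  next
    show "\<exists>b>0. omega s b a k \<noteq> 0" if "0 < a" for a and k :: "'d mindex \<times> 'd mindex"
      using between(1)[OF that zero_less_one] zero_less_one by (metis less_irrefl)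
    show "\<exists>a>0. \<forall>b>0. omega s b a k < \<infinity>" for k :: "'d mindex \<times> 'd mindex"
      using between(2)[OF zero_less_one] zero_less_one by blast
  next
    fix A a :: real assume A: "1 \<le> A" and a: "0 < a"
    obtain a' where a': "0 < a'"
      and ex: "\<And>b. 0 < b \<Longrightarrow> \<exists>b'>0. \<exists>K>0. \<forall>\<alpha> \<beta> \<gamma> :: 'd mindex.
        ennreal (A ^ (mlen (\<alpha> + \<gamma>) + mlen (\<beta> + \<gamma>))) * (vartheta s a (\<alpha> + \<gamma>) * vartheta s b \<beta>)
        \<le> ennreal K * (vartheta s a' \<alpha> * vartheta s b' (\<beta> + \<gamma>))"
      by (rule vartheta_exchange_raise[OF assms(2-4) A a]) blast
    have "\<exists>b'>0. \<exists>K>0. \<forall>j k :: 'd mindex \<times> 'd mindex. diag_below j k \<longrightarrow>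
        ennreal (A ^ idx_len k) * omega s b a' j \<le> ennreal K * omega s b' a k \<or> (\<exists>b''>0. omega s b'' a k = \<infinity>)"
      if b: "0 < b" for b
    proof -
      obtain b' K where b': "0 < b'" "0 < K" and le: "\<And>\<alpha> \<beta> \<gamma> :: 'd mindex.
          ennreal (A ^ (mlen (\<alpha> + \<gamma>) + mlen (\<beta> + \<gamma>))) * (vartheta s a (\<alpha> + \<gamma>) * vartheta s b \<beta>)
          \<le> ennreal K * (vartheta s a' \<alpha> * vartheta s b' (\<beta> + \<gamma>))"
        using ex[OF b] by blast
      have "ennreal (A ^ idx_len k) * omega s b a' j \<le> ennreal K * omega s b' a k"
        if "diag_below j k" for j k :: "'d mindex \<times> 'd mindex"
      proof -
        obtain \<alpha> \<beta> \<gamma> where jk: "j = (\<alpha>, \<beta>)" "k = (\<alpha> + \<gamma>, \<beta> + \<gamma>)"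
          using \<open>diag_below j k\<close> unfolding diag_below_iff by blast
        have "(ennreal (A ^ idx_len k) * vartheta s b \<alpha>) * vartheta s a (\<beta> + \<gamma>)
            \<le> (ennreal K * vartheta s b' (\<alpha> + \<gamma>)) * vartheta s a' \<beta>"
          using le[of \<beta> \<gamma> \<alpha>] by (simp add: jk idx_len_def add.commute mult_ac)
        then show ?thesis
          unfolding omega_apply ennreal_times_divide jk fst_conv snd_conv
          using a a' by (intro ennreal_divide_le_divide vartheta_pos vartheta_less_top[OF s0]) auto
      qed
      then show ?thesis
        using b' by (intro exI[of _ b'] exI[of _ K] conjI allI impI disjI1)
    qed
    then show "\<exists>a'>0. \<forall>b>0. \<exists>b'>0. \<exists>K>0. \<forall>j k :: 'd mindex \<times> 'd mindex. diag_below j k \<longrightarrow>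
        ennreal (A ^ idx_len k) * omega s b a' j \<le> ennreal K * omega s b' a k \<or> (\<exists>b''>0. omega s b'' a k = \<infinity>)"
      using a'(1) by blast
  qed (rule assms)
qed

section \<open>Continuity on the full and the finite sequences\<close>

lemma continuous_linear_op_ell0'I:
  fixes T :: "'d::finite seq2 \<Rightarrow> 'd seq2"
  assumes "\<And>k. continuous_on UNIV (\<lambda>c. T c k)" "linear_op_on UNIV T"
  shows "continuous_linear_op ell0' T"
proof -
  have eq: "ell0' = (euclidean :: 'd seq2 topology)"
    by (simp add: ell0'_def euclidean_product_topology)
  show ?thesis
    using assms continuous_on_coordinatewise_then_product[of UNIV T]
    unfolding continuous_linear_op_def linear_op_on_def eq by simp
qed

lemma continuous_linear_op_T0: "continuous_linear_op ell0' (T0 t)"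
  by (rule continuous_linear_op_ell0'I[OF _ linear_op_on_T0])
    (auto simp: T0_eq_sum intro!: continuous_intros)

lemma continuous_linear_op_S0: "continuous_linear_op ell0' S0"
  by (rule continuous_linear_op_ell0'I[OF _ linear_op_on_S0])
    (auto simp: S0_apply intro!: continuous_intros)

text \<open>A linear self-map of the finite sequences is continuous for the finest locally convex
  topology, because the pullback of any locally convex topology along it is again one of those in
  the supremum.\<close>

lemma continuous_linear_op_T0_adj: "continuous_linear_op (ell0 :: 'd::finite seq2 topology) (T0_adj t)"
proof -
  let ?X = "{c :: 'd seq2. finite {k. c k \<noteq> 0}}"
  have X: "topspace (finest_lc ?X (\<lambda>_. True)) = ?X"
    using topspace_ell0 unfolding ell0_def .
  have linX: "lin_subspace ?X"
    by (rule lin_subspace_finite_support)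
  have lin: "linear_op_on ?X (T0_adj t)"
    unfolding T0_adj_eq_kernel_op
  proof (rule linear_op_on_kernel_op)
    fix c :: "'d seq2" and j assume "c \<in> ?X"
    then show "(\<lambda>k. shift_kernel t k j * c k) summable_on UNIV"
      by (intro finite_nonzero_values_imp_summable_on) (auto elim!: rev_finite_subset)
  qed
  have maps: "T0_adj t \<in> ?X \<rightarrow> ?X"
    using finite_support_T0_adj by auto
  have "continuous_map (finest_lc ?X (\<lambda>_. True)) (finest_lc ?X (\<lambda>_. True)) (T0_adj t)"
  proof (rule continuous_map_into_finest_lc[OF _ X])
    fix \<tau> :: "'d seq2 topology" assume \<tau>: "locally_convex \<tau>" "topspace \<tau> = ?X"
    let ?\<sigma> = "pullback_topology ?X (T0_adj t) \<tau>"
    have "locally_convex ?\<sigma>"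
      using maps \<tau> by (intro locally_convex_pullback linX lin) simp_all
    moreover have "topspace ?\<sigma> = ?X"
      unfolding topspace_pullback_topology \<tau>(2) using maps by (intro Int_absorb1 subsetI) (simp only: vimage_eq Pi_iff)
    ultimately have "continuous_map (finest_lc ?X (\<lambda>_. True)) ?\<sigma> id"
      by (intro continuous_map_finest_lc_id X) simp_all
    moreover have "continuous_map ?\<sigma> \<tau> (T0_adj t)"
      using continuous_map_pullback[OF continuous_map_id, of ?X "T0_adj t" \<tau>] by simp
    ultimately show "continuous_map (finest_lc ?X (\<lambda>_. True)) \<tau> (T0_adj t)"
      using continuous_map_compose[of _ ?\<sigma> id \<tau> "T0_adj t"] by simp
  qed (use maps X in simp)
  then show ?thesis
    using lin unfolding continuous_linear_op_def linear_op_on_def topspace_ell0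
    by (simp only: ell0_def)
qed

theorem proposition3p6:
  fixes t :: complex and s s\<^sub>0 :: flat_real and p :: ennreal
  assumes "0 < p"
    and "s \<in> flat_reals" and "s < Num (1/2)"
    and "s\<^sub>0 \<in> flat_reals" and "Num 0 < s\<^sub>0" and "s\<^sub>0 \<le> Num (1/2)"
  shows "continuous_linear_op (ell0' :: 'd::finite seq2 topology) (T0 t) \<and>
    continuous_linear_op (ell0' :: 'd seq2 topology) S0 \<and>
    continuous_linear_op (ell0 :: 'd seq2 topology) (T0_adj t) \<and>
    (\<forall>X \<in> {ell_B p s, ell_B_star p s, ell_B0 p s\<^sub>0, ell_B0_star p s\<^sub>0 :: 'd seq2 topology}.
       homeomorphic_maps X X (T0 t) (T0 (- t)) \<and>
       S0 ` topspace X = topspace X \<and>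
       (\<forall>c\<in>topspace X. T0 (- t) c = (inv S0 \<circ> T0 t \<circ> S0) c)) \<and>
    (\<forall>X \<in> {ell_C p s, ell_C_star p s, ell_C0 p s\<^sub>0, ell_C0_star p s\<^sub>0 :: 'd seq2 topology}.
       \<exists>F G. unique_extension ell0 X (T0_adj t) F \<and>
             unique_extension ell0 X (T0_adj (- t)) G \<and>
             homeomorphic_maps X X F G \<and>
             S0 ` topspace X = topspace X \<and>
             (\<forall>c\<in>topspace X. G c = (inv S0 \<circ> F \<circ> S0) c))"
proof (intro conjI)
  show "continuous_linear_op (ell0' :: 'd seq2 topology) (T0 t)"
    by (rule continuous_linear_op_T0)
  show "continuous_linear_op (ell0' :: 'd seq2 topology) S0"
    by (rule continuous_linear_op_S0)
  show "continuous_linear_op (ell0 :: 'd seq2 topology) (T0_adj t)"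
    by (rule continuous_linear_op_T0_adj)
next
  note B = proj_ind_weights_B[OF assms(1-3), where 'd = 'd]
  note B0 = proj_ind_weights_B0[OF assms(1,4-6), where 'd = 'd]
  note hom = proj_ind_weights.T0_homeomorphic_maps
  show "\<forall>X \<in> {ell_B p s, ell_B_star p s, ell_B0 p s\<^sub>0, ell_B0_star p s\<^sub>0 :: 'd seq2 topology}.
      homeomorphic_maps X X (T0 t) (T0 (- t)) \<and> S0 ` topspace X = topspace X \<and>
      (\<forall>c\<in>topspace X. T0 (- t) c = (inv S0 \<circ> T0 t \<circ> S0) c)"
    unfolding ball_simps(5,7) ell_B_def ell_B_star_def ell_B0_def ell_B0_star_def omega_star_eq_swap
    by (rule conjI[OF hom[OF B] conjI[OF hom[OF proj_ind_weights_swap[OF B]]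
        conjI[OF hom[OF B0] conjI[OF hom[OF proj_ind_weights_swap[OF B0]] TrueI]]]])
next
  note C = ind_proj_weights_C[OF assms(1-3), where 'd = 'd]
  note C0 = ind_proj_weights_C0[OF assms(1,4-6), where 'd = 'd]
  note hom = ind_proj_weights.T0_adj_homeomorphic_maps
  show "\<forall>X \<in> {ell_C p s, ell_C_star p s, ell_C0 p s\<^sub>0, ell_C0_star p s\<^sub>0 :: 'd seq2 topology}.
      \<exists>F G. unique_extension ell0 X (T0_adj t) F \<and> unique_extension ell0 X (T0_adj (- t)) G \<and>
        homeomorphic_maps X X F G \<and> S0 ` topspace X = topspace X \<and>
        (\<forall>c\<in>topspace X. G c = (inv S0 \<circ> F \<circ> S0) c)"
    unfolding ball_simps(5,7) ell_C_def ell_C_star_def ell_C0_def ell_C0_star_def omega_star_eq_swap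
    by (rule conjI[OF hom[OF C] conjI[OF hom[OF ind_proj_weights_swap[OF C]]
        conjI[OF hom[OF C0] conjI[OF hom[OF ind_proj_weights_swap[OF C0]] TrueI]]]])
qed

end
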